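(* Let $\mathcal{G}$ be a connected finite metric graph with non-empty set of boundary vertices, let $\tfrac12<\beta<1$, and let $p,r\in C[\mathcal{G}]$ satisfy $0<a_0\le p^{(i)}\le a_1<+\infty$ and $0<R_0\le r^{(i)}\le R_1<+\infty$ on every edge $e_i$. Consider the fractional Sturm–Liouville eigenvalue problem on $\mathcal{G}$ described in the context, with eigenvalues and eigenfunctions understood in the generalized sense given there. Then the eigenvalues, repeated according to multiplicity, form an infinite sequence $(\lambda_k)_{k\ge1}$ with corresponding eigenfunctions $(u_k)_{k\ge 1}$ such that: 1) $0<\lambda_1\le\lambda_2\le\lambda_3\le\dots$; 2) $\lambda_k\to\infty$ as $k\to\infty$; 3) the functions $u_k$ form a complete orthonormal basis of $L_2(\mathcal{G})$ with respect to the norm $\|u\|_{1,L_2(\mathcal{G})}=\left(\int_{\mathcal{G}} r u^2\,d\mathcal{G}\right)^{1/2}$ (and its associated inner product $\int_{\mathcal{G}} r u v\,d\mathcal{G}$).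
   Context: All functions are real-valued. Graph. A metric graph $\mathcal{G}$ has finitely many vertices $V$ and finitely many edges $e_1,\dots,e_n$; edge $e_i$ has length $l_i>0$ and is identified with the interval $(0,l_i)$ with coordinate $x$ (so it has a left end $x=0$ and a right end $x=l_i$). An edge $e$ is incident with a vertex $\nu$ (written $e\sim\nu$) if $\nu$ is an end of $e$; the valency of $\nu$ is the number of edges incident with it; $\nu$ is a boundary vertex if its valency is one; $\partial\mathcal{G}\subset V$ is the set of boundary vertices. For $u:\mathcal{G}\to\mathbb{R}$ write $u^{(i)}=u|_{e_i}$ and $\int_{\mathcal{G}}u\,d\mathcal{G}=\sum_{i=1}^n\int_0^{l_i}u^{(i)}(x)\,dx$. $C[\mathcal{G}]$ is the space of functions uniformly continuous on each edge; $C(\mathcal{G})$ is the space of functions continuous on the whole graph (i.e. continuous up to the ends of each edge, with agreeing limits at every vertex along all incident edge ends). $L_2(\mathcal{G})=\bigoplus_i L_2(0,l_i)$ with $(u,v)_{L_2(\mathcal{G})}=\int_{\mathcal{G}}uv\,d\mathcal{G}$. Fractional operators. For $0<\alpha<1$, $I^\alpha_{0,x}y(x)=\frac1{\Gamma(\alpha)}\int_0^x\frac{y(\xi)}{(x-\xi)^{1-\alpha}}d\xi$; the left Riemann–Liouville derivative is $D^\beta_{0,x}y=\frac{d}{dx}I^{1-\beta}_{0,x}y$; the right Caputo derivative is $\partial^\beta_{x,l}y(x)=\frac{-1}{\Gamma(1-\beta)}\int_x^l\frac{y'(\xi)}{(\xi-x)^\beta}d\xi$. Put $D_+^\beta u=(D^\beta_{0,x}u^{(1)},\dots,D^\beta_{0,x}u^{(n)})$.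 Spaces. $AC^{\beta,2}_0(0,l)$ is the set of functions $f$ with $f(x)=\frac{c_0}{\Gamma(\beta)}x^{\beta-1}+I^\beta_{0,x}\phi(x)$ for a.e. $x\in[0,l]$, for some $c_0\in\mathbb{R}$, $\phi\in L_2(0,l)$ (then $I^{1-\beta}_{0,x}f(x)=c_0+\int_0^x\phi$ and $D^\beta_{0,x}f=\phi$). $\mathcal{H}^\beta_+(0,l)=AC^{\beta,2}_0(0,l)\cap L_2(0,l)$. $\mathcal{H}^\beta_+(\mathcal{G})=\{u\in\bigoplus_{i=1}^n\mathcal{H}^\beta_+(0,l_i): I^{1-\beta}_{0,x}u\in C(\mathcal{G})\}$, where $I^{1-\beta}_{0,x}$ is applied edgewise, and $\mathcal{H}^\beta_{+,Dir}(\mathcal{G})=\{u\in\mathcal{H}^\beta_+(\mathcal{G}): I^{1-\beta}_{0,x}u|_{\partial\mathcal{G}}=0\}$. Eigenvalue problem. On each edge, $\partial^\beta_{x,l_i}\big(p^{(i)}(x)D^\beta_{0,x}u^{(i)}(x)\big)=\lambda r^{(i)}(x)u^{(i)}(x)$; at each interior vertex $\nu\in V\setminus\partial\mathcal{G}$, $I^{1-\beta}_{0,x}u$ is continuous and $\sum_{e_i\sim\nu}\sigma_{e_i,\nu}\,p^{(i)}(\nu)D^\beta_{0,x}u^{(i)}(\nu)=0$, where $\sigma_{e_i,\nu}=1$ if $\nu$ is the right end of $e_i$ and $-1$ if it is the left end; at each $\nu\in\partial\mathcal{G}$, $I^{1-\beta}_{0,x}u(\nu)=0$. A generalized solution is a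 $u\in\mathcal{H}^\beta_{+,Dir}(\mathcal{G})$ with $$\big(p\,D_+^\beta u,D_+^\beta w\big)_{L_2(\mathcal{G})}=\lambda\,(r u,w)_{L_2(\mathcal{G})}\quad\text{for all } w\in\mathcal{H}^\beta_{+,Dir}(\mathcal{G}).$$ $\lambda$ is an eigenvalue with eigenfunction $u$ if $u\neq0$ is a generalized solution for this $\lambda$. *)

theory Defs
  imports "HOL-Analysis.Analysis" "Graph_Theory.Digraph_Component"
begin

section \<open>Metric graphs\<close>

text \<open>
  A finite metric graph is a finite multigraph together with edge lengths. The orientation of an
  arc \<open>e\<close> records its parametrisation by the interval \<open>(0, len e)\<close>: the tail is the left end
  \<open>x = 0\<close> and the head is the right end \<open>x = len e\<close>. Parallel edges and loops are allowed.
\<close>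

locale metric_graph = fin_digraph G
  for G :: "('v, 'e) pre_digraph" and len :: "'e \<Rightarrow> real" +
  assumes len_pos: "e \<in> arcs G \<Longrightarrow> 0 < len e"

definition edges_at :: "('v, 'e) pre_digraph \<Rightarrow> 'v \<Rightarrow> 'e set" where
  "edges_at G v = {e \<in> arcs G. tail G e = v \<or> head G e = v}"

text \<open>Number of incident edges, so that a loop is counted once.\<close>

definition valency :: "('v, 'e) pre_digraph \<Rightarrow> 'v \<Rightarrow> nat" where
  "valency G v = card (edges_at G v)"

definition boundary :: "('v, 'e) pre_digraph \<Rightarrow> 'v set" where
  "boundary G = {v \<in> verts G. valency G v = 1}"

section \<open>Functions on a metric graph\<close>

text \<open>
  A function on the graph is represented by the family of its restrictions to the edges; only the
  values \<open>u e x\<close> with \<open>e \<in> arcs G\<close> and \<open>0 < x < len e\<close> are relevant.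
\<close>

type_synonym 'e gfun = "'e \<Rightarrow> real \<Rightarrow> real"

definition graph_integral :: "('v, 'e) pre_digraph \<Rightarrow> ('e \<Rightarrow> real) \<Rightarrow> 'e gfun \<Rightarrow> real" where
  "graph_integral G len u = (\<Sum>e\<in>arcs G. LINT x|lebesgue_on {0<..<len e}. u e x)"

definition ae_eq :: "('v, 'e) pre_digraph \<Rightarrow> ('e \<Rightarrow> real) \<Rightarrow> 'e gfun \<Rightarrow> 'e gfun \<Rightarrow> bool" where
  "ae_eq G len u v \<longleftrightarrow> (\<forall>e\<in>arcs G. AE x in lebesgue_on {0<..<len e}. u e x = v e x)"

definition unif_continuous_on_edges ::
    "('v, 'e) pre_digraph \<Rightarrow> ('e \<Rightarrow> real) \<Rightarrow> 'e gfun \<Rightarrow> bool" where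
  "unif_continuous_on_edges G len u \<longleftrightarrow>
     (\<forall>e\<in>arcs G. uniformly_continuous_on {0<..<len e} (u e))"

text \<open>
  The function \<open>u\<close> is continuous on the whole graph with the value \<open>h v\<close> at each vertex \<open>v\<close>.
\<close>

definition continuous_with_vertex_values ::
    "('v, 'e) pre_digraph \<Rightarrow> ('e \<Rightarrow> real) \<Rightarrow> 'e gfun \<Rightarrow> ('v \<Rightarrow> real) \<Rightarrow> bool" where
  "continuous_with_vertex_values G len u h \<longleftrightarrow>
     (\<forall>e\<in>arcs G. continuous_on {0<..<len e} (u e) \<and>
        (u e \<longlongrightarrow> h (tail G e)) (at_right 0) \<and>
        (u e \<longlongrightarrow> h (head G e)) (at_left (len e)))"

definition L2_interval :: "real \<Rightarrow> (real \<Rightarrow> real) set" where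
  "L2_interval l = {f. f \<in> borel_measurable (lebesgue_on {0<..<l}) \<and>
     integrable (lebesgue_on {0<..<l}) (\<lambda>x. (f x)\<^sup>2)}"

definition L2_graph :: "('v, 'e) pre_digraph \<Rightarrow> ('e \<Rightarrow> real) \<Rightarrow> 'e gfun set" where
  "L2_graph G len = {u. \<forall>e\<in>arcs G. u e \<in> L2_interval (len e)}"

definition L2_inner :: "('v, 'e) pre_digraph \<Rightarrow> ('e \<Rightarrow> real) \<Rightarrow> 'e gfun \<Rightarrow> 'e gfun \<Rightarrow> real" where
  "L2_inner G len u v = graph_integral G len (\<lambda>e x. u e x * v e x)"

section \<open>Fractional operators and spaces\<close>

definition frac_integral :: "real \<Rightarrow> (real \<Rightarrow> real) \<Rightarrow> real \<Rightarrow> real" where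
  "frac_integral \<alpha> f x =
     1 / Gamma \<alpha> * (LINT \<xi>|lebesgue_on {0<..<x}. f \<xi> / (x - \<xi>) powr (1 - \<alpha>))"

text \<open>
  For functions in the space \<open>AC_space\<close> below the classical derivative exists almost everywhere;
  at the remaining points the value of \<^const>\<open>deriv\<close> is irrelevant, also for measurability,
  because Lebesgue measure is complete.
\<close>

definition RL_deriv :: "real \<Rightarrow> (real \<Rightarrow> real) \<Rightarrow> real \<Rightarrow> real" where
  "RL_deriv \<beta> f x = deriv (frac_integral (1 - \<beta>) f) x"

definition AC_space :: "real \<Rightarrow> real \<Rightarrow> (real \<Rightarrow> real) set" where
  "AC_space \<beta> l = {f. \<exists>c0. \<exists>\<phi>\<in>L2_interval l.
     AE x in lebesgue_on {0..l}. f x = c0 / Gamma \<beta> * x powr (\<beta> - 1) + frac_integral \<beta> \<phi> x}"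

definition H_interval :: "real \<Rightarrow> real \<Rightarrow> (real \<Rightarrow> real) set" where
  "H_interval \<beta> l = AC_space \<beta> l \<inter> L2_interval l"

definition frac_integral_graph :: "real \<Rightarrow> 'e gfun \<Rightarrow> 'e gfun" where
  "frac_integral_graph \<alpha> u = (\<lambda>e. frac_integral \<alpha> (u e))"

definition RL_deriv_graph :: "real \<Rightarrow> 'e gfun \<Rightarrow> 'e gfun" where
  "RL_deriv_graph \<beta> u = (\<lambda>e. RL_deriv \<beta> (u e))"

definition H_graph :: "('v, 'e) pre_digraph \<Rightarrow> ('e \<Rightarrow> real) \<Rightarrow> real \<Rightarrow> 'e gfun set" where
  "H_graph G len \<beta> = {u. (\<forall>e\<in>arcs G. u e \<in> H_interval \<beta> (len e)) \<and>
     (\<exists>h. continuous_with_vertex_values G len (frac_integral_graph (1 - \<beta>) u) h)}"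

definition H_graph_Dir :: "('v, 'e) pre_digraph \<Rightarrow> ('e \<Rightarrow> real) \<Rightarrow> real \<Rightarrow> 'e gfun set" where
  "H_graph_Dir G len \<beta> = {u \<in> H_graph G len \<beta>.
     \<exists>h. continuous_with_vertex_values G len (frac_integral_graph (1 - \<beta>) u) h \<and>
         (\<forall>v\<in>boundary G. h v = 0)}"

section \<open>The eigenvalue problem\<close>

definition generalized_solution ::
    "('v, 'e) pre_digraph \<Rightarrow> ('e \<Rightarrow> real) \<Rightarrow> real \<Rightarrow> 'e gfun \<Rightarrow> 'e gfun \<Rightarrow> real \<Rightarrow> 'e gfun \<Rightarrow> bool"
  where
  "generalized_solution G len \<beta> p r \<mu> u \<longleftrightarrow> u \<in> H_graph_Dir G len \<beta> \<and>
     (\<forall>w\<in>H_graph_Dir G len \<beta>.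
        L2_inner G len (\<lambda>e x. p e x * RL_deriv_graph \<beta> u e x) (RL_deriv_graph \<beta> w) =
        \<mu> * L2_inner G len (\<lambda>e x. r e x * u e x) w)"

text \<open>As in \<open>L\<^sub>2\<close>, functions that agree almost everywhere are identified.\<close>

definition eigenfunction ::
    "('v, 'e) pre_digraph \<Rightarrow> ('e \<Rightarrow> real) \<Rightarrow> real \<Rightarrow> 'e gfun \<Rightarrow> 'e gfun \<Rightarrow> real \<Rightarrow> 'e gfun \<Rightarrow> bool"
  where
  "eigenfunction G len \<beta> p r \<mu> u \<longleftrightarrow>
     generalized_solution G len \<beta> p r \<mu> u \<and> \<not> ae_eq G len u (\<lambda>e x. 0)"

definition eigenvalue ::
    "('v, 'e) pre_digraph \<Rightarrow> ('e \<Rightarrow> real) \<Rightarrow> real \<Rightarrow> 'e gfun \<Rightarrow> 'e gfun \<Rightarrow> real \<Rightarrow> bool" where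
  "eigenvalue G len \<beta> p r \<mu> \<longleftrightarrow> (\<exists>u. eigenfunction G len \<beta> p r \<mu> u)"

text \<open>
  The linear space \<open>S\<close> of functions, taken modulo equality almost everywhere, has a basis
  consisting of \<open>m\<close> elements.
\<close>

definition has_dim_ae ::
    "('v, 'e) pre_digraph \<Rightarrow> ('e \<Rightarrow> real) \<Rightarrow> 'e gfun set \<Rightarrow> nat \<Rightarrow> bool" where
  "has_dim_ae G len S m \<longleftrightarrow> (\<exists>v :: nat \<Rightarrow> 'e gfun.
     (\<forall>j<m. v j \<in> S) \<and>
     (\<forall>c :: nat \<Rightarrow> real. ae_eq G len (\<lambda>e x. \<Sum>j<m. c j * v j e x) (\<lambda>e x. 0) \<longrightarrow> (\<forall>j<m. c j = 0)) \<and>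
     (\<forall>w\<in>S. \<exists>c :: nat \<Rightarrow> real. ae_eq G len w (\<lambda>e x. \<Sum>j<m. c j * v j e x)))"

definition has_multiplicity ::
    "('v, 'e) pre_digraph \<Rightarrow> ('e \<Rightarrow> real) \<Rightarrow> real \<Rightarrow> 'e gfun \<Rightarrow> 'e gfun \<Rightarrow> real \<Rightarrow> nat \<Rightarrow> bool" where
  "has_multiplicity G len \<beta> p r \<mu> m \<longleftrightarrow>
     has_dim_ae G len {u. generalized_solution G len \<beta> p r \<mu> u} m"

section \<open>Orthonormal bases of the weighted space\<close>

definition weighted_inner ::
    "('v, 'e) pre_digraph \<Rightarrow> ('e \<Rightarrow> real) \<Rightarrow> 'e gfun \<Rightarrow> 'e gfun \<Rightarrow> 'e gfun \<Rightarrow> real" where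
  "weighted_inner G len r u v = graph_integral G len (\<lambda>e x. r e x * u e x * v e x)"

definition weighted_norm ::
    "('v, 'e) pre_digraph \<Rightarrow> ('e \<Rightarrow> real) \<Rightarrow> 'e gfun \<Rightarrow> 'e gfun \<Rightarrow> real" where
  "weighted_norm G len r u = sqrt (graph_integral G len (\<lambda>e x. r e x * (u e x)\<^sup>2))"

definition complete_orthonormal_basis ::
    "('v, 'e) pre_digraph \<Rightarrow> ('e \<Rightarrow> real) \<Rightarrow> 'e gfun \<Rightarrow> (nat \<Rightarrow> 'e gfun) \<Rightarrow> bool" where
  "complete_orthonormal_basis G len r u \<longleftrightarrow>
     (\<forall>k. u k \<in> L2_graph G len) \<and>
     (\<forall>j k. weighted_inner G len r (u j) (u k) = (if j = k then 1 else 0)) \<and>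
     (\<forall>f\<in>L2_graph G len.
        (\<lambda>N. weighted_norm G len r
               (\<lambda>e x. f e x - (\<Sum>k<N. weighted_inner G len r f (u k) * u k e x)))
          \<longlonglongrightarrow> 0)"

end

theory Submission
  imports Defs "HOL-Library.Function_Algebras" "HOL-Complex_Analysis.Great_Picard"
begin

text \<open>
  The generalized problem is the variational equation \<open>a u w = \<lambda> * b u w\<close> with the energy
  \<open>a u w = (p D u, D w)\<close> on \<open>V = H_graph_Dir\<close> and the inner product \<open>b u w = (r u, w)\<close> of \<open>L\<^sub>2\<close>. If the
  energy dominates \<open>b\<close>, both spaces are complete, \<open>V\<close> embeds compactly into \<open>L\<^sub>2\<close> and only zero is orthogonal
  to \<open>V\<close>, then successive minimisation of the Rayleigh quotient \<open>a u u / b u u\<close> produces the whole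
  spectrum. This abstract part is \<open>spectral_sequence_exists\<close> and \<open>eigenvector_expansion\<close>. It is carried out
  for semidefinite forms, so that functions stand for their classes modulo equality almost everywhere.

  The concrete part reduces the fractional space to an ordinary Sobolev space. By the semigroup law of
  fractional integration (\<open>frac_integral_of_representation\<close>), the function
  \<open>u = c / Gamma \<beta> * x powr (\<beta> - 1) + frac_integral \<beta> \<phi>\<close> has \<open>c + \<integral>\<phi>\<close> as its fractional integral of order
  \<open>1 - \<beta>\<close>, and \<open>\<phi>\<close> as its fractional derivative by Lebesgue's differentiation theorem. So the elements of
  \<open>V\<close> correspond to vertex values \<open>h\<close> vanishing on the boundary and densities \<open>\<phi>\<close> in \<open>L\<^sub>2\<close> whose integral
  over each edge is the increment of \<open>h\<close> (\<open>represents_imp_V\<close>, \<open>V_imp_represents\<close>), and the energy is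
  \<open>(p \<phi>, \<phi>)\<close>.

  In these coordinates the hypotheses of the abstract part become the following. Connectedness and a
  nonempty boundary bound the vertex values by the energy (\<open>vertex_bound\<close>). For \<open>\<beta> > 1 / 2\<close> the kernel of the
  fractional integral is square integrable, whence \<open>frac_integral \<beta> \<phi>\<close> is bounded and Hoelder
  continuous with constants controlled by the norm of \<open>\<phi>\<close>; pointwise convergence of a subsequence and
  dominated convergence then give compactness (\<open>compact_embedding\<close>). Completeness is Riesz--Fischer
  (\<open>L2_complete\<close>, \<open>V_complete\<close>). Finally, if \<open>z\<close> is orthogonal to \<open>V\<close>, the
  right-sided fractional integral of \<open>r z\<close> is constant on each edge; the constant is its limit zero at the
  right end, and Abel's inversion makes \<open>z\<close> vanish (\<open>frac_integral_mean_zero_total\<close>, \<open>V_total\<close>).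
\<close>

section \<open>Semi-inner product spaces\<close>

instantiation "fun" :: (type, real_vector) real_vector
begin

definition "c *\<^sub>R f = (\<lambda>x. c *\<^sub>R f x)"

instance
  by standard (simp_all add: scaleR_fun_def fun_eq_iff algebra_simps)

end

lemma scaleR_fun_apply [simp]: "(c *\<^sub>R f) x = c *\<^sub>R f x"
  by (simp add: scaleR_fun_def)

lemma sum_fun_apply: "(\<Sum>i\<in>I. f i) x = (\<Sum>i\<in>I. f i x)"
  by (induction I rule: infinite_finite_induct) auto

text \<open>
  The form may vanish on nonzero vectors, so that functions need not be replaced by classes of
  functions that agree almost everywhere; limits are therefore unique only up to null vectors.
\<close>

locale semi_inner =
  fixes L :: "'a::real_vector set" and b :: "'a \<Rightarrow> 'a \<Rightarrow> real"
  assumes subspace: "subspace L"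
    and add_left: "\<lbrakk>x \<in> L; y \<in> L; z \<in> L\<rbrakk> \<Longrightarrow> b (x + y) z = b x z + b y z"
    and scale_left: "\<lbrakk>x \<in> L; z \<in> L\<rbrakk> \<Longrightarrow> b (c *\<^sub>R x) z = c * b x z"
    and commute: "\<lbrakk>x \<in> L; y \<in> L\<rbrakk> \<Longrightarrow> b x y = b y x"
    and nonneg: "x \<in> L \<Longrightarrow> 0 \<le> b x x"
begin

definition sq_Cauchy :: "(nat \<Rightarrow> 'a) \<Rightarrow> bool" where
  "sq_Cauchy X \<longleftrightarrow> (\<forall>\<epsilon>>0. \<exists>N. \<forall>m\<ge>N. \<forall>n\<ge>N. b (X m - X n) (X m - X n) < \<epsilon>)"

definition sq_tendsto :: "(nat \<Rightarrow> 'a) \<Rightarrow> 'a \<Rightarrow> bool" where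
  "sq_tendsto X x \<longleftrightarrow> (\<lambda>n. b (X n - x) (X n - x)) \<longlonglongrightarrow> 0"

definition sq_complete :: bool where
  "sq_complete \<longleftrightarrow> (\<forall>X. (\<forall>n. X n \<in> L) \<and> sq_Cauchy X \<longrightarrow> (\<exists>x\<in>L. sq_tendsto X x))"

lemma mem [simp]:
  "0 \<in> L" "\<lbrakk>x \<in> L; y \<in> L\<rbrakk> \<Longrightarrow> x + y \<in> L" "\<lbrakk>x \<in> L; y \<in> L\<rbrakk> \<Longrightarrow> x - y \<in> L"
  "x \<in> L \<Longrightarrow> c *\<^sub>R x \<in> L"
  using subspace by (auto simp: subspace_0 subspace_add subspace_diff subspace_scale)

lemma mem_sum [simp]: "(\<And>i. i \<in> I \<Longrightarrow> f i \<in> L) \<Longrightarrow> sum f I \<in> L"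
  using subspace by (rule subspace_sum)

lemma add_right: "\<lbrakk>x \<in> L; y \<in> L; z \<in> L\<rbrakk> \<Longrightarrow> b z (x + y) = b z x + b z y"
  using commute add_left by simp

lemma scale_right: "\<lbrakk>x \<in> L; z \<in> L\<rbrakk> \<Longrightarrow> b z (c *\<^sub>R x) = c * b z x"
  using commute scale_left by simp

lemma zero_left [simp]: "z \<in> L \<Longrightarrow> b 0 z = 0"
  using scale_left[of z z 0] by simp

lemma zero_right [simp]: "z \<in> L \<Longrightarrow> b z 0 = 0"
  using commute[of z 0] by simp

lemma diff_left: "\<lbrakk>x \<in> L; y \<in> L; z \<in> L\<rbrakk> \<Longrightarrow> b (x - y) z = b x z - b y z"
  using add_left[of "x - y" y z] by simp

lemma diff_right: "\<lbrakk>x \<in> L; y \<in> L; z \<in> L\<rbrakk> \<Longrightarrow> b z (x - y) = b z x - b z y"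
  using add_right[of "x - y" y z] by simp

lemma sum_left: "\<lbrakk>\<And>i. i \<in> I \<Longrightarrow> f i \<in> L; z \<in> L\<rbrakk> \<Longrightarrow> b (sum f I) z = (\<Sum>i\<in>I. b (f i) z)"
  by (induction I rule: infinite_finite_induct) (auto simp: add_left)

lemma sum_right: "\<lbrakk>\<And>i. i \<in> I \<Longrightarrow> f i \<in> L; z \<in> L\<rbrakk> \<Longrightarrow> b z (sum f I) = (\<Sum>i\<in>I. b z (f i))"
  by (induction I rule: infinite_finite_induct) (auto simp: add_right)

lemmas linear = add_left add_right diff_left diff_right scale_left scale_right

lemma Cauchy_Schwarz:
  assumes "x \<in> L" "y \<in> L"
  shows "(b x y)\<^sup>2 \<le> b x x * b y y"
proof (cases "b y y = 0")
  case True
  have "b x y = 0"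
  proof (rule ccontr)
    assume n: "b x y \<noteq> 0"
    \<comment> \<open>The square of \<open>x + t y\<close> is affine in \<open>t\<close> and takes the value \<open>-1\<close> here.\<close>
    define t where "t = - (b x x + 1) / (2 * b x y)"
    have "0 \<le> b (x + t *\<^sub>R y) (x + t *\<^sub>R y)"
      using assms by (intro nonneg) auto
    also have "\<dots> = b x x + 2 * t * b x y"
      using assms True by (simp add: linear commute[of y x])
    also have "\<dots> = - 1"
      using n by (simp add: t_def field_simps)
    finally show False by simp
  qed
  then show ?thesis
    using True by simp
next
  case False
  then have pos: "b y y > 0"
    using nonneg[of y] assms by simp
  define t where "t = - b x y / b y y"
  have "0 \<le> b (x + t *\<^sub>R y) (x + t *\<^sub>R y)"
    using assms by (intro nonneg) auto
  also have "\<dots> = b x x + 2 * t * b x y + t\<^sup>2 * b y y"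
    using assms by (simp add: linear commute[of y x] power2_eq_square algebra_simps)
  also have "\<dots> = b x x - (b x y)\<^sup>2 / b y y"
    using pos by (simp add: t_def power2_eq_square field_simps)
  finally show ?thesis
    using pos by (simp add: field_simps)
qed

text \<open>
  Null vectors are orthogonal to everything, which is what permits working without quotients.
\<close>

lemma null_left: "\<lbrakk>x \<in> L; y \<in> L; b x x = 0\<rbrakk> \<Longrightarrow> b x y = 0"
  using Cauchy_Schwarz[of x y] by simp

lemma square_diff_null:
  assumes "x \<in> L" "z \<in> L" "b z z = 0"
  shows "b (x - z) (x - z) = b x x"
  using assms null_left[of z x] commute[of x z] by (simp add: diff_left diff_right)

lemma square_diff_le:
  assumes "x \<in> L" "y \<in> L"
  shows "b (x - y) (x - y) \<le> 2 * b x x + 2 * b y y"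
proof -
  have "0 \<le> b (x + y) (x + y)"
    using assms by (intro nonneg) auto
  then show ?thesis
    using assms by (simp add: linear commute[of y x])
qed

lemma tendsto_inner:
  assumes "sq_tendsto X x" "\<And>n. X n \<in> L" "x \<in> L" "y \<in> L"
  shows "(\<lambda>n. b (X n) y) \<longlonglongrightarrow> b x y"
proof -
  have "(\<lambda>n. sqrt (b (X n - x) (X n - x) * b y y)) \<longlonglongrightarrow> sqrt (0 * b y y)"
    using assms(1) unfolding sq_tendsto_def by (intro tendsto_real_sqrt tendsto_mult_right) 
  moreover have "\<bar>b (X n) y - b x y\<bar> \<le> sqrt (b (X n - x) (X n - x) * b y y)" for n
    using Cauchy_Schwarz[of "X n - x" y] assms by (intro real_le_rsqrt) (simp add: diff_left)
  ultimately have "(\<lambda>n. b (X n) y - b x y) \<longlonglongrightarrow> 0"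
    by - (rule Lim_null_comparison[of _ "\<lambda>n. sqrt (b (X n - x) (X n - x) * b y y)"], auto)
  then show ?thesis
    by (simp add: LIM_zero_iff)
qed

lemma tendsto_square:
  assumes "sq_tendsto X x" "\<And>n. X n \<in> L" "x \<in> L"
  shows "(\<lambda>n. b (X n) (X n)) \<longlonglongrightarrow> b x x"
proof -
  have "(\<lambda>n. b (X n - x) (X n - x) + 2 * b (X n) x - b x x) \<longlonglongrightarrow> 0 + 2 * b x x - b x x"
    using assms(1) unfolding sq_tendsto_def
    by (intro tendsto_intros tendsto_inner assms)
  moreover have "b (X n - x) (X n - x) + 2 * b (X n) x - b x x = b (X n) (X n)" for n
    using assms by (simp add: linear commute[of x "X n"])
  ultimately show ?thesis by simp
qed

lemma sq_tendsto_imp_sq_Cauchy: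
  assumes "sq_tendsto X x" "\<And>n. X n \<in> L" "x \<in> L"
  shows "sq_Cauchy X"
  unfolding sq_Cauchy_def
proof (intro allI impI)
  fix \<epsilon> :: real assume "\<epsilon> > 0"
  then have "\<forall>\<^sub>F n in sequentially. b (X n - x) (X n - x) < \<epsilon> / 4"
    using assms(1) unfolding sq_tendsto_def by (intro order_tendstoD) auto
  then obtain N where N: "\<And>n. n \<ge> N \<Longrightarrow> b (X n - x) (X n - x) < \<epsilon> / 4"
    by (auto simp: eventually_sequentially)
  show "\<exists>N. \<forall>m\<ge>N. \<forall>n\<ge>N. b (X m - X n) (X m - X n) < \<epsilon>"
  proof (intro exI allI impI)
    fix m n assume "m \<ge> N" "n \<ge> N"
    then show "b (X m - X n) (X m - X n) < \<epsilon>"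
      using square_diff_le[of "X m - x" "X n - x"] N[of m] N[of n] assms by simp
  qed
qed

end

section \<open>Orthonormal systems\<close>

text \<open>
  The index set \<open>J\<close> covers both finite systems, indexed by an initial segment, and sequences.
\<close>

locale orthonormal = semi_inner +
  fixes u :: "nat \<Rightarrow> 'a" and J :: "nat set"
  assumes u_mem: "k \<in> J \<Longrightarrow> u k \<in> L"
    and ortho: "\<lbrakk>j \<in> J; k \<in> J\<rbrakk> \<Longrightarrow> b (u j) (u k) = (if j = k then 1 else 0)"
begin

definition proj :: "nat set \<Rightarrow> 'a \<Rightarrow> 'a" where
  "proj I f = (\<Sum>k\<in>I. b f (u k) *\<^sub>R u k)"

lemma proj_mem [simp]: "I \<subseteq> J \<Longrightarrow> proj I f \<in> L"
  unfolding proj_def using u_mem by (intro mem_sum mem) auto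

lemma inner_combination:
  assumes "finite I" "I \<subseteq> J" "k \<in> J"
  shows "b (\<Sum>i\<in>I. c i *\<^sub>R u i) (u k) = (if k \<in> I then c k else 0)"
proof -
  have "b (\<Sum>i\<in>I. c i *\<^sub>R u i) (u k) = (\<Sum>i\<in>I. c i * (if i = k then 1 else 0))"
    using assms by (subst sum_left) (auto simp: u_mem scale_left ortho subset_iff intro!: sum.cong)
  also have "\<dots> = (if k \<in> I then c k else 0)"
    using assms by (simp add: if_distrib[of "\<lambda>z. _ * z"] cong: if_cong)
  finally show ?thesis .
qed

lemma inner_proj:
  assumes "finite I" "I \<subseteq> J" "k \<in> J"
  shows "b (proj I f) (u k) = (if k \<in> I then b f (u k) else 0)"
  unfolding proj_def using inner_combination[OF assms] by simp

lemma inner_residual: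
  assumes "finite I" "I \<subseteq> J" "k \<in> I" "f \<in> L"
  shows "b (f - proj I f) (u k) = 0"
  using assms inner_proj[of I k f] by (subst diff_left) (auto simp: u_mem subset_iff)

lemma combination_square:
  assumes "finite I" "I \<subseteq> J"
  shows "b (\<Sum>k\<in>I. c k *\<^sub>R u k) (\<Sum>k\<in>I. c k *\<^sub>R u k) = (\<Sum>k\<in>I. (c k)\<^sup>2)"
proof -
  have "b (\<Sum>k\<in>I. c k *\<^sub>R u k) (\<Sum>k\<in>I. c k *\<^sub>R u k)
      = (\<Sum>k\<in>I. b (\<Sum>k\<in>I. c k *\<^sub>R u k) (c k *\<^sub>R u k))"
    using assms u_mem by (intro sum_right mem_sum mem) auto
  also have "\<dots> = (\<Sum>k\<in>I. (c k)\<^sup>2)"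
    using assms u_mem
    by (intro sum.cong refl)
       (subst scale_right, auto simp: inner_combination power2_eq_square subset_iff intro!: mem_sum)
  finally show ?thesis .
qed

lemma inner_proj_self:
  assumes "finite I" "I \<subseteq> J" "f \<in> L"
  shows "b f (proj I f) = (\<Sum>k\<in>I. (b f (u k))\<^sup>2)"
  unfolding proj_def using assms u_mem
  by (subst sum_right) (auto simp: scale_right power2_eq_square subset_iff intro!: sum.cong)

lemma residual_square:
  assumes "finite I" "I \<subseteq> J" "f \<in> L"
  shows "b (f - proj I f) (f - proj I f) = b f f - (\<Sum>k\<in>I. (b f (u k))\<^sup>2)"
proof -
  have "b (f - proj I f) (f - proj I f) = b f f - 2 * b f (proj I f) + b (proj I f) (proj I f)"
    using assms by (simp add: linear commute[of "proj I f" f])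
  then show ?thesis
    using inner_proj_self[OF assms] combination_square[OF assms(1,2), of "\<lambda>k. b f (u k)"]
    by (simp add: proj_def)
qed

lemma Bessel:
  assumes "finite I" "I \<subseteq> J" "f \<in> L"
  shows "(\<Sum>k\<in>I. (b f (u k))\<^sup>2) \<le> b f f"
  using residual_square[OF assms] nonneg[of "f - proj I f"] assms by auto

text \<open>
  Riesz--Fischer: by orthonormality the distance of two partial sums is a difference of two partial
  sums of the squared coefficients, whose series converges by Bessel's inequality. The limit \<open>s\<close>
  need not be \<open>f\<close>.
\<close>

lemma Fourier_series_converges:
  assumes "J = UNIV" "sq_complete" "f \<in> L"
  obtains s where "s \<in> L" "sq_tendsto (\<lambda>N. proj {..<N} f) s"
proof -
  define c where "c k = (b f (u k))\<^sup>2" for k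
  have "summable c"
  proof (rule bounded_imp_summable[of _ "b f f"])
    show "sum c {..n} \<le> b f f" for n
      unfolding c_def using assms by (intro Bessel) auto
  qed (simp add: c_def)
  have diff: "b (proj {..<m} f - proj {..<n} f) (proj {..<m} f - proj {..<n} f)
      = \<bar>sum c {..<m} - sum c {..<n}\<bar>" for m n
  proof -
    have *: "b (proj {..<m} f - proj {..<n} f) (proj {..<m} f - proj {..<n} f)
        = sum c {..<m} - sum c {..<n}" if "n \<le> m" for m n
    proof -
      have sub: "sum g {..<m} - sum g {..<n} = sum g {n..<m}" for g :: "nat \<Rightarrow> 'z::ab_group_add"
        using sum_diff_nat_ivl[of 0 n m g] that by (simp add: atLeast0LessThan)
      show ?thesis
        unfolding proj_def sub using assms(1) by (subst combination_square) (auto simp: c_def)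
    qed
    have mono: "sum c {..<n} \<le> sum c {..<m}" if "n \<le> m" for m n
      using that by (intro sum_mono2) (auto simp: c_def)
    have "b (proj {..<m} f - proj {..<n} f) (proj {..<m} f - proj {..<n} f)
        = b (proj {..<n} f - proj {..<m} f) (proj {..<n} f - proj {..<m} f)"
      using assms(1) by (simp add: linear)
    then show ?thesis
      using *[of n m] *[of m n] mono[of n m] mono[of m n] by (cases "n \<le> m") simp_all
  qed
  have "Cauchy (\<lambda>N. sum c {..<N})"
    using \<open>summable c\<close> by (simp add: summable_iff_convergent Cauchy_convergent_iff)
  then have "sq_Cauchy (\<lambda>N. proj {..<N} f)"
    unfolding sq_Cauchy_def diff Cauchy_def dist_real_def by auto
  then show ?thesis
    using assms that unfolding sq_complete_def by (metis proj_mem subset_UNIV)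
qed

end

section \<open>Spectral theorem for a compactly embedded form\<close>

text \<open>
  The variational setting of an eigenvalue problem \<open>a u w = \<lambda> * b u w\<close>: the form \<open>a\<close> on \<open>V\<close> plays the
  energy, \<open>b\<close> the inner product of an ambient space \<open>L\<close>, and \<open>V\<close> is compactly embedded in \<open>L\<close>. The
  assumption \<open>total\<close> says that \<open>V\<close> is dense in \<open>L\<close>, in the form in which it is used: only null
  vectors are orthogonal to \<open>V\<close>.
\<close>

locale compact_form_pair = form: semi_inner V a + amb: semi_inner L b
  for V L :: "'a::real_vector set" and a b +
  fixes C :: real
  assumes V_subset: "V \<subseteq> L"
    and bounded: "x \<in> V \<Longrightarrow> b x x \<le> C * a x x"
    and V_complete: "form.sq_complete"
    and L_complete: "amb.sq_complete"
    and compact: "\<lbrakk>\<And>n. X n \<in> V; \<And>n. a (X n) (X n) \<le> M\<rbrakk>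
      \<Longrightarrow> \<exists>s. strict_mono (s :: nat \<Rightarrow> nat) \<and> amb.sq_Cauchy (X \<circ> s)"
    and total: "\<lbrakk>z \<in> L; \<And>w. w \<in> V \<Longrightarrow> b z w = 0\<rbrakk> \<Longrightarrow> b z z = 0"
    and infinite_dim: "\<exists>e :: nat \<Rightarrow> 'a. (\<forall>k. e k \<in> L \<and> 0 < b (e k) (e k)) \<and>
      (\<forall>j k. j \<noteq> k \<longrightarrow> b (e j) (e k) = 0)"
begin

lemma V_L [simp]: "x \<in> V \<Longrightarrow> x \<in> L"
  using V_subset by auto

definition perp :: "nat \<Rightarrow> (nat \<Rightarrow> 'a) \<Rightarrow> 'a set" where
  "perp n f = {x \<in> V. \<forall>i<n. b x (f i) = 0}"

text \<open>
  A vector with \<open>b r r = 1\<close> that minimises the Rayleigh quotient \<open>a x x / b x x\<close> over \<open>W\<close>; the minimum is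
  then \<open>a r r\<close>.
\<close>

definition minimizer_on :: "'a set \<Rightarrow> 'a \<Rightarrow> bool" where
  "minimizer_on W r \<longleftrightarrow> r \<in> W \<and> b r r = 1 \<and> (\<forall>x\<in>W. a r r * b x x \<le> a x x)"

lemma perp_closed:
  assumes "\<And>i. i < n \<Longrightarrow> f i \<in> V"
  shows "x \<in> perp n f \<Longrightarrow> y \<in> perp n f \<Longrightarrow> x + y \<in> perp n f"
    "x \<in> perp n f \<Longrightarrow> c *\<^sub>R x \<in> perp n f"
  using assms unfolding perp_def by (auto simp: amb.linear)

text \<open>
  Direct method. A minimising sequence is bounded for \<open>a\<close>, so by compactness a subsequence is Cauchy
  for \<open>b\<close>. The parallelogram law upgrades this to Cauchy for \<open>a\<close>: the midpoints of two nearly minimal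
  vectors cannot lie below the infimum. Completeness of \<open>V\<close> then gives the minimiser.
\<close>

lemma minimizer_exists:
  assumes f: "\<And>i. i < n \<Longrightarrow> f i \<in> V" and x0: "x0 \<in> perp n f" "b x0 x0 > 0"
  shows "\<exists>r. minimizer_on (perp n f) r"
proof -
  define W where "W = perp n f"
  have WV: "x \<in> V" if "x \<in> W" for x
    using that by (auto simp: W_def perp_def)
  note closed = perp_closed[of n f, OF f, folded W_def]
  define S where "S = (\<lambda>x. a x x) ` {x \<in> W. b x x = 1}"
  define lam where "lam = Inf S"
  have normalize: "(1 / sqrt (b x x)) *\<^sub>R x \<in> W"
    "b ((1 / sqrt (b x x)) *\<^sub>R x) ((1 / sqrt (b x x)) *\<^sub>R x) = 1"
    "a ((1 / sqrt (b x x)) *\<^sub>R x) ((1 / sqrt (b x x)) *\<^sub>R x) = a x x / b x x"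
    if "x \<in> W" "b x x > 0" for x
    using that WV[OF that(1)] closed(2)
    by (auto simp: amb.linear form.linear field_simps)
  have S_ne: "S \<noteq> {}"
    using normalize[of x0] x0 unfolding S_def W_def by blast
  have S_bdd: "bdd_below S"
    unfolding S_def by (rule bdd_belowI[of _ 0]) (auto intro: form.nonneg WV)
  have lam_le: "lam * b x x \<le> a x x" if "x \<in> W" for x
  proof (cases "b x x = 0")
    case True
    then show ?thesis using form.nonneg[of x] WV that by simp
  next
    case False
    then have pos: "b x x > 0"
      using amb.nonneg[of x] WV that by force
    have "a x x / b x x \<in> S"
      unfolding S_def using normalize[OF that pos] by (metis (mono_tags, lifting) image_eqI mem_Collect_eq)
    then have "lam \<le> a x x / b x x"
      unfolding lam_def using S_bdd by (rule cInf_lower)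
    then show ?thesis
      using pos by (simp add: field_simps)
  qed
  have "\<exists>x. x \<in> W \<and> b x x = 1 \<and> a x x < lam + 1 / real (Suc k)" for k
    using cInf_lessD[OF S_ne, of "lam + 1 / real (Suc k)"] unfolding lam_def S_def by auto
  then obtain g where g: "\<And>k. g k \<in> W" "\<And>k. b (g k) (g k) = 1"
      "\<And>k. a (g k) (g k) < lam + 1 / real (Suc k)"
    by metis
  have "a (g k) (g k) \<le> lam + 1" for k
    using g(3)[of k] by (rule order.trans[OF less_imp_le]) auto
  then obtain s where s: "strict_mono (s :: nat \<Rightarrow> nat)" "amb.sq_Cauchy (g \<circ> s)"
    using compact[of g "lam + 1"] WV g(1) by auto
  define X where "X = g \<circ> s"
  have X: "X k \<in> W" "X k \<in> V" "b (X k) (X k) = 1" "a (X k) (X k) < lam + 1 / real (Suc k)" for k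
  proof -
    have "k \<le> s k"
      using s(1) by (rule seq_suble)
    then have "1 / real (Suc (s k)) \<le> 1 / real (Suc k)"
      by (intro divide_left_mono) auto
    then show "a (X k) (X k) < lam + 1 / real (Suc k)"
      using g(3)[of "s k"] by (simp add: X_def)
  qed (auto simp: X_def g WV)
  have lam_nonneg: "lam \<ge> 0"
    unfolding lam_def using S_ne by (rule cInf_greatest) (auto simp: S_def intro!: form.nonneg WV)
  \<comment> \<open>The parallelogram law for both forms, with \<open>lam * b \<le> a\<close> applied to \<open>X m + X n\<close>.\<close>
  have gap: "a (X m - X n) (X m - X n) \<le> 2 / real (Suc m) + 2 / real (Suc n) + lam * b (X m - X n) (X m - X n)"
    for m n
  proof -
    have "lam * b (X m + X n) (X m + X n) \<le> a (X m + X n) (X m + X n)"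
      using X by (intro lam_le closed)
    moreover have "b (X m + X n) (X m + X n) = 4 - b (X m - X n) (X m - X n)"
      using X by (simp add: amb.linear)
    moreover have "a (X m + X n) (X m + X n) = 2 * a (X m) (X m) + 2 * a (X n) (X n) - a (X m - X n) (X m - X n)"
      using X by (simp add: form.linear)
    ultimately show ?thesis
      using X(4)[of m] X(4)[of n] by (simp add: algebra_simps)
  qed
  have "form.sq_Cauchy X"
    unfolding form.sq_Cauchy_def
  proof (intro allI impI)
    fix \<epsilon> :: real
    assume \<epsilon>: "\<epsilon> > 0"
    obtain N1 where N1: "\<And>m n. m \<ge> N1 \<Longrightarrow> n \<ge> N1 \<Longrightarrow> b (X m - X n) (X m - X n) < \<epsilon> / (2 * (lam + 1))"
      using s(2) \<epsilon> lam_nonneg unfolding amb.sq_Cauchy_def X_def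
      by (metis add_nonneg_pos divide_pos_pos mult_pos_pos zero_less_numeral zero_less_one)
    obtain N2 where N2: "1 / real (Suc N2) < \<epsilon> / 8"
      using \<epsilon> nat_approx_posE[of "\<epsilon> / 8"] by auto
    show "\<exists>N. \<forall>m\<ge>N. \<forall>n\<ge>N. a (X m - X n) (X m - X n) < \<epsilon>"
    proof (intro exI allI impI)
      fix m n assume mn: "m \<ge> max N1 N2" "n \<ge> max N1 N2"
      have "1 / real (Suc m) \<le> 1 / real (Suc N2)" "1 / real (Suc n) \<le> 1 / real (Suc N2)"
        using mn by (auto intro!: divide_left_mono)
      moreover have "lam * b (X m - X n) (X m - X n) \<le> (lam + 1) * b (X m - X n) (X m - X n)"
        using amb.nonneg[of "X m - X n"] X by (intro mult_right_mono) auto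
      moreover have "(lam + 1) * b (X m - X n) (X m - X n) < \<epsilon> / 2"
        using N1[of m n] mn lam_nonneg by (simp add: field_simps)
      ultimately show "a (X m - X n) (X m - X n) < \<epsilon>"
        using gap[of m n] N2 by simp
    qed
  qed
  then obtain r where r: "r \<in> V" "form.sq_tendsto X r"
    using V_complete X(2) unfolding form.sq_complete_def by blast
  have "amb.sq_tendsto X r"
    unfolding amb.sq_tendsto_def
  proof (rule tendsto_sandwich[of "\<lambda>_. 0"])
    show "(\<lambda>n. C * a (X n - r) (X n - r)) \<longlonglongrightarrow> 0"
      using r(2) unfolding form.sq_tendsto_def by (rule tendsto_mult_right_zero)
  qed (use X r in \<open>auto intro!: bounded amb.nonneg always_eventually\<close>)
  note b_lim = amb.tendsto_inner[OF this] amb.tendsto_square[OF this]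
  have "b r r = 1"
    using b_lim(2) X r by (simp add: LIMSEQ_const_iff)
  moreover have "r \<in> W"
  proof -
    have "b r (f i) = 0" if "i < n" for i
      using b_lim(1)[of "f i"] X r f that LIMSEQ_unique[of "\<lambda>n. b (X n) (f i)" _ 0]
      by (auto simp: W_def perp_def)
    then show ?thesis
      using r by (simp add: W_def perp_def)
  qed
  moreover have "a r r \<le> lam"
  proof (rule LIMSEQ_le)
    show "(\<lambda>n. a (X n) (X n)) \<longlonglongrightarrow> a r r"
      using X r by (intro form.tendsto_square) auto
    show "(\<lambda>n. lam + 1 / real (Suc n)) \<longlonglongrightarrow> lam"
      using tendsto_add[OF tendsto_const LIMSEQ_Suc[OF lim_1_over_n], of lam] by simp
  qed (use X(4) in \<open>auto intro: less_imp_le\<close>)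
  ultimately have "minimizer_on W r"
    unfolding minimizer_on_def using lam_le
    by (meson WV amb.nonneg V_L mult_right_mono order.trans)
  then show ?thesis
    unfolding W_def by blast
qed

text \<open>
  First variation: \<open>a - a r r * b\<close> is nonnegative on the subspace and vanishes at \<open>r\<close>, so its
  derivative at \<open>r\<close> in every direction \<open>w\<close> is zero.
\<close>

lemma minimizer_Euler_Lagrange:
  assumes f: "\<And>i. i < n \<Longrightarrow> f i \<in> V" and r: "minimizer_on (perp n f) r" and w: "w \<in> perp n f"
  shows "a r w = a r r * b r w"
proof -
  define q where "q = a r w - a r r * b r w"
  define Q where "Q = a w w - a r r * b w w"
  have mem: "r \<in> V" "w \<in> V" "r \<in> perp n f" and r1: "b r r = 1"
    using r w by (auto simp: minimizer_on_def perp_def)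
  have *: "0 \<le> 2 * t * q + t\<^sup>2 * Q" for t
  proof -
    have "r + t *\<^sub>R w \<in> perp n f"
      using perp_closed[of n f, OF f] mem w by auto
    then have "a r r * b (r + t *\<^sub>R w) (r + t *\<^sub>R w) \<le> a (r + t *\<^sub>R w) (r + t *\<^sub>R w)"
      using r unfolding minimizer_on_def by auto
    then show ?thesis
      using mem r1
      by (simp add: amb.linear form.linear amb.commute[of w r] form.commute[of w r]
          q_def Q_def power2_eq_square algebra_simps)
  qed
  have "q = 0"
  proof (rule ccontr)
    assume "q \<noteq> 0"
    \<comment> \<open>A step against the sign of \<open>q\<close>, so short that the linear term dominates the quadratic one.\<close>
    define d where "d = \<bar>Q\<bar> + 1"
    define t where "t = - q / d"
    have d: "d > 0" "Q < 2 * d"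
      by (auto simp: d_def)
    have "2 * t * q + t\<^sup>2 * Q = (q\<^sup>2 / d) * (Q / d - 2)"
      using d by (simp add: t_def power2_eq_square field_simps)
    moreover have "Q / d - 2 < 0"
      using d by (simp add: field_simps)
    moreover have "q\<^sup>2 / d > 0"
      using \<open>q \<noteq> 0\<close> d by (intro divide_pos_pos) auto
    ultimately show False
      using *[of t] by (smt (verit) mult_pos_neg)
  qed
  then show ?thesis
    by (simp add: q_def)
qed

text \<open>
  The minimisation never stops: if all of the orthogonal complement of \<open>f 0, \<dots>, f (n - 1)\<close> in \<open>V\<close> were
  null, then by totality every vector of \<open>L\<close> would be a combination of these \<open>n\<close> vectors up to a null
  vector, against the infinite dimension of \<open>L\<close>.
\<close>

lemma perp_nontrivial:
  assumes f: "\<And>i. i < n \<Longrightarrow> f i \<in> V"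
    and ortho: "\<And>i j. i < n \<Longrightarrow> j < n \<Longrightarrow> b (f i) (f j) = (if i = j then 1 else 0)"
  shows "\<exists>x\<in>perp n f. b x x > 0"
proof (rule ccontr)
  assume "\<not> ?thesis"
  then have triv: "b x x = 0" if "x \<in> perp n f" for x
    using that amb.nonneg[of x] by (force simp: perp_def)
  interpret F: orthonormal L b f "{..<n}"
    using f ortho by unfold_locales auto
  have zero: "b (z - F.proj {..<n} z) (z - F.proj {..<n} z) = 0" if z: "z \<in> L" for z
  proof (rule total)
    show "z - F.proj {..<n} z \<in> L"
      using z by auto
    fix w assume w: "w \<in> V"
    define y where "y = z - F.proj {..<n} z"
    have y: "y \<in> L" "\<And>i. i < n \<Longrightarrow> b y (f i) = 0"
      unfolding y_def using z F.inner_residual[of "{..<n}"] by auto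
    have pw: "F.proj {..<n} w \<in> V"
      unfolding F.proj_def using f by (intro form.mem_sum form.mem) auto
    have "b (w - F.proj {..<n} w) (w - F.proj {..<n} w) = 0"
      using w pw F.inner_residual[of "{..<n}"] by (intro triv) (auto simp: perp_def)
    then have "b (w - F.proj {..<n} w) y = 0"
      using w y by - (rule amb.null_left, auto)
    moreover have "b y (F.proj {..<n} w) = 0"
      unfolding F.proj_def using y f by (subst amb.sum_right) (auto simp: amb.linear)
    ultimately have "b y w = 0"
      using y w pw amb.commute[of w y] amb.commute[of "F.proj {..<n} w" y] by (simp add: amb.linear)
    then show "b (z - F.proj {..<n} z) w = 0"
      by (simp add: y_def)
  qed
  obtain e0 where e0: "\<And>k::nat. e0 k \<in> L" "\<And>k. 0 < b (e0 k) (e0 k)" "\<And>j k. j \<noteq> k \<Longrightarrow> b (e0 j) (e0 k) = 0"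
    using infinite_dim by blast
  define e where "e k = (1 / sqrt (b (e0 k) (e0 k))) *\<^sub>R e0 k" for k
  interpret E: orthonormal L b e UNIV
  proof unfold_locales
    show "b (e j) (e k) = (if j = k then 1 else 0)" for j k
      unfolding e_def using e0(1,2)[of k] e0(1,2)[of j] e0(3)[of j k] by (auto simp: amb.linear field_simps)
  qed (auto simp: e_def e0)
  have [simp]: "e k \<in> L" for k
    using E.u_mem by simp
  \<comment> \<open>The \<open>n + 1\<close> orthonormal vectors \<open>e k\<close> would lie in the span of the \<open>n\<close> vectors \<open>f i\<close>; sum the
      squares of all coefficients \<open>b (e k) (f i)\<close> in both orders.\<close>
  have "real (Suc n) = (\<Sum>k\<le>n. b (e k) (e k))"
    using E.ortho by simp
  also have "\<dots> = (\<Sum>k\<le>n. \<Sum>i<n. (b (e k) (f i))\<^sup>2)"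
    using F.residual_square[of "{..<n}"] zero by (intro sum.cong) auto
  also have "\<dots> = (\<Sum>i<n. \<Sum>k\<le>n. (b (e k) (f i))\<^sup>2)"
    by (rule sum.swap)
  also have "\<dots> = (\<Sum>i<n. \<Sum>k\<le>n. (b (f i) (e k))\<^sup>2)"
    using f by (intro sum.cong refl) (auto simp: amb.commute)
  also have "\<dots> \<le> (\<Sum>i<n. b (f i) (f i))"
    using f by (intro sum_mono E.Bessel) auto
  also have "\<dots> = real n"
    using ortho by simp
  finally show False by simp
qed

lemma minimizing_sequence_exists:
  "\<exists>u. \<forall>n. minimizer_on (perp n u) (u n)"
proof (rule dependent_wellorder_choice)
  fix r :: 'a and f g :: "nat \<Rightarrow> 'a" and n :: nat
  assume "\<And>y. y < n \<Longrightarrow> f y = g y"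
  then show "minimizer_on (perp n f) r = minimizer_on (perp n g) r"
    by (simp add: perp_def)
next
  fix n :: nat and f :: "nat \<Rightarrow> 'a"
  assume *: "\<And>i. i < n \<Longrightarrow> minimizer_on (perp i f) (f i)"
  have f: "f i \<in> V" "b (f i) (f i) = 1" "j < i \<Longrightarrow> b (f i) (f j) = 0" if "i < n" for i j
    using *[OF that] by (auto simp: minimizer_on_def perp_def)
  have "b (f i) (f j) = (if i = j then 1 else 0)" if "i < n" "j < n" for i j
    using f[of i] f[of j] that amb.commute[of "f i" "f j"] by (cases i j rule: linorder_cases) auto
  then show "\<exists>r. minimizer_on (perp n f) r"
    using perp_nontrivial[of n f] minimizer_exists[of n f] f(1) by blast
qed

definition spectral_sequence :: "(nat \<Rightarrow> real) \<Rightarrow> (nat \<Rightarrow> 'a) \<Rightarrow> bool" where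
  "spectral_sequence lam u \<longleftrightarrow> (\<forall>k. u k \<in> V) \<and>
     (\<forall>j k. b (u j) (u k) = (if j = k then 1 else 0)) \<and>
     (\<forall>k. \<forall>w\<in>V. a (u k) w = lam k * b (u k) w) \<and>
     0 < lam 0 \<and> (\<forall>k. lam k \<le> lam (Suc k)) \<and> filterlim lam at_top sequentially \<and>
     (\<forall>f\<in>L. amb.sq_tendsto (\<lambda>N. \<Sum>k<N. b f (u k) *\<^sub>R u k) f)"

text \<open>
  Minimise the Rayleigh quotient successively over the orthogonal complements of the minimisers
  found before. The Euler--Lagrange equation, a priori valid against the complement only, extends to
  all of \<open>V\<close> because the minimisers are orthogonal for both forms. Compactness forces the minima to
  infinity, and since \<open>lam N\<close> bounds the quotient of the \<open>N\<close>-th remainder from below, the expansion of a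
  vector of \<open>V\<close> converges. For a general \<open>f\<close> in \<open>L\<close> the Fourier series converges by Riesz--Fischer, and
  its difference from \<open>f\<close> is orthogonal to \<open>V\<close>, hence null.
\<close>

theorem spectral_sequence_exists: "\<exists>lam u. spectral_sequence lam u"
proof -
  obtain u where u: "\<And>n. minimizer_on (perp n u) (u n)"
    using minimizing_sequence_exists by blast
  define lam where "lam n = a (u n) (u n)" for n
  have uV: "u n \<in> V" "b (u n) (u n) = 1" and u_perp: "i < n \<Longrightarrow> b (u n) (u i) = 0"
    and min: "x \<in> perp n u \<Longrightarrow> lam n * b x x \<le> a x x" for n i x
    using u[of n] by (auto simp: minimizer_on_def perp_def lam_def)
  have ortho: "b (u j) (u k) = (if j = k then 1 else 0)" for j k
    using u_perp[of k j] u_perp[of j k] uV amb.commute[of "u j" "u k"] by (cases j k rule: linorder_cases) auto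
  interpret U: orthonormal L b u UNIV
    using uV ortho by unfold_locales auto
  have residual_perp: "w - U.proj {..<n} w \<in> perp n u" if "w \<in> V" for w n
  proof -
    have "U.proj {..<n} w \<in> V"
      unfolding U.proj_def using uV by (intro form.mem_sum form.mem) auto
    then show ?thesis
      using that U.inner_residual[of "{..<n}"] by (auto simp: perp_def)
  qed
  have a_ortho: "a (u n) (u i) = 0" if "i < n" for i n
  proof -
    have "u n \<in> perp i u"
      using that u_perp uV by (auto simp: perp_def)
    then have "a (u i) (u n) = lam i * b (u i) (u n)"
      unfolding lam_def using minimizer_Euler_Lagrange[of i u "u i" "u n"] uV u by blast
    then show ?thesis
      using that uV ortho form.commute[of "u n" "u i"] by simp
  qed
  have eigen: "a (u n) w = lam n * b (u n) w" if w: "w \<in> V" for n w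
  proof -
    define y where "y = w - U.proj {..<n} w"
    have pV: "U.proj {..<n} w \<in> V"
      unfolding U.proj_def using uV by (intro form.mem_sum form.mem) auto
    have y: "y \<in> perp n u" "y \<in> V"
      using residual_perp[OF w] unfolding y_def perp_def by auto
    have "a (u n) (U.proj {..<n} w) = 0" "b (u n) (U.proj {..<n} w) = 0"
      unfolding U.proj_def using uV a_ortho ortho
      by (subst form.sum_right amb.sum_right; auto simp: form.linear amb.linear)+
    moreover have "a (u n) y = lam n * b (u n) y"
      unfolding lam_def using minimizer_Euler_Lagrange[of n u "u n" y] uV u y by blast
    moreover have "w = y + U.proj {..<n} w"
      by (simp add: y_def)
    ultimately show ?thesis
      using uV y pV by (metis V_L add.right_neutral amb.add_right form.add_right)
  qed
  have mono: "lam k \<le> lam (Suc k)" for k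
  proof -
    have "u (Suc k) \<in> perp k u"
      using uV u_perp by (auto simp: perp_def)
    then show ?thesis
      using min[of "u (Suc k)" k] uV by (simp add: lam_def)
  qed
  then have incseq: "incseq lam"
    by (rule incseq_SucI)
  have pos: "0 < lam 0"
    using bounded[of "u 0"] uV form.nonneg[of "u 0"] by (cases "a (u 0) (u 0) = 0") (auto simp: lam_def)
  \<comment> \<open>If the \<open>lam n\<close> were bounded, compactness would make a subsequence of \<open>u\<close> Cauchy for \<open>b\<close>, but
      distinct orthonormal vectors have squared distance 2.\<close>
  have "\<not> bdd_above (range lam)"
  proof
    assume "bdd_above (range lam)"
    then obtain M where M: "\<And>n. a (u n) (u n) \<le> M"
      unfolding bdd_above_def lam_def by auto
    obtain s where s: "strict_mono (s :: nat \<Rightarrow> nat)" "amb.sq_Cauchy (u \<circ> s)"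
      using compact[of u M] uV M by auto
    then obtain N where N: "\<And>m n. m \<ge> N \<Longrightarrow> n \<ge> N \<Longrightarrow> b (u (s m) - u (s n)) (u (s m) - u (s n)) < 1"
      unfolding amb.sq_Cauchy_def by (metis comp_apply zero_less_one)
    have "s N \<noteq> s (Suc N)"
      using strict_mono_eq[OF s(1), of N "Suc N"] by simp
    then have "b (u (s N) - u (s (Suc N))) (u (s N) - u (s (Suc N))) = 2"
      using uV ortho by (simp add: amb.linear)
    then show False
      using N[of N "Suc N"] by simp
  qed
  then have lim: "filterlim lam at_top sequentially"
    using incseq_convergent[OF incseq] incseq 
    unfolding filterlim_at_top
    by (metis (no_types, lifting) bdd_above.I2 eventually_sequentiallyI incseqD less_eq_real_def linorder_linear order.trans)
  have V_conv: "(\<lambda>N. b (w - U.proj {..<N} w) (w - U.proj {..<N} w)) \<longlonglongrightarrow> 0" if w: "w \<in> V" for w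
  proof (rule tendsto_sandwich[of "\<lambda>_. 0"])
    have "b (w - U.proj {..<N} w) (w - U.proj {..<N} w) \<le> a w w / lam N" for N
    proof -
      have pV: "U.proj {..<N} w \<in> V"
        unfolding U.proj_def using uV by (intro form.mem_sum form.mem) auto
      define y where "y = w - U.proj {..<N} w"
      have y: "y \<in> perp N u" "y \<in> V"
        using residual_perp[OF w] unfolding y_def perp_def by auto
      have "a y (U.proj {..<N} w) = 0"
      proof -
        have "a y (u i) = 0" if "i < N" for i
          using eigen[of y i] y that uV amb.commute[of y "u i"] form.commute[of y "u i"]
          by (auto simp: perp_def)
        then show ?thesis
          unfolding U.proj_def using y uV by (subst form.sum_right) (auto simp: form.linear)
      qed
      then have "a (y + U.proj {..<N} w) (y + U.proj {..<N} w) = a y y + a (U.proj {..<N} w) (U.proj {..<N} w)"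
        using y pV form.commute[of y "U.proj {..<N} w"] by (simp add: form.linear)
      then have "a w w = a y y + a (U.proj {..<N} w) (U.proj {..<N} w)"
        by (simp add: y_def)
      then have "lam N * b y y \<le> a w w"
        using min[of y N] y form.nonneg[OF pV] by simp
      moreover have "lam N > 0"
        using pos incseqD[OF incseq, of 0 N] by simp
      ultimately show ?thesis
        by (simp add: y_def field_simps)
    qed
    then show "\<forall>\<^sub>F N in sequentially. b (w - U.proj {..<N} w) (w - U.proj {..<N} w) \<le> a w w / lam N"
      by simp
    show "(\<lambda>N. a w w / lam N) \<longlonglongrightarrow> 0"
      by (rule tendsto_divide_0[OF tendsto_const filterlim_at_top_imp_at_infinity[OF lim]])
  qed (use w in \<open>auto intro!: amb.nonneg always_eventually\<close>)
  have L_conv: "amb.sq_tendsto (\<lambda>N. U.proj {..<N} f) f" if f: "f \<in> L" for f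
  proof -
    obtain s where s: "s \<in> L" "amb.sq_tendsto (\<lambda>N. U.proj {..<N} f) s"
      using U.Fourier_series_converges[OF refl L_complete f] by blast
    define z where "z = f - s"
    have z: "z \<in> L"
      using f s by (simp add: z_def)
    have zu: "b z (u k) = 0" for k
    proof -
      have "(\<lambda>N. b (U.proj {..<N} f) (u k)) \<longlonglongrightarrow> b s (u k)"
        using s uV by (intro amb.tendsto_inner) auto
      moreover have "\<forall>\<^sub>F N in sequentially. b (U.proj {..<N} f) (u k) = b f (u k)"
        using eventually_gt_at_top[of k] by eventually_elim (simp add: U.inner_proj)
      ultimately have "b s (u k) = b f (u k)"
        by (metis LIMSEQ_unique tendsto_eventually)
      then show ?thesis
        using f s uV by (simp add: z_def amb.linear)
    qed
    have "b z z = 0"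
    proof (rule total[OF z])
      fix w assume w: "w \<in> V"
      have "amb.sq_tendsto (\<lambda>N. U.proj {..<N} w) w"
        using V_conv[OF w] w unfolding amb.sq_tendsto_def by (simp add: amb.linear algebra_simps)
      then have "(\<lambda>N. b (U.proj {..<N} w) z) \<longlonglongrightarrow> b w z"
        using w z by (intro amb.tendsto_inner) auto
      moreover have "b (U.proj {..<N} w) z = 0" for N
        unfolding U.proj_def using uV zu z amb.commute[OF z]
        by (subst amb.sum_left) (auto simp: amb.linear)
      ultimately show "b z w = 0"
        using w z amb.commute[of z w] by (simp add: LIMSEQ_const_iff)
    qed
    have "b (U.proj {..<N} f - f) (U.proj {..<N} f - f) = b (U.proj {..<N} f - s) (U.proj {..<N} f - s)" for N
    proof -
      have eq: "U.proj {..<N} f - f = (U.proj {..<N} f - s) - z"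
        by (simp add: z_def)
      show ?thesis
        unfolding eq using \<open>b z z = 0\<close> s z by (intro amb.square_diff_null) auto
    qed
    then show ?thesis
      using s(2) by (simp add: amb.sq_tendsto_def)
  qed
  have "spectral_sequence lam u"
    unfolding spectral_sequence_def
    using uV ortho eigen pos mono lim L_conv by (simp add: U.proj_def)
  then show ?thesis by blast
qed

text \<open>
  A solution for the value \<open>\<mu>\<close> is orthogonal to every \<open>u k\<close> with \<open>lam k \<noteq> \<mu>\<close> by symmetry of both forms,
  so that its Fourier series is a finite sum over the \<open>k\<close> with \<open>lam k = \<mu>\<close>. Thus no other eigenvalues
  exist, and the multiplicity is the number of repetitions.
\<close>

lemma eigenvector_expansion:
  assumes sp: "spectral_sequence lam u" and x: "x \<in> V" "\<And>w. w \<in> V \<Longrightarrow> a x w = \<mu> * b x w"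
  shows "finite {k. lam k = \<mu>}"
    and "b (x - (\<Sum>k | lam k = \<mu>. b x (u k) *\<^sub>R u k)) (x - (\<Sum>k | lam k = \<mu>. b x (u k) *\<^sub>R u k)) = 0"
proof -
  note sp = sp[unfolded spectral_sequence_def]
  interpret U: orthonormal L b u UNIV
    using sp by unfold_locales auto
  show fin: "finite {k. lam k = \<mu>}"
  proof -
    have "\<forall>\<^sub>F k in sequentially. lam k > \<mu>"
      using sp by (simp add: filterlim_at_top_dense)
    then obtain N where "\<And>k. k \<ge> N \<Longrightarrow> lam k > \<mu>"
      by (auto simp: eventually_sequentially)
    then have "{k. lam k = \<mu>} \<subseteq> {..<N}"
      by (force simp: not_less[symmetric])
    then show ?thesis
      by (rule finite_subset) simp
  qed
  have zero: "b x (u k) = 0" if "lam k \<noteq> \<mu>" for k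
  proof -
    have "\<mu> * b x (u k) = lam k * b x (u k)"
      using x(1) x(2)[of "u k"] sp form.commute[of x "u k"] amb.commute[of x "u k"] by auto
    then show ?thesis
      using that by simp
  qed
  define P where "P = (\<Sum>k | lam k = \<mu>. b x (u k) *\<^sub>R u k)"
  have "\<forall>\<^sub>F N in sequentially. {k. lam k = \<mu>} \<subseteq> {..<N}"
    using fin by (meson eventually_sequentiallyI finite_nat_iff_bounded lessThan_subset_iff order.trans)
  then have "\<forall>\<^sub>F N in sequentially. (\<Sum>k<N. b x (u k) *\<^sub>R u k) = P"
  proof eventually_elim
    case (elim N)
    then show ?case
      unfolding P_def using zero by (intro sum.mono_neutral_right) auto
  qed
  then have "(\<lambda>N. b ((\<Sum>k<N. b x (u k) *\<^sub>R u k) - x) ((\<Sum>k<N. b x (u k) *\<^sub>R u k) - x))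
      \<longlonglongrightarrow> b (P - x) (P - x)"
    by (intro tendsto_eventually) (auto elim: eventually_mono)
  moreover have "(\<lambda>N. b ((\<Sum>k<N. b x (u k) *\<^sub>R u k) - x) ((\<Sum>k<N. b x (u k) *\<^sub>R u k) - x)) \<longlonglongrightarrow> 0"
    using sp x(1) by (auto simp: amb.sq_tendsto_def)
  ultimately have "b (P - x) (P - x) = 0"
    by (rule LIMSEQ_unique)
  moreover have "P \<in> L"
    unfolding P_def using sp by (intro amb.mem_sum amb.mem) auto
  ultimately show "b (x - P) (x - P) = 0"
    using x(1) by (simp add: amb.linear)
qed

end

section \<open>Square integrable functions\<close>

definition L2_space :: "'x measure \<Rightarrow> ('x \<Rightarrow> real) set" where
  "L2_space M = {f \<in> borel_measurable M. integrable M (\<lambda>x. (f x)\<^sup>2)}"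

lemma L2_measurable: "f \<in> L2_space M \<Longrightarrow> f \<in> borel_measurable M"
  and L2_square_integrable: "f \<in> L2_space M \<Longrightarrow> integrable M (\<lambda>x. (f x)\<^sup>2)"
  by (auto simp: L2_space_def)

lemma L2_mult_integrable:
  assumes "f \<in> L2_space M" "g \<in> L2_space M"
  shows "integrable M (\<lambda>x. f x * g x)"
proof (rule Bochner_Integration.integrable_bound)
  show "integrable M (\<lambda>x. (f x)\<^sup>2 + (g x)\<^sup>2)"
    using assms by (simp add: L2_space_def)
  show "(\<lambda>x. f x * g x) \<in> borel_measurable M"
    using assms by (auto simp: L2_space_def)
  have "\<bar>p * q\<bar> \<le> p\<^sup>2 + q\<^sup>2" for p q :: real
    using sum_squares_bound[of "\<bar>p\<bar>" "\<bar>q\<bar>"] mult_nonneg_nonneg[OF abs_ge_zero abs_ge_zero, of p q]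
    unfolding abs_mult power2_abs by linarith
  then show "AE x in M. norm (f x * g x) \<le> norm ((f x)\<^sup>2 + (g x)\<^sup>2)"
    by simp
qed

lemma L2_bounded_mult:
  assumes "f \<in> L2_space M" "g \<in> borel_measurable M" "\<And>x. x \<in> space M \<Longrightarrow> \<bar>g x\<bar> \<le> B"
  shows "(\<lambda>x. g x * f x) \<in> L2_space M"
proof -
  have "integrable M (\<lambda>x. (g x * f x)\<^sup>2)"
  proof (rule Bochner_Integration.integrable_bound)
    show "integrable M (\<lambda>x. B\<^sup>2 * (f x)\<^sup>2)"
      using assms by (simp add: L2_space_def)
    show "AE x in M. norm ((g x * f x)\<^sup>2) \<le> norm (B\<^sup>2 * (f x)\<^sup>2)"
    proof (rule AE_I2)
      fix x assume "x \<in> space M"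
      then have "(g x)\<^sup>2 \<le> B\<^sup>2"
        using assms(3)[of x] by (simp add: abs_le_square_iff[symmetric])
      then show "norm ((g x * f x)\<^sup>2) \<le> norm (B\<^sup>2 * (f x)\<^sup>2)"
        by (simp add: power_mult_distrib mult_right_mono)
    qed
  qed (use assms in \<open>auto simp: L2_space_def\<close>)
  then show ?thesis
    using assms by (auto simp: L2_space_def)
qed

lemma L2_bounded:
  assumes "finite_measure M" "g \<in> borel_measurable M" "\<And>x. x \<in> space M \<Longrightarrow> \<bar>g x\<bar> \<le> B"
  shows "g \<in> L2_space M"
proof -
  interpret finite_measure M by fact
  have "(\<lambda>x. g x * 1) \<in> L2_space M"
    using assms by (intro L2_bounded_mult[where B = B]) (auto simp: L2_space_def)
  then show ?thesis by simp
qed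

lemma L2_integrable:
  assumes "finite_measure M" "f \<in> L2_space M"
  shows "integrable M f"
  using L2_mult_integrable[OF assms(2) L2_bounded[OF assms(1), of "\<lambda>_. 1" 1]] by simp

lemma L2_cong_AE:
  assumes "f \<in> L2_space M" "g \<in> borel_measurable M" "AE x in M. f x = g x"
  shows "g \<in> L2_space M"
proof -
  have "integrable M (\<lambda>x. (g x)\<^sup>2) \<longleftrightarrow> integrable M (\<lambda>x. (f x)\<^sup>2)"
    using assms by (intro integrable_cong_AE) (auto simp: L2_space_def)
  then show ?thesis
    using assms by (simp add: L2_space_def)
qed

lemma L2_subspace: "subspace (L2_space M)"
proof (rule subspaceI)
  show "f + g \<in> L2_space M" if "f \<in> L2_space M" "g \<in> L2_space M" for f g
    using that L2_mult_integrable[OF that]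
    by (auto simp: L2_space_def power2_sum plus_fun_def mult.assoc)
qed (auto simp: L2_space_def zero_fun_def scaleR_fun_def power_mult_distrib)

lemma L2_semi_inner: "semi_inner (L2_space M) (\<lambda>f g. \<integral>x. f x * g x \<partial>M)"
  using L2_subspace
  by unfold_locales
    (auto simp: L2_mult_integrable algebra_simps Bochner_Integration.integral_add
      intro!: Bochner_Integration.integral_nonneg)

lemma L2_diff: "f \<in> L2_space M \<Longrightarrow> g \<in> L2_space M \<Longrightarrow> (\<lambda>x. f x - g x) \<in> L2_space M"
  using subspace_diff[OF L2_subspace, of f M g] by (simp add: fun_diff_def)

lemma L2_add: "f \<in> L2_space M \<Longrightarrow> g \<in> L2_space M \<Longrightarrow> (\<lambda>x. f x + g x) \<in> L2_space M"
  using subspace_add[OF L2_subspace, of f M g] by (simp add: plus_fun_def)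

lemma L2_scale: "f \<in> L2_space M \<Longrightarrow> (\<lambda>x. c * f x) \<in> L2_space M"
  using subspace_scale[OF L2_subspace, of f M c] by (simp add: scaleR_fun_def)

lemma L2_Cauchy_Schwarz:
  assumes "f \<in> L2_space M" "g \<in> L2_space M"
  shows "(\<integral>x. f x * g x \<partial>M)\<^sup>2 \<le> (\<integral>x. (f x)\<^sup>2 \<partial>M) * (\<integral>x. (g x)\<^sup>2 \<partial>M)"
  using semi_inner.Cauchy_Schwarz[OF L2_semi_inner assms] by (simp add: power2_eq_square)

lemma L2_norm_zero_iff:
  assumes "f \<in> L2_space M"
  shows "(\<integral>x. (f x)\<^sup>2 \<partial>M) = 0 \<longleftrightarrow> (AE x in M. f x = 0)"
  using integral_nonneg_eq_0_iff_AE[OF L2_square_integrable[OF assms]] by simp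

text \<open>
  The sum of \<open>2 ^ k * (X (Suc k) - X k)\<^sup>2\<close> over \<open>k\<close> has finite integral, hence is finite almost
  everywhere, and there the increments decay geometrically.
\<close>

lemma L2_fast_Cauchy_AE_convergent:
  assumes X: "\<And>k. X k \<in> L2_space M"
    and fast: "\<And>k. (\<integral>x. (X (Suc k) x - X k x)\<^sup>2 \<partial>M) \<le> (1 / 4) ^ k"
  shows "AE x in M. convergent (\<lambda>k. X k x)"
proof -
  define d where "d k x = X (Suc k) x - X k x" for k x
  have d: "d k \<in> L2_space M" for k
    unfolding d_def using X by (intro L2_diff)
  have [measurable]: "d k \<in> borel_measurable M" for k
    using d by (rule L2_measurable)
  have "(\<integral>\<^sup>+x. (\<Sum>k. ennreal (2 ^ k * (d k x)\<^sup>2)) \<partial>M) = (\<Sum>k. \<integral>\<^sup>+x. ennreal (2 ^ k * (d k x)\<^sup>2) \<partial>M)"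
    by (rule nn_integral_suminf) measurable
  also have "\<dots> \<le> (\<Sum>k. ennreal ((1 / 2) ^ k))"
  proof (rule suminf_le)
    fix k
    have "(\<integral>\<^sup>+x. ennreal (2 ^ k * (d k x)\<^sup>2) \<partial>M) = ennreal (\<integral>x. 2 ^ k * (d k x)\<^sup>2 \<partial>M)"
      using L2_square_integrable[OF d] by (intro nn_integral_eq_integral) auto
    also have "(\<integral>x. 2 ^ k * (d k x)\<^sup>2 \<partial>M) \<le> 2 ^ k * (1 / 4) ^ k"
      using fast[of k] by (simp add: d_def)
    also have "\<dots> = (1 / 2 :: real) ^ k"
      by (simp flip: power_mult_distrib)
    finally show "(\<integral>\<^sup>+x. ennreal (2 ^ k * (d k x)\<^sup>2) \<partial>M) \<le> ennreal ((1 / 2) ^ k)"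
      by (auto simp: ennreal_leI)
  qed auto
  also have "\<dots> = ennreal (\<Sum>k. (1 / 2) ^ k)"
    by (intro suminf_ennreal2 summable_geometric) auto
  also have "\<dots> < \<infinity>"
    by simp
  finally have "AE x in M. (\<Sum>k. ennreal (2 ^ k * (d k x)\<^sup>2)) \<noteq> \<infinity>"
    by (intro nn_integral_PInf_AE) auto
  then show ?thesis
  proof eventually_elim
    case (elim x)
    define t where "t k = ennreal (2 ^ k * (d k x)\<^sup>2)" for k
    define B where "B = enn2real (suminf t)"
    have B: "suminf t = ennreal B" "B \<ge> 0"
      using elim by (auto simp: B_def t_def[abs_def] less_top)
    have bound: "\<bar>d k x\<bar> \<le> sqrt B * (sqrt (1 / 2)) ^ k" for k
    proof -
      have "sum t {k} \<le> suminf t"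
        by (rule sum_le_suminf) auto
      then have "ennreal (2 ^ k * (d k x)\<^sup>2) \<le> ennreal B"
        by (simp add: B(1) t_def)
      then have "2 ^ k * (d k x)\<^sup>2 \<le> B"
        using B(2) by (rule ennreal_le_iff[THEN iffD1, rotated])
      then have "(d k x)\<^sup>2 \<le> B * (1 / 2) ^ k"
        by (simp add: field_simps power_one_over)
      then have "sqrt ((d k x)\<^sup>2) \<le> sqrt (B * (1 / 2) ^ k)"
        by (rule real_sqrt_le_mono)
      moreover have "sqrt (B * (1 / 2) ^ k) = sqrt B * (sqrt (1 / 2)) ^ k"
        by (simp add: real_sqrt_mult real_sqrt_power)
      ultimately show ?thesis
        by simp
    qed
    have "summable (\<lambda>k. d k x)"
    proof (rule summable_comparison_test)
      show "\<exists>N. \<forall>n\<ge>N. norm (d n x) \<le> sqrt B * (sqrt (1 / 2)) ^ n"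
        using bound by auto
      show "summable (\<lambda>n. sqrt B * (sqrt (1 / 2)) ^ n)"
        by (intro summable_mult summable_geometric) auto
    qed
    then have "convergent (\<lambda>n. \<Sum>k<n. d k x)"
      by (simp add: summable_iff_convergent)
    moreover have "(\<Sum>k<n. d k x) = X n x - X 0 x" for n
      unfolding d_def by (induction n) auto
    ultimately show "convergent (\<lambda>k. X k x)"
      by (simp add: convergent_diff_const_right_iff)
  qed
qed

text \<open>
  Riesz--Fischer theorem: a subsequence with rapidly decreasing increments converges almost
  everywhere, and Fatou's lemma turns its pointwise limit into a limit in the mean of the whole
  sequence.
\<close>

theorem L2_complete: "semi_inner.sq_complete (L2_space M) (\<lambda>f g. \<integral>x. f x * g x \<partial>M)"
proof -
  interpret semi_inner "L2_space M" "\<lambda>f g. \<integral>x. f x * g x \<partial>M"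
    by (rule L2_semi_inner)
  show ?thesis
    unfolding sq_complete_def
  proof (intro allI impI, elim conjE)
    fix X assume X: "\<forall>n. X n \<in> L2_space M" and C: "sq_Cauchy X"
    have C: "\<exists>N. \<forall>m\<ge>N. \<forall>n\<ge>N. (\<integral>x. (X m x - X n x)\<^sup>2 \<partial>M) < \<epsilon>" if "\<epsilon> > 0" for \<epsilon>
      using C that unfolding sq_Cauchy_def by (auto simp: power2_eq_square)
    obtain r where r: "strict_mono r" "\<And>k m n. m \<ge> r k \<Longrightarrow> n \<ge> r k \<Longrightarrow> (\<integral>x. (X m x - X n x)\<^sup>2 \<partial>M) < (1 / 4) ^ k"
    proof -
      obtain N where N: "\<And>k m n. m \<ge> N k \<Longrightarrow> n \<ge> N k \<Longrightarrow> (\<integral>x. (X m x - X n x)\<^sup>2 \<partial>M) < (1 / 4) ^ k"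
        using C[of "(1 / 4) ^ k" for k] by atomize_elim (intro choice, auto)
      \<comment> \<open>At least \<open>N k\<close>, and strictly increasing.\<close>
      define r where "r k = (\<Sum>j\<le>k. N j) + k" for k
      have "N k \<le> r k" for k
        unfolding r_def by (intro trans_le_add1 member_le_sum) auto
      moreover have "strict_mono r"
        by (simp add: strict_mono_Suc_iff r_def)
      ultimately show ?thesis
        using N le_trans by (intro that[of r]) blast+
    qed
    have rle: "r k \<le> r (Suc k)" for k
      using r(1) by (simp add: strict_mono_Suc_iff less_imp_le)
    have conv: "AE x in M. convergent (\<lambda>k. X (r k) x)"
      using X r(2) rle by (intro L2_fast_Cauchy_AE_convergent) (auto intro: less_imp_le)
    define f where "f x = lim (\<lambda>k. X (r k) x)" for x
    have [measurable]: "X n \<in> borel_measurable M" for n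
      using X L2_measurable by auto
    have [measurable]: "f \<in> borel_measurable M"
      unfolding f_def by measurable
    have *: "(\<lambda>x. X n x - f x) \<in> L2_space M \<and> (\<integral>x. (X n x - f x)\<^sup>2 \<partial>M) \<le> (1 / 4) ^ k"
      if n: "n \<ge> r k" for n k
    proof -
      have "(\<integral>\<^sup>+x. ennreal ((X n x - f x)\<^sup>2) \<partial>M)
          = (\<integral>\<^sup>+x. liminf (\<lambda>j. ennreal ((X n x - X (r j) x)\<^sup>2)) \<partial>M)"
      proof (rule nn_integral_cong_AE)
        show "AE x in M. ennreal ((X n x - f x)\<^sup>2) = liminf (\<lambda>j. ennreal ((X n x - X (r j) x)\<^sup>2))"
          using conv
        proof eventually_elim
          case (elim x)
          then have "(\<lambda>j. X (r j) x) \<longlonglongrightarrow> f x"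
            by (simp add: convergent_LIMSEQ_iff f_def)
          then have "(\<lambda>j. ennreal ((X n x - X (r j) x)\<^sup>2)) \<longlonglongrightarrow> ennreal ((X n x - f x)\<^sup>2)"
            by (intro tendsto_intros tendsto_ennrealI)
          then show ?case
            by (metis lim_imp_Liminf sequentially_bot)
        qed
      qed
      also have "\<dots> \<le> liminf (\<lambda>j. \<integral>\<^sup>+x. ennreal ((X n x - X (r j) x)\<^sup>2) \<partial>M)"
        by (intro nn_integral_liminf) auto
      also have "\<dots> \<le> ennreal ((1 / 4) ^ k)"
      proof -
        have "(\<integral>\<^sup>+x. ennreal ((X n x - X (r j) x)\<^sup>2) \<partial>M) \<le> ennreal ((1 / 4) ^ k)" if "j \<ge> k" for j
        proof -
          have "integrable M (\<lambda>x. (X n x - X (r j) x)\<^sup>2)"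
            using L2_square_integrable[OF L2_diff, of "X n" M "X (r j)"] X by simp
          moreover have "r k \<le> r j"
            using strict_mono_less_eq[OF r(1)] that by simp
          ultimately show ?thesis
            using r(2)[of k n "r j"] n by (subst nn_integral_eq_integral) (auto intro!: ennreal_leI less_imp_le)
        qed
        then have "\<forall>\<^sub>F j in sequentially. (\<integral>\<^sup>+x. ennreal ((X n x - X (r j) x)\<^sup>2) \<partial>M) \<le> ennreal ((1 / 4) ^ k)"
          by (auto simp: eventually_sequentially)
        then have "limsup (\<lambda>j. \<integral>\<^sup>+x. ennreal ((X n x - X (r j) x)\<^sup>2) \<partial>M) \<le> ennreal ((1 / 4) ^ k)"
          by (rule Limsup_bounded)
        then show ?thesis
          using Liminf_le_Limsup[OF sequentially_bot] order.trans by blast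
      qed
      finally have le: "(\<integral>\<^sup>+x. ennreal ((X n x - f x)\<^sup>2) \<partial>M) \<le> ennreal ((1 / 4) ^ k)" .
      have int: "integrable M (\<lambda>x. (X n x - f x)\<^sup>2)"
        using order.strict_trans1[OF le ennreal_less_top] by (intro integrableI_nonneg) auto
      then have "ennreal (\<integral>x. (X n x - f x)\<^sup>2 \<partial>M) \<le> ennreal ((1 / 4) ^ k)"
        using le by (subst (asm) nn_integral_eq_integral) auto
      then show ?thesis
        using int by (simp add: L2_space_def)
    qed
    have f: "f \<in> L2_space M"
      using L2_diff[of "X (r 0)" M "\<lambda>x. X (r 0) x - f x"] X *[of 0 "r 0"] by simp
    have "sq_tendsto X f"
      unfolding sq_tendsto_def
    proof (rule LIMSEQ_I)
      fix \<epsilon> :: real assume "\<epsilon> > 0"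
      then obtain k where k: "(1 / 4) ^ k < \<epsilon>"
        using real_arch_pow_inv[of \<epsilon> "1 / 4"] by auto
      have "norm ((\<integral>x. (X n - f) x * (X n - f) x \<partial>M) - 0) < \<epsilon>" if "n \<ge> r k" for n
      proof -
        have "norm ((\<integral>x. (X n - f) x * (X n - f) x \<partial>M) - 0) = (\<integral>x. (X n x - f x)\<^sup>2 \<partial>M)"
          by (simp add: power2_eq_square abs_of_nonneg integral_nonneg_AE)
        then show ?thesis
          using *[OF that] k by linarith
      qed
      then show "\<exists>N. \<forall>n\<ge>N. norm ((\<integral>x. (X n - f) x * (X n - f) x \<partial>M) - 0) < \<epsilon>"
        by blast
    qed
    then show "\<exists>f\<in>L2_space M. sq_tendsto X f"
      using f by blast
  qed
qed

section \<open>Lebesgue integration on an interval\<close>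

abbreviation Leb :: "real \<Rightarrow> real measure" where
  "Leb l \<equiv> lebesgue_on {0<..<l}"

lemma L2_interval_eq: "L2_interval l = L2_space (Leb l)"
  by (simp add: L2_interval_def L2_space_def)

lemma finite_measure_Leb: "finite_measure (Leb l)"
  by (simp add: finite_measure_lebesgue_on)

text \<open>
  Lebesgue measure is complete; this makes \<^const>\<open>RL_deriv\<close> measurable although it is known almost
  everywhere only.
\<close>

lemma borel_measurable_Leb_cong_AE:
  fixes f g :: "real \<Rightarrow> real"
  assumes "f \<in> borel_measurable (Leb l)" "AE x in Leb l. f x = g x"
  shows "g \<in> borel_measurable (Leb l)"
proof -
  obtain N where N: "N \<in> null_sets (Leb l)" "{x \<in> space (Leb l). f x \<noteq> g x} \<subseteq> N"
    using assms(2) by (auto elim!: AE_E simp: null_sets_def)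
  have "f \<in> borel_measurable (lebesgue_on ({0<..<l} - N))"
    using assms(1) by (rule measurable_restrict_mono) auto
  then have "g \<in> borel_measurable (lebesgue_on ({0<..<l} - N))"
    using N(2) by (subst measurable_lebesgue_cong[where g = f]) auto
  then show ?thesis
    using borel_measurable_diff_null[OF N(1), of g] by simp
qed

lemma integral_Leb_restrict:
  fixes f :: "real \<Rightarrow> real"
  assumes "x \<le> l"
  shows "(LINT t|Leb x. f t) = (LINT t|Leb l. (if t < x then f t else 0))"
proof -
  have "(LINT t|Leb l. (if t \<in> {0<..<x} then f t else 0)) = (LINT t|Leb x. f t)"
    using assms by (intro integral_restrict) auto
  moreover have "(LINT t|Leb l. (if t \<in> {0<..<x} then f t else 0)) = (LINT t|Leb l. (if t < x then f t else 0))"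
    by (intro Bochner_Integration.integral_cong) auto
  ultimately show ?thesis by simp
qed

lemma integrable_Leb_restrict:
  fixes f :: "real \<Rightarrow> real"
  assumes "integrable (Leb l) f" "x \<le> l"
  shows "integrable (Leb x) f"
proof -
  have "set_integrable lebesgue {0<..<l} f"
    using assms(1) by (simp add: integrable_restrict_space set_integrable_def)
  then have "set_integrable lebesgue {0<..<x} f"
    by (rule set_integrable_subset) (use assms(2) in auto)
  then show ?thesis
    by (simp add: integrable_restrict_space set_integrable_def)
qed

lemma AE_Leb_mono:
  assumes "AE t in Leb l. P t" "x \<le> l"
  shows "AE t in Leb x. P t"
proof -
  have "AE t in lebesgue. t \<in> {0<..<l} \<longrightarrow> P t"
    using assms(1) by (subst (asm) AE_restrict_space_iff) auto
  then have "AE t in lebesgue. t \<in> {0<..<x} \<longrightarrow> P t"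
    by (rule eventually_mono) (use assms(2) in auto)
  then show ?thesis
    by (subst AE_restrict_space_iff) auto
qed

lemma AE_Leb_Icc_iff: "(AE x in lebesgue_on {0..l}. P x) \<longleftrightarrow> (AE x in Leb l. P x)"
proof
  assume "AE x in lebesgue_on {0..l}. P x"
  then have "AE x in lebesgue. x \<in> {0..l} \<longrightarrow> P x"
    by (subst (asm) AE_restrict_space_iff) auto
  then have "AE x in lebesgue. x \<in> {0<..<l} \<longrightarrow> P x"
    by (rule eventually_mono) auto
  then show "AE x in Leb l. P x"
    by (subst AE_restrict_space_iff) auto
next
  assume "AE x in Leb l. P x"
  then have "AE x in lebesgue. x \<in> {0<..<l} \<longrightarrow> P x"
    by (subst (asm) AE_restrict_space_iff) auto
  moreover have "AE x in lebesgue. x \<noteq> 0" "AE x in lebesgue. x \<noteq> l"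
    by (auto intro!: AE_completion AE_lborel_singleton)
  ultimately have "AE x in lebesgue. x \<in> {0..l} \<longrightarrow> P x"
    by eventually_elim force
  then show "AE x in lebesgue_on {0..l}. P x"
    by (subst AE_restrict_space_iff) auto
qed

lemma integral_Leb_square_le:
  assumes "\<phi> \<in> L2_space (Leb l)" "0 \<le> l"
  shows "(LINT t|Leb l. \<phi> t)\<^sup>2 \<le> l * (LINT t|Leb l. (\<phi> t)\<^sup>2)"
proof -
  have "(\<lambda>_. 1) \<in> L2_space (Leb l)"
    by (rule L2_bounded[OF finite_measure_Leb, of _ _ 1]) auto
  from L2_Cauchy_Schwarz[OF this assms(1)] show ?thesis
    using assms(2) by (simp add: measure_restrict_space)
qed

lemma integral_Leb_continuous:
  fixes f :: "real \<Rightarrow> real"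
  assumes "integrable (Leb l) f"
  shows "continuous_on {0..l} (\<lambda>y. LINT t|Leb y. f t)"
proof -
  have "f integrable_on {0..l}"
    using integrable_on_lebesgue_on[OF assms] by (simp add: integrable_on_open_interval_real)
  then have "continuous_on {0..l} (\<lambda>y. integral {0..y} f)"
    by (rule indefinite_integral_continuous_1)
  moreover have "(LINT t|Leb y. f t) = integral {0..y} f" if "y \<in> {0..l}" for y
    using that lebesgue_integral_eq_integral[OF integrable_Leb_restrict[OF assms]]
    by (simp add: integral_open_interval_real)
  ultimately show ?thesis
    by (auto intro: continuous_on_eq)
qed

lemma indefinite_integral_ends:
  fixes f :: "real \<Rightarrow> real"
  assumes "integrable (Leb l) f" "0 < l" and eq: "\<And>y. 0 < y \<Longrightarrow> y < l \<Longrightarrow> F y = c + (LINT t|Leb y. f t)"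
  shows "continuous_on {0<..<l} F" "(F \<longlongrightarrow> c) (at_right 0)" "(F \<longlongrightarrow> c + (LINT t|Leb l. f t)) (at_left l)"
proof -
  define g where "g y = c + (LINT t|Leb y. f t)" for y
  have "continuous_on {0..l} g"
    unfolding g_def by (intro continuous_intros integral_Leb_continuous assms)
  then have g: "continuous_on {0<..<l} g" "(g \<longlongrightarrow> g 0) (at_right 0)" "(g \<longlongrightarrow> g l) (at_left l)"
    using assms(2) by (auto intro: continuous_on_subset continuous_on_Icc_at_rightD continuous_on_Icc_at_leftD)
  have F: "F y = g y" if "y \<in> {0<..<l}" for y
    using eq[of y] that by (simp add: g_def)
  show "continuous_on {0<..<l} F"
    using g(1) by (rule continuous_on_eq) (simp add: F)
  have "\<forall>\<^sub>F y in at_right 0. F y = g y" "\<forall>\<^sub>F y in at_left l. F y = g y"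
    using assms(2) F by (auto simp: eventually_at_right_field eventually_at_left_field)
  then have "(F \<longlongrightarrow> g 0) (at_right 0)" "(F \<longlongrightarrow> g l) (at_left l)"
    using g(2,3) tendsto_cong by blast+
  then show "(F \<longlongrightarrow> c) (at_right 0)" "(F \<longlongrightarrow> c + (LINT t|Leb l. f t)) (at_left l)"
    by (simp_all add: g_def)
qed

lemma Lebesgue_differentiation_right:
  fixes f :: "real \<Rightarrow> real"
  assumes "\<And>a b. f integrable_on {a..b}"
  obtains N where "negligible N"
    "\<And>x \<epsilon>. x \<notin> N \<Longrightarrow> 0 < \<epsilon> \<Longrightarrow> \<exists>d>0. \<forall>h. 0 < h \<and> h < d \<longrightarrow> \<bar>integral {x..x + h} f / h - f x\<bar> < \<epsilon>"
  using integrable_ccontinuous_explicit[of f] assms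
  by (auto simp: divide_inverse mult.commute)

text \<open>
  Lebesgue's differentiation theorem. The one-sided statement applied to \<open>g\<close> gives the right
  derivative, and applied to the reflection of \<open>g\<close> the left derivative.
\<close>

theorem indefinite_integral_has_derivative_AE:
  fixes f :: "real \<Rightarrow> real"
  assumes "integrable (Leb l) f"
  shows "AE x in Leb l. ((\<lambda>y. LINT t|Leb y. f t) has_real_derivative f x) (at x)"
proof -
  \<comment> \<open>Extension by zero, so that the differentiation theorem for the whole line applies.\<close>
  define g where "g x = (if x \<in> {0<..<l} then f x else 0)" for x
  have "integrable lebesgue g"
    unfolding g_def using assms by (subst Lebesgue_Measure.integrable_restrict_UNIV) auto
  then have "g integrable_on UNIV"
    by (rule integrable_on_lebesgue)
  then have gi: "g integrable_on {a..b}" for a b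
    using integrable_on_subcbox[of g UNIV a b] by auto
  then have gi': "(\<lambda>x. g (- x)) integrable_on {a..b}" for a b
    using Henstock_Kurzweil_Integration.integrable_reflect_real[of g "- a" "- b"] by simp
  obtain N where N: "negligible N"
    "\<And>x \<epsilon>. x \<notin> N \<Longrightarrow> 0 < \<epsilon> \<Longrightarrow> \<exists>d>0. \<forall>h. 0 < h \<and> h < d \<longrightarrow> \<bar>integral {x..x + h} g / h - g x\<bar> < \<epsilon>"
    using Lebesgue_differentiation_right[OF gi] by metis
  obtain N' where N': "negligible N'"
    "\<And>x \<epsilon>. x \<notin> N' \<Longrightarrow> 0 < \<epsilon> \<Longrightarrow> \<exists>d>0. \<forall>h. 0 < h \<and> h < d \<longrightarrow> \<bar>integral {x..x + h} (\<lambda>x. g (- x)) / h - g (- x)\<bar> < \<epsilon>"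
    using Lebesgue_differentiation_right[OF gi'] by metis
  define F where "F y = (LINT t|Leb y. f t)" for y
  have F: "F y = integral {0..y} g" if "0 \<le> y" "y \<le> l" for y
  proof -
    have "F y = integral {0<..<y} f"
      unfolding F_def using assms that
      by (intro lebesgue_integral_eq_integral integrable_Leb_restrict[OF assms]) auto
    also have "\<dots> = integral {0<..<y} g"
      using that by (intro integral_cong) (auto simp: g_def)
    also have "\<dots> = integral {0..y} g"
      by (simp add: integral_open_interval_real)
    finally show ?thesis .
  qed
  have diff: "F y - F x = integral {x..y} g" if "0 \<le> x" "x \<le> y" "y \<le> l" for x y
    using that F[of x] F[of y] Henstock_Kurzweil_Integration.integral_combine[of 0 x y g] gi by simp
  have deriv: "(F has_real_derivative f x) (at x)" if x: "x \<in> {0<..<l}" "x \<notin> N" "- x \<notin> N'" for x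
    unfolding DERIV_def LIM_eq
  proof (intro allI impI)
    fix \<epsilon> :: real assume \<epsilon>: "0 < \<epsilon>"
    obtain d where d: "d > 0" "\<And>h. 0 < h \<Longrightarrow> h < d \<Longrightarrow> \<bar>integral {x..x + h} g / h - g x\<bar> < \<epsilon>"
      using N(2)[OF x(2) \<epsilon>] by blast
    obtain d' where d': "d' > 0" "\<And>h. 0 < h \<Longrightarrow> h < d' \<Longrightarrow> \<bar>integral {-x..-x + h} (\<lambda>x. g (- x)) / h - g x\<bar> < \<epsilon>"
      using N'(2)[OF x(3) \<epsilon>] by auto
    define \<delta> where "\<delta> = min (min d d') (min x (l - x))"
    have "norm ((F (x + h) - F x) / h - f x) < \<epsilon>" if h: "h \<noteq> 0" "norm (h - 0) < \<delta>" for h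
    proof (cases "h > 0")
      case True
      then have "F (x + h) - F x = integral {x..x + h} g" "h < d"
        using h x by (auto simp: \<delta>_def intro!: diff)
      then show ?thesis
        using d(2)[OF True] x by (simp add: g_def)
    next
      case False
      then have *: "F x - F (x + h) = integral {x + h..x} g" "- h < d'" "0 < - h"
        using h x by (auto simp: \<delta>_def intro!: diff)
      have "integral {-x..-x + - h} (\<lambda>x. g (- x)) = integral {x + h..x} g"
        using Henstock_Kurzweil_Integration.integral_reflect_real[of x "x + h" g] by (simp add: algebra_simps)
      moreover have "(F (x + h) - F x) / h = (F x - F (x + h)) / (- h)"
        using h(1) by (simp add: divide_simps)
      ultimately show ?thesis
        using d'(2)[OF *(3,2)] * x by (simp add: g_def)
    qed
    moreover have "\<delta> > 0"
      using d(1) d'(1) x by (auto simp: \<delta>_def)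
    ultimately show "\<exists>s>0. \<forall>h. h \<noteq> 0 \<and> norm (h - 0) < s \<longrightarrow> norm ((F (x + h) - F x) / h - f x) < \<epsilon>"
      by blast
  qed
  have "AE x in Leb l. x \<in> {0<..<l} \<and> x \<notin> N \<and> - x \<notin> N'"
  proof -
    have "negligible (uminus ` N')"
      using N(1) N'(1) by (intro negligible_differentiable_image_negligible) (auto intro!: derivative_intros simp: differentiable_on_def)
    then have "N \<union> uminus ` N' \<in> null_sets lebesgue"
      using N(1) negligible_Un negligible_iff_null_sets by blast
    then have "AE x in lebesgue. x \<notin> N \<union> uminus ` N'"
      by (rule AE_not_in)
    then have "AE x in lebesgue. x \<notin> N \<and> - x \<notin> N'"
      by eventually_elim (metis UnI1 UnI2 image_eqI minus_minus)
    then have "AE x in lebesgue. x \<in> {0<..<l} \<longrightarrow> x \<in> {0<..<l} \<and> x \<notin> N \<and> - x \<notin> N'"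
      by (rule eventually_mono) auto
    then show ?thesis
      by (subst AE_restrict_space_iff) auto
  qed
  then show ?thesis
    by (rule eventually_mono) (use deriv in \<open>auto simp: F_def[abs_def]\<close>)
qed

section \<open>Fractional integrals of square integrable functions\<close>

lemma has_bochner_integral_congI:
  assumes "has_bochner_integral M f I" "\<And>x. x \<in> space M \<Longrightarrow> f x = g x"
  shows "has_bochner_integral M g I"
  using assms has_bochner_integral_cong[of M M f g I I] by simp

lemma has_bochner_integral_Leb_restrict:
  fixes f :: "real \<Rightarrow> real"
  assumes "(f has_integral I) {c..d}" "\<And>t. c < t \<Longrightarrow> t < d \<Longrightarrow> 0 \<le> f t" "0 \<le> c" "d \<le> l"
  shows "has_bochner_integral (Leb l) (\<lambda>t. if c < t \<and> t < d then f t else 0) I"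
proof -
  have I: "(f has_integral I) {c<..<d}"
    using assms(1) by (simp add: has_integral_Icc_iff_Ioo)
  then have int: "integrable (lebesgue_on {c<..<d}) f"
    using assms(2)
    by (intro absolutely_integrable_imp_integrable nonnegative_absolutely_integrable_1) (auto simp: integrable_on_def)
  then have "has_bochner_integral (lebesgue_on {c<..<d}) f I"
    using lebesgue_integral_eq_integral[OF int] I by (simp add: has_bochner_integral_iff integral_unique)
  then have "has_bochner_integral lebesgue (\<lambda>t. indicator {c<..<d} t *\<^sub>R f t) I"
    by (simp add: has_bochner_integral_restrict_space)
  also have "(\<lambda>t. indicator {c<..<d} t *\<^sub>R f t)
      = (\<lambda>t. indicator {0<..<l} t *\<^sub>R (if c < t \<and> t < d then f t else 0))"
    using assms(3,4) by (auto simp: indicator_def fun_eq_iff)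
  finally show ?thesis
    by (simp add: has_bochner_integral_restrict_space)
qed

lemma has_integral_powr_right_end:
  fixes a c d :: real
  assumes "a > -1" "c \<le> d"
  shows "((\<lambda>t. (d - t) powr a) has_integral ((d - c) powr (a + 1) / (a + 1))) {c..d}"
  using has_integral_affinity[of "\<lambda>x. x powr a" _ 0 "d - c" "-1" d] has_integral_powr_from_0[of a "d - c"] assms
  by (simp add: image_affinity_atLeastAtMost_diff algebra_simps)

lemma has_integral_powr_left_end:
  fixes a c d :: real
  assumes "a > -1" "c \<le> d"
  shows "((\<lambda>t. (t - c) powr a) has_integral ((d - c) powr (a + 1) / (a + 1))) {c..d}"
  using has_integral_affinity[of "\<lambda>x. x powr a" _ 0 "d - c" 1 "- c"] has_integral_powr_from_0[of a "d - c"] assms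
  by (simp add: algebra_simps)

lemma has_integral_Beta_interval:
  fixes a b c d :: real
  assumes "a > 0" "b > 0" "c < d"
  shows "((\<lambda>t. (t - c) powr (a - 1) * (d - t) powr (b - 1)) has_integral
    (d - c) powr (a + b - 1) * Beta a b) {c..d}"
proof -
  \<comment> \<open>Substitute \<open>m * t - c * m\<close>, which maps \<open>{c..d}\<close> onto \<open>{0..1}\<close>, in the Beta integral.\<close>
  define m where "m = 1 / (d - c)"
  have m: "m > 0" "1 / m = d - c"
    using assms by (auto simp: m_def)
  have "((\<lambda>t. (m * t + (- c * m)) powr (a - 1) * (1 - (m * t + (- c * m))) powr (b - 1)) has_integral Beta a b / m) {c..d}"
  proof -
    have "1 - - c * m = d * m"
      using assms by (simp add: m_def field_simps)
    then have ends: "(0 - - c * m) /\<^sub>R m = c" "(1 - - c * m) /\<^sub>R m = d"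
      using m(1) by simp_all
    show ?thesis
      using has_integral_affinity'[OF has_integral_Beta_real[OF assms(1,2), folded cbox_interval] m(1), of "- c * m"]
      unfolding ends by (simp add: divide_inverse mult.commute)
  qed
  moreover have "m * t + (- c * m) = (t - c) / (d - c)" for t
    by (simp add: m_def diff_divide_distrib)
  moreover have "1 - (t - c) / (d - c) = (d - t) / (d - c)" for t
    using assms by (simp add: divide_simps)
  ultimately have "((\<lambda>t. ((t - c) / (d - c)) powr (a - 1) * ((d - t) / (d - c)) powr (b - 1)) has_integral Beta a b * (d - c)) {c..d}"
    using m by (simp add: m_def)
  then have "((\<lambda>t. (d - c) powr (a + b - 2) * (((t - c) / (d - c)) powr (a - 1) * ((d - t) / (d - c)) powr (b - 1))) has_integral
      (d - c) powr (a + b - 2) * (Beta a b * (d - c))) {c..d}"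
    by (rule has_integral_mult_right)
  moreover have "(d - c) powr (a + b - 2) * (Beta a b * (d - c)) = (d - c) powr (a + b - 1) * Beta a b"
  proof -
    have "(d - c) powr (a + b - 1) = (d - c) powr (a + b - 2) * (d - c) powr 1"
      by (simp only: powr_add[symmetric]) simp
    then show ?thesis
      using assms by simp
  qed
  moreover have "(d - c) powr (a + b - 2) * (((t - c) / (d - c)) powr (a - 1) * ((d - t) / (d - c)) powr (b - 1))
      = (t - c) powr (a - 1) * (d - t) powr (b - 1)" if "t \<in> {c..d}" for t
  proof -
    have "(d - c) powr (a + b - 2) = (d - c) powr (a - 1) * (d - c) powr (b - 1)"
      by (simp add: powr_add[symmetric])
    then show ?thesis
      using that assms by (simp add: powr_divide)
  qed
  ultimately show ?thesis
    using has_integral_cong[of "{c..d}" "\<lambda>t. (d - c) powr (a + b - 2) * (((t - c) / (d - c)) powr (a - 1) * ((d - t) / (d - c)) powr (b - 1))"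
      "\<lambda>t. (t - c) powr (a - 1) * (d - t) powr (b - 1)"] by simp
qed

text \<open>
  Fubini's theorem for an integral operator whose kernel \<open>H\<close> has uniformly bounded integrals in its
  second argument. It yields the semigroup law, the adjoint and the injectivity of the fractional
  integral by three choices of \<open>H\<close>.
\<close>

lemma kernel_Fubini:
  fixes H :: "'x \<Rightarrow> 'x \<Rightarrow> real"
  assumes "sigma_finite_measure M" "integrable M \<phi>"
    and H: "(\<lambda>(t, x). H t x) \<in> borel_measurable (M \<Otimes>\<^sub>M M)"
    and int: "\<And>t. t \<in> space M \<Longrightarrow> integrable M (H t)"
    and bound: "\<And>t. t \<in> space M \<Longrightarrow> (\<integral>x. \<bar>H t x\<bar> \<partial>M) \<le> B"
  shows "integrable M (\<lambda>x. \<integral>t. \<phi> t * H t x \<partial>M)"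
    and "(\<integral>x. (\<integral>t. \<phi> t * H t x \<partial>M) \<partial>M) = (\<integral>t. \<phi> t * (\<integral>x. H t x \<partial>M) \<partial>M)"
proof -
  interpret sigma_finite_measure M by fact
  interpret pair_sigma_finite M M ..
  have [measurable]: "\<phi> \<in> borel_measurable M"
    using assms(2) by simp
  note H[measurable]
  have "integrable (M \<Otimes>\<^sub>M M) (\<lambda>(t, x). \<phi> t * H t x)"
  proof (rule Fubini_integrable)
    show "integrable M (\<lambda>t. \<integral>x. norm (case (t, x) of (t, x) \<Rightarrow> \<phi> t * H t x) \<partial>M)"
    proof (rule Bochner_Integration.integrable_bound)
      show "integrable M (\<lambda>t. B * \<phi> t)"
        using assms(2) by simp
      show "AE t in M. norm (\<integral>x. norm (case (t, x) of (t, x) \<Rightarrow> \<phi> t * H t x) \<partial>M) \<le> norm (B * \<phi> t)"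
      proof (rule AE_I2)
        fix t assume t: "t \<in> space M"
        have "0 \<le> (\<integral>x. \<bar>H t x\<bar> \<partial>M)"
          by simp
        then show "norm (\<integral>x. norm (case (t, x) of (t, x) \<Rightarrow> \<phi> t * H t x) \<partial>M) \<le> norm (B * \<phi> t)"
          using bound[OF t] by (simp add: abs_mult mult.commute[of "\<bar>B\<bar>"] mult_left_mono)
      qed
    qed measurable
    show "AE t in M. integrable M (\<lambda>x. case (t, x) of (t, x) \<Rightarrow> \<phi> t * H t x)"
      using int by (intro AE_I2) simp
  qed measurable
  note I = this
  show "integrable M (\<lambda>x. \<integral>t. \<phi> t * H t x \<partial>M)"
    using integrable_snd[OF I] by simp
  have "(\<integral>x. (\<integral>t. \<phi> t * H t x \<partial>M) \<partial>M) = (\<integral>t. (\<integral>x. \<phi> t * H t x \<partial>M) \<partial>M)"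
    using Fubini_integral[OF I] by simp
  then show "(\<integral>x. (\<integral>t. \<phi> t * H t x \<partial>M) \<partial>M) = (\<integral>t. \<phi> t * (\<integral>x. H t x \<partial>M) \<partial>M)"
    by simp
qed

text \<open>
  The kernel of the Riemann--Liouville integral, extended by zero to \<open>t \<ge> x\<close> so that integrals for
  different upper limits \<open>x\<close> are taken over the same interval.
\<close>

definition rl_kernel :: "real \<Rightarrow> real \<Rightarrow> real \<Rightarrow> real" where
  "rl_kernel \<beta> x t = (if t < x then (x - t) powr (\<beta> - 1) else 0)"

lemma rl_kernel_nonneg [simp]: "0 \<le> rl_kernel \<beta> x t"
  by (simp add: rl_kernel_def)

lemma borel_measurable_Leb_ident [measurable]: "(\<lambda>x. x) \<in> borel_measurable (Leb l)"
  by (intro continuous_imp_measurable_on_sets_lebesgue) auto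

lemma rl_kernel_measurable [measurable]:
  assumes [measurable]: "f \<in> borel_measurable M" "g \<in> borel_measurable M"
  shows "(\<lambda>w. rl_kernel \<beta> (f w) (g w)) \<in> borel_measurable M"
  unfolding rl_kernel_def by measurable

lemma frac_integral_eq_kernel:
  assumes "x \<le> l"
  shows "frac_integral \<beta> \<phi> x = 1 / Gamma \<beta> * (LINT t|Leb l. \<phi> t * rl_kernel \<beta> x t)"
proof -
  have "(LINT t|Leb x. \<phi> t / (x - t) powr (1 - \<beta>)) = (LINT t|Leb l. \<phi> t * rl_kernel \<beta> x t)"
    unfolding integral_Leb_restrict[OF assms]
  proof (intro Bochner_Integration.integral_cong refl)
    fix t
    show "(if t < x then \<phi> t / (x - t) powr (1 - \<beta>) else 0) = \<phi> t * rl_kernel \<beta> x t"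
      using powr_minus_divide[of "x - t" "1 - \<beta>"] by (simp add: rl_kernel_def)
  qed
  then show ?thesis
    by (simp add: frac_integral_def)
qed

lemma rl_kernel_square: "t < x \<Longrightarrow> (rl_kernel \<beta> x t)\<^sup>2 = (x - t) powr (2 * \<beta> - 2)"
  by (simp add: rl_kernel_def power2_eq_square powr_add[symmetric])

lemma frac_integral_scale: "frac_integral \<beta> (\<lambda>t. c * \<phi> t) x = c * frac_integral \<beta> \<phi> x"
  by (simp add: frac_integral_eq_kernel[of x x] mult.assoc)

lemma sigma_finite_Leb: "sigma_finite_measure (Leb l)"
  using finite_measure_Leb finite_measure.axioms(1) by blast

context
  fixes \<beta> :: real
  assumes beta: "1 / 2 < \<beta>" "\<beta> < 1"
begin

text \<open>
  Here \<open>\<beta> > 1 / 2\<close> enters: the kernel is square integrable, so that point values of a fractional integral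
  are bounded linear functionals on \<open>L\<^sub>2\<close>.
\<close>

lemma kernel_square_integral:
  assumes "0 \<le> x" "x \<le> l"
  shows "has_bochner_integral (Leb l) (\<lambda>t. (rl_kernel \<beta> x t)\<^sup>2) (x powr (2 * \<beta> - 1) / (2 * \<beta> - 1))"
proof -
  have "has_bochner_integral (Leb l) (\<lambda>t. if 0 < t \<and> t < x then (x - t) powr (2 * \<beta> - 2) else 0)
      (x powr (2 * \<beta> - 1) / (2 * \<beta> - 1))"
    using has_integral_powr_right_end[of "2 * \<beta> - 2" 0 x] beta assms
    by (intro has_bochner_integral_Leb_restrict) auto
  then show ?thesis
    by (rule has_bochner_integral_cong[THEN iffD1, rotated -1])
       (auto simp: rl_kernel_def power2_eq_square powr_add[symmetric])
qed

lemma kernel_L2: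
  assumes "0 \<le> x" "x \<le> l"
  shows "rl_kernel \<beta> x \<in> L2_space (Leb l)"
  using kernel_square_integral[OF assms] by (auto simp: L2_space_def has_bochner_integral_iff)

lemma kernel_square_integral':
  assumes "0 \<le> t" "t \<le> l"
  shows "has_bochner_integral (Leb l) (\<lambda>x. (rl_kernel \<beta> x t)\<^sup>2) ((l - t) powr (2 * \<beta> - 1) / (2 * \<beta> - 1))"
proof -
  have "has_bochner_integral (Leb l) (\<lambda>x. if t < x \<and> x < l then (x - t) powr (2 * \<beta> - 2) else 0)
      ((l - t) powr (2 * \<beta> - 1) / (2 * \<beta> - 1))"
    using has_integral_powr_left_end[of "2 * \<beta> - 2" t l] beta assms
    by (intro has_bochner_integral_Leb_restrict) auto
  then show ?thesis
    by (rule has_bochner_integral_cong[THEN iffD1, rotated -1])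
       (auto simp: rl_kernel_def power2_eq_square powr_add[symmetric])
qed

lemma kernel_L2':
  assumes "0 \<le> t" "t \<le> l"
  shows "(\<lambda>x. rl_kernel \<beta> x t) \<in> L2_space (Leb l)"
  using kernel_square_integral'[OF assms] by (auto simp: L2_space_def has_bochner_integral_iff)

text \<open>
  Below \<open>y\<close> use \<open>(A - B)\<^sup>2 \<le> A\<^sup>2 - B\<^sup>2\<close> for \<open>0 \<le> B \<le> A\<close>. All squares then have explicit integrals, and those
  that involve \<open>x\<close> and \<open>y\<close> separately add up to something nonpositive.
\<close>

lemma kernel_increment:
  assumes "0 \<le> y" "y \<le> x" "x \<le> l"
  shows "(LINT t|Leb l. (rl_kernel \<beta> x t - rl_kernel \<beta> y t)\<^sup>2) \<le> 2 * (x - y) powr (2 * \<beta> - 1) / (2 * \<beta> - 1)"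
proof -
  define g where "g t = (rl_kernel \<beta> y t)\<^sup>2 - (rl_kernel \<beta> x t)\<^sup>2
      + 2 * (if y < t \<and> t < x then (x - t) powr (2 * \<beta> - 2) else 0)" for t
  have third: "has_bochner_integral (Leb l) (\<lambda>t. if y < t \<and> t < x then (x - t) powr (2 * \<beta> - 2) else 0)
      ((x - y) powr (2 * \<beta> - 1) / (2 * \<beta> - 1))"
    using has_integral_powr_right_end[of "2 * \<beta> - 2" y x] beta assms
    by (intro has_bochner_integral_Leb_restrict) auto
  have g: "has_bochner_integral (Leb l) g (y powr (2 * \<beta> - 1) / (2 * \<beta> - 1) - x powr (2 * \<beta> - 1) / (2 * \<beta> - 1)
      + 2 * ((x - y) powr (2 * \<beta> - 1) / (2 * \<beta> - 1)))"
    unfolding g_def using assms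
    by (intro has_bochner_integral_add has_bochner_integral_diff has_bochner_integral_mult_right
        kernel_square_integral third) auto
  have "(LINT t|Leb l. (rl_kernel \<beta> x t - rl_kernel \<beta> y t)\<^sup>2) \<le> (LINT t|Leb l. g t)"
  proof (rule integral_mono_AE)
    show "integrable (Leb l) (\<lambda>t. (rl_kernel \<beta> x t - rl_kernel \<beta> y t)\<^sup>2)"
      using assms by (intro L2_square_integrable L2_diff kernel_L2) auto
    show "integrable (Leb l) g"
      using g by (simp add: has_bochner_integral_iff)
    have "AE t in lebesgue. t \<noteq> y"
      by (intro AE_completion AE_lborel_singleton)
    then have "AE t in Leb l. t \<noteq> y"
      by (subst AE_restrict_space_iff) (auto elim: eventually_mono)
    then show "AE t in Leb l. (rl_kernel \<beta> x t - rl_kernel \<beta> y t)\<^sup>2 \<le> g t"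
    proof eventually_elim
      case (elim t)
      consider "t < y" | "y < t" "t < x" | "x \<le> t"
        using elim by linarith
      then show ?case
      proof cases
        case 1
        define A where "A = rl_kernel \<beta> y t"
        define B where "B = rl_kernel \<beta> x t"
        have "0 \<le> B"
          by (simp add: B_def)
        moreover have "B \<le> A"
          using 1 assms beta by (auto simp: A_def B_def rl_kernel_def intro!: powr_mono2')
        ultimately have "B * B \<le> A * B"
          by (simp add: mult_right_mono)
        then have "(B - A)\<^sup>2 \<le> A\<^sup>2 - B\<^sup>2"
          by (simp add: power2_eq_square algebra_simps)
        then show ?thesis
          using 1 by (simp add: g_def A_def B_def)
      next
        case 2
        then show ?thesis
          using rl_kernel_square[of t x] by (simp add: g_def) (simp add: rl_kernel_def)
      next
        case 3
        then show ?thesis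
          using assms by (simp add: g_def rl_kernel_def)
      qed
    qed
  qed
  also have "\<dots> \<le> 2 * (x - y) powr (2 * \<beta> - 1) / (2 * \<beta> - 1)"
  proof -
    have "y powr (2 * \<beta> - 1) / (2 * \<beta> - 1) \<le> x powr (2 * \<beta> - 1) / (2 * \<beta> - 1)"
      using beta assms by (intro divide_right_mono powr_mono2) auto
    then show ?thesis
      using g by (simp add: has_bochner_integral_iff)
  qed
  finally show ?thesis .
qed

lemma Gamma_beta_pos: "Gamma \<beta> > 0" "Gamma (1 - \<beta>) > 0"
  using beta by (auto intro: Gamma_real_pos)

text \<open>
  Cauchy--Schwarz against the kernel. Together with the Hoelder estimate below, this makes bounded
  subsets of \<open>L\<^sub>2\<close> have uniformly bounded and equicontinuous fractional integrals.
\<close>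

lemma frac_integral_bound:
  assumes "\<phi> \<in> L2_space (Leb l)" "0 \<le> x" "x \<le> l"
  shows "(frac_integral \<beta> \<phi> x)\<^sup>2 \<le> x powr (2 * \<beta> - 1) / (2 * \<beta> - 1) / (Gamma \<beta>)\<^sup>2 * (LINT t|Leb l. (\<phi> t)\<^sup>2)"
proof -
  have "(LINT t|Leb l. \<phi> t * rl_kernel \<beta> x t)\<^sup>2 \<le> (LINT t|Leb l. (\<phi> t)\<^sup>2) * (x powr (2 * \<beta> - 1) / (2 * \<beta> - 1))"
    using L2_Cauchy_Schwarz[OF assms(1) kernel_L2[OF assms(2,3)]] kernel_square_integral[OF assms(2,3)]
    by (simp add: has_bochner_integral_iff)
  then have "(LINT t|Leb l. \<phi> t * rl_kernel \<beta> x t)\<^sup>2 / (Gamma \<beta>)\<^sup>2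
      \<le> (LINT t|Leb l. (\<phi> t)\<^sup>2) * (x powr (2 * \<beta> - 1) / (2 * \<beta> - 1)) / (Gamma \<beta>)\<^sup>2"
    by (rule divide_right_mono) simp
  then show ?thesis
    by (simp add: frac_integral_eq_kernel[OF assms(3)] power_divide mult_ac)
qed

lemma frac_integral_Hoelder:
  assumes "\<phi> \<in> L2_space (Leb l)" "0 \<le> y" "y \<le> l" "0 \<le> x" "x \<le> l"
  shows "(frac_integral \<beta> \<phi> x - frac_integral \<beta> \<phi> y)\<^sup>2
    \<le> 2 * \<bar>x - y\<bar> powr (2 * \<beta> - 1) / (2 * \<beta> - 1) / (Gamma \<beta>)\<^sup>2 * (LINT t|Leb l. (\<phi> t)\<^sup>2)"
proof -
  have *: "(frac_integral \<beta> \<phi> x - frac_integral \<beta> \<phi> y)\<^sup>2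
      \<le> 2 * \<bar>x - y\<bar> powr (2 * \<beta> - 1) / (2 * \<beta> - 1) / (Gamma \<beta>)\<^sup>2 * (LINT t|Leb l. (\<phi> t)\<^sup>2)"
    if "0 \<le> y" "y \<le> x" "x \<le> l" for x y
  proof -
    have K: "rl_kernel \<beta> x \<in> L2_space (Leb l)" "rl_kernel \<beta> y \<in> L2_space (Leb l)"
      using that by (auto intro!: kernel_L2)
    have eq: "frac_integral \<beta> \<phi> x - frac_integral \<beta> \<phi> y
        = 1 / Gamma \<beta> * (LINT t|Leb l. \<phi> t * (rl_kernel \<beta> x t - rl_kernel \<beta> y t))"
      using that L2_mult_integrable[OF assms(1) K(1)] L2_mult_integrable[OF assms(1) K(2)]
      by (simp add: frac_integral_eq_kernel[of _ l] right_diff_distrib diff_divide_distrib)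
    have "(LINT t|Leb l. \<phi> t * (rl_kernel \<beta> x t - rl_kernel \<beta> y t))\<^sup>2
        \<le> (LINT t|Leb l. (\<phi> t)\<^sup>2) * (2 * (x - y) powr (2 * \<beta> - 1) / (2 * \<beta> - 1))"
      using L2_Cauchy_Schwarz[OF assms(1) L2_diff[OF K]] kernel_increment[OF that]
      by (rule order.trans[OF _ mult_left_mono]) simp
    then have "(LINT t|Leb l. \<phi> t * (rl_kernel \<beta> x t - rl_kernel \<beta> y t))\<^sup>2 / (Gamma \<beta>)\<^sup>2
        \<le> (LINT t|Leb l. (\<phi> t)\<^sup>2) * (2 * (x - y) powr (2 * \<beta> - 1) / (2 * \<beta> - 1)) / (Gamma \<beta>)\<^sup>2"
      by (rule divide_right_mono) simp
    then show ?thesis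
      unfolding eq using that by (simp add: power_divide mult_ac)
  qed
  show ?thesis
    using *[of x y] *[of y x] assms by (cases "y \<le> x") (auto simp: power2_commute abs_minus_commute)
qed

lemma frac_integral_measurable:
  assumes "\<phi> \<in> L2_space (Leb l)"
  shows "frac_integral \<beta> \<phi> \<in> borel_measurable (Leb l)"
proof -
  interpret sigma_finite_measure "Leb l"
    by (rule sigma_finite_Leb)
  have [measurable]: "\<phi> \<in> borel_measurable (Leb l)"
    using assms by (rule L2_measurable)
  have "(\<lambda>x. 1 / Gamma \<beta> * (LINT t|Leb l. \<phi> t * rl_kernel \<beta> x t)) \<in> borel_measurable (Leb l)"
    by measurable
  then show ?thesis
    by (rule measurable_cong[THEN iffD1, rotated]) (simp add: frac_integral_eq_kernel[where l = l])
qed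

lemma frac_integral_add:
  assumes "\<phi> \<in> L2_space (Leb l)" "\<psi> \<in> L2_space (Leb l)" "0 \<le> x" "x \<le> l"
  shows "frac_integral \<beta> (\<lambda>t. \<phi> t + \<psi> t) x = frac_integral \<beta> \<phi> x + frac_integral \<beta> \<psi> x"
  using L2_mult_integrable[OF assms(1) kernel_L2[OF assms(3,4)]] L2_mult_integrable[OF assms(2) kernel_L2[OF assms(3,4)]]
  by (simp add: frac_integral_eq_kernel[OF assms(4)] distrib_right add_divide_distrib)

lemma Beta_beta: "Beta \<beta> (1 - \<beta>) = Gamma \<beta> * Gamma (1 - \<beta>)"
  by (simp add: Beta_def)

text \<open>
  Both are the integral \<open>Beta \<beta> (1 - \<beta>)\<close>, which does not depend on the interval since the exponents add
  up to \<open>-1\<close>. This is what inverts Abel's integral equation.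
\<close>

lemma Abel_kernel_integral:
  assumes "0 \<le> c" "c < d" "d \<le> l"
  shows "has_bochner_integral (Leb l) (\<lambda>t. if c < t \<and> t < d then (t - c) powr (\<beta> - 1) * (d - t) powr (- \<beta>) else 0)
    (Gamma \<beta> * Gamma (1 - \<beta>))"
    "has_bochner_integral (Leb l) (\<lambda>t. if c < t \<and> t < d then (d - t) powr (\<beta> - 1) * (t - c) powr (- \<beta>) else 0)
    (Gamma \<beta> * Gamma (1 - \<beta>))"
  using has_integral_Beta_interval[of \<beta> "1 - \<beta>" c d] has_integral_Beta_interval[of "1 - \<beta>" \<beta> c d]
    beta assms Beta_beta Beta_commute[of \<beta> "1 - \<beta>"]
  by (auto intro!: has_bochner_integral_Leb_restrict simp: mult.commute)

text \<open>
  The semigroup law \<open>I\<^bsup>1-\<beta>\<^esup> I\<^bsup>\<beta>\<^esup> \<phi> = I\<^bsup>1\<^esup> \<phi>\<close>, up to the factor \<open>Gamma (1 - \<beta>)\<close> and together with the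
  integrability that the default value of the Bochner integral hides.
\<close>

lemma frac_integral_frac_integral:
  assumes phi: "\<phi> \<in> L2_space (Leb l)" and x: "0 < x" "x \<le> l"
  shows "has_bochner_integral (Leb x) (\<lambda>\<xi>. frac_integral \<beta> \<phi> \<xi> / (x - \<xi>) powr \<beta>)
    (Gamma (1 - \<beta>) * (LINT t|Leb x. \<phi> t))"
proof -
  have int: "integrable (Leb x) \<phi>"
    using integrable_Leb_restrict[OF L2_integrable[OF finite_measure_Leb phi] x(2)] .
  define H where "H t \<xi> = rl_kernel \<beta> \<xi> t * (x - \<xi>) powr (- \<beta>)" for t \<xi>
  have H: "has_bochner_integral (Leb x) (H t) (Gamma \<beta> * Gamma (1 - \<beta>))" if "t \<in> space (Leb x)" for t
    by (rule has_bochner_integral_congI[OF Abel_kernel_integral(1)[of t x x]])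
      (use that in \<open>auto simp: H_def rl_kernel_def\<close>)
  have abs: "(LINT \<xi>|Leb x. \<bar>H t \<xi>\<bar>) = (LINT \<xi>|Leb x. H t \<xi>)" for t
    by (simp add: H_def)
  have H_meas: "(\<lambda>(t, \<xi>). H t \<xi>) \<in> borel_measurable (Leb x \<Otimes>\<^sub>M Leb x)"
    unfolding H_def by measurable
  have Fub: "integrable (Leb x) (\<lambda>\<xi>. LINT t|Leb x. \<phi> t * H t \<xi>)"
    "(LINT \<xi>|Leb x. LINT t|Leb x. \<phi> t * H t \<xi>) = (LINT t|Leb x. \<phi> t * (LINT \<xi>|Leb x. H t \<xi>))"
    using H abs
    by (auto intro!: kernel_Fubini[OF sigma_finite_Leb int H_meas, of "Gamma \<beta> * Gamma (1 - \<beta>)"]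
        simp: has_bochner_integral_iff)
  have inner: "(LINT t|Leb x. \<phi> t * H t \<xi>) = Gamma \<beta> * (frac_integral \<beta> \<phi> \<xi> / (x - \<xi>) powr \<beta>)" if "\<xi> \<in> space (Leb x)" for \<xi>
    using that Gamma_beta_pos
    by (simp add: frac_integral_eq_kernel[of \<xi> x] H_def powr_minus_divide mult.assoc[symmetric])
  have "integrable (Leb x) (\<lambda>\<xi>. Gamma \<beta> * (frac_integral \<beta> \<phi> \<xi> / (x - \<xi>) powr \<beta>))"
    using Fub(1) by (rule Bochner_Integration.integrable_cong[THEN iffD1, rotated -1]) (auto simp: inner)
  then have "integrable (Leb x) (\<lambda>\<xi>. 1 / Gamma \<beta> * (Gamma \<beta> * (frac_integral \<beta> \<phi> \<xi> / (x - \<xi>) powr \<beta>)))"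
    by (rule Bochner_Integration.integrable_mult_right)
  then have "integrable (Leb x) (\<lambda>\<xi>. frac_integral \<beta> \<phi> \<xi> / (x - \<xi>) powr \<beta>)"
    using Gamma_beta_pos by simp
  moreover have "Gamma \<beta> * (LINT \<xi>|Leb x. frac_integral \<beta> \<phi> \<xi> / (x - \<xi>) powr \<beta>)
      = (LINT \<xi>|Leb x. LINT t|Leb x. \<phi> t * H t \<xi>)"
    unfolding Bochner_Integration.integral_mult_right_zero[symmetric]
    by (intro Bochner_Integration.integral_cong refl inner[symmetric])
  moreover have "\<dots> = (LINT t|Leb x. \<phi> t * (Gamma \<beta> * Gamma (1 - \<beta>)))"
    unfolding Fub(2) using H by (intro Bochner_Integration.integral_cong refl) (simp add: has_bochner_integral_iff)
  ultimately show ?thesis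
    using Gamma_beta_pos by (simp add: has_bochner_integral_iff field_simps)
qed

text \<open>
  The fractional integral of order \<open>1 - \<beta>\<close> recovers the data \<open>c\<close> and \<open>\<phi>\<close> of an element of
  \<^const>\<open>AC_space\<close>: the singular term contributes \<open>c\<close> by the Beta integral, the other one \<open>\<integral>\<phi>\<close> by the
  semigroup law. The identity holds at every \<open>x\<close>, although \<open>f\<close> is given almost
  everywhere only; that is needed to differentiate it and to speak of its values at the vertices.
\<close>

theorem frac_integral_of_representation:
  assumes phi: "\<phi> \<in> L2_space (Leb l)"
    and f: "AE \<xi> in Leb l. f \<xi> = c / Gamma \<beta> * \<xi> powr (\<beta> - 1) + frac_integral \<beta> \<phi> \<xi>"
    and meas: "f \<in> borel_measurable (Leb l)" and x: "0 < x" "x \<le> l"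
  shows "frac_integral (1 - \<beta>) f x = c + (LINT t|Leb x. \<phi> t)"
proof -
  have first: "has_bochner_integral (Leb x) (\<lambda>\<xi>. c / Gamma \<beta> * (\<xi> powr (\<beta> - 1) / (x - \<xi>) powr \<beta>)) (c / Gamma \<beta> * (Gamma \<beta> * Gamma (1 - \<beta>)))"
    by (intro has_bochner_integral_mult_right has_bochner_integral_congI[OF Abel_kernel_integral(1)[of 0 x x]])
      (use x in \<open>auto simp: powr_minus_divide\<close>)
  have sum: "has_bochner_integral (Leb x) (\<lambda>\<xi>. c / Gamma \<beta> * (\<xi> powr (\<beta> - 1) / (x - \<xi>) powr \<beta>) + frac_integral \<beta> \<phi> \<xi> / (x - \<xi>) powr \<beta>)
      (c / Gamma \<beta> * (Gamma \<beta> * Gamma (1 - \<beta>)) + Gamma (1 - \<beta>) * (LINT t|Leb x. \<phi> t))"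
    by (intro has_bochner_integral_add first frac_integral_frac_integral[OF phi x])
  have [measurable]: "f \<in> borel_measurable (Leb x)"
    using meas by (rule measurable_restrict_mono) (use x in auto)
  have [measurable]: "frac_integral \<beta> \<phi> \<in> borel_measurable (Leb x)"
    using frac_integral_measurable[OF phi] by (rule measurable_restrict_mono) (use x in auto)
  have "AE \<xi> in Leb x. f \<xi> = c / Gamma \<beta> * \<xi> powr (\<beta> - 1) + frac_integral \<beta> \<phi> \<xi>"
    using f x(2) by (rule AE_Leb_mono)
  then have "(LINT \<xi>|Leb x. f \<xi> / (x - \<xi>) powr \<beta>)
      = (LINT \<xi>|Leb x. c / Gamma \<beta> * (\<xi> powr (\<beta> - 1) / (x - \<xi>) powr \<beta>) + frac_integral \<beta> \<phi> \<xi> / (x - \<xi>) powr \<beta>)"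
    by (intro integral_cong_AE) (measurable, auto elim!: eventually_mono simp: add_divide_distrib)
  also have "\<dots> = c * Gamma (1 - \<beta>) + Gamma (1 - \<beta>) * (LINT t|Leb x. \<phi> t)"
    using sum Gamma_beta_pos by (simp add: has_bochner_integral_iff)
  finally show ?thesis
    using Gamma_beta_pos unfolding frac_integral_def by (simp add: field_simps)
qed

text \<open>
  The inner integral on the right is, up to the constant, the right-sided fractional integral of \<open>z\<close>.
\<close>

lemma frac_integral_adjoint:
  assumes z: "z \<in> L2_space (Leb l)" and phi: "\<phi> \<in> L2_space (Leb l)"
  shows "(LINT x|Leb l. z x * frac_integral \<beta> \<phi> x)
    = 1 / Gamma \<beta> * (LINT t|Leb l. \<phi> t * (LINT x|Leb l. z x * rl_kernel \<beta> x t))"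
proof -
  have int: "integrable (Leb l) \<phi>"
    by (rule L2_integrable[OF finite_measure_Leb phi])
  have [measurable]: "z \<in> borel_measurable (Leb l)"
    using z by (rule L2_measurable)
  define H where "H t x = z x * rl_kernel \<beta> x t" for t x
  have H_meas: "(\<lambda>(t, \<xi>). H t \<xi>) \<in> borel_measurable (Leb l \<Otimes>\<^sub>M Leb l)"
    unfolding H_def by measurable
  define B where "B = sqrt ((LINT x|Leb l. (z x)\<^sup>2) * (l powr (2 * \<beta> - 1) / (2 * \<beta> - 1)))"
  have abs_z: "(\<lambda>x. \<bar>z x\<bar>) \<in> L2_space (Leb l)"
    using z by (auto simp: L2_space_def)
  have "(LINT x|Leb l. \<bar>H t x\<bar>) \<le> B" if "t \<in> space (Leb l)" for t
  proof -
    have t: "0 \<le> t" "t \<le> l"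
      using that by auto
    have "(LINT x|Leb l. \<bar>H t x\<bar>)\<^sup>2 \<le> (LINT x|Leb l. (z x)\<^sup>2) * ((l - t) powr (2 * \<beta> - 1) / (2 * \<beta> - 1))"
      using L2_Cauchy_Schwarz[OF abs_z kernel_L2'[OF t]] kernel_square_integral'[OF t]
      by (simp add: H_def abs_mult has_bochner_integral_iff)
    also have "\<dots> \<le> (LINT x|Leb l. (z x)\<^sup>2) * (l powr (2 * \<beta> - 1) / (2 * \<beta> - 1))"
      using beta t by (intro mult_left_mono divide_right_mono powr_mono2) auto
    finally show ?thesis
      unfolding B_def by (rule real_le_rsqrt)
  qed
  moreover have "integrable (Leb l) (H t)" if "t \<in> space (Leb l)" for t
    using that unfolding H_def by (intro L2_mult_integrable z kernel_L2') auto
  ultimately have "(LINT x|Leb l. LINT t|Leb l. \<phi> t * H t x) = (LINT t|Leb l. \<phi> t * (LINT x|Leb l. H t x))"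
    by (intro kernel_Fubini(2)[OF sigma_finite_Leb int H_meas])
  moreover have "(LINT x|Leb l. z x * frac_integral \<beta> \<phi> x) = (LINT x|Leb l. 1 / Gamma \<beta> * (LINT t|Leb l. \<phi> t * H t x))"
  proof (intro Bochner_Integration.integral_cong refl)
    fix x assume "x \<in> space (Leb l)"
    have "(LINT t|Leb l. \<phi> t * H t x) = (LINT t|Leb l. z x * (\<phi> t * rl_kernel \<beta> x t))"
      by (simp add: H_def mult_ac)
    then show "z x * frac_integral \<beta> \<phi> x = 1 / Gamma \<beta> * (LINT t|Leb l. \<phi> t * H t x)"
      using \<open>x \<in> space (Leb l)\<close> by (simp add: frac_integral_eq_kernel[of x l])
  qed
  ultimately show ?thesis
    by (simp add: H_def)
qed

lemma adjoint_bound: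
  assumes "z \<in> L2_space (Leb l)" "0 \<le> t" "t \<le> l"
  shows "(LINT x|Leb l. z x * rl_kernel \<beta> x t)\<^sup>2 \<le> (LINT x|Leb l. (z x)\<^sup>2) * ((l - t) powr (2 * \<beta> - 1) / (2 * \<beta> - 1))"
  using L2_Cauchy_Schwarz[OF assms(1) kernel_L2'[OF assms(2,3)]] kernel_square_integral'[OF assms(2,3)]
  by (simp add: has_bochner_integral_iff)

text \<open>
  Abel's inversion for the right-sided integral: applying the integral of order \<open>1 - \<beta>\<close> from the point
  \<open>a\<close> gives a multiple of \<open>\<integral>\<close> of \<open>z\<close> over \<open>(a, l)\<close>. If all these vanish, the indefinite integral of \<open>z\<close> is
  constant and \<open>z\<close> is its derivative.
\<close>

lemma adjoint_injective:
  assumes z: "z \<in> L2_space (Leb l)"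
    and zero: "AE t in Leb l. (LINT x|Leb l. z x * rl_kernel \<beta> x t) = 0"
  shows "AE x in Leb l. z x = 0"
proof -
  have int: "integrable (Leb l) z"
    by (rule L2_integrable[OF finite_measure_Leb z])
  then have [measurable]: "z \<in> borel_measurable (Leb l)"
    by simp
  have tail: "(LINT x|Leb l. (if x < a then z x else 0)) = (LINT x|Leb l. z x)" if a: "a \<in> {0<..<l}" for a
  proof -
    define H where "H x t = (if a < t then (t - a) powr (- \<beta>) else 0) * rl_kernel \<beta> x t" for x t
    have H: "has_bochner_integral (Leb l) (H x) (if a < x then Gamma \<beta> * Gamma (1 - \<beta>) else 0)" if "x \<in> space (Leb l)" for x
    proof (cases "a < x")
      case True
      then show ?thesis
        using that a by (simp, intro has_bochner_integral_congI[OF Abel_kernel_integral(2)[of a x l]])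
          (auto simp: H_def rl_kernel_def)
    next
      case False
      then have "H x = (\<lambda>_. 0)"
        by (auto simp: H_def rl_kernel_def fun_eq_iff)
      then show ?thesis
        using False by (simp add: has_bochner_integral_zero)
    qed
    have H_meas: "(\<lambda>(x, t). H x t) \<in> borel_measurable (Leb l \<Otimes>\<^sub>M Leb l)"
      unfolding H_def by measurable
    have "(LINT x|Leb l. z x * (LINT t|Leb l. H x t)) = (LINT t|Leb l. LINT x|Leb l. z x * H x t)"
    proof (rule kernel_Fubini(2)[OF sigma_finite_Leb int H_meas, of "Gamma \<beta> * Gamma (1 - \<beta>)", symmetric])
      show "(LINT t|Leb l. \<bar>H x t\<bar>) \<le> Gamma \<beta> * Gamma (1 - \<beta>)" if "x \<in> space (Leb l)" for x
      proof -
        have "\<bar>H x t\<bar> = H x t" for t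
          by (simp add: H_def)
        then show ?thesis
          using H[OF that] Gamma_beta_pos by (simp add: has_bochner_integral_iff)
      qed
    qed (use H in \<open>auto simp: has_bochner_integral_iff\<close>)
    also have "\<dots> = (LINT t|Leb l. 0)"
    proof (rule integral_cong_AE)
      show "AE t in Leb l. (LINT x|Leb l. z x * H x t) = 0"
        using zero
      proof eventually_elim
        case (elim t)
        have "(LINT x|Leb l. z x * H x t) = (LINT x|Leb l. (if a < t then (t - a) powr (- \<beta>) else 0) * (z x * rl_kernel \<beta> x t))"
          by (simp add: H_def mult_ac)
        then show ?case
          using elim by simp
      qed
      interpret sigma_finite_measure "Leb l"
        by (rule sigma_finite_Leb)
      show "(\<lambda>t. LINT x|Leb l. z x * H x t) \<in> borel_measurable (Leb l)"
        using H_meas by measurable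
    qed simp
    finally have "(LINT x|Leb l. z x * (LINT t|Leb l. H x t)) = 0"
      by simp
    moreover have "(LINT x|Leb l. z x * (LINT t|Leb l. H x t))
        = (LINT x|Leb l. (Gamma \<beta> * Gamma (1 - \<beta>)) * (if a < x then z x else 0))"
      using H by (intro Bochner_Integration.integral_cong refl) (auto simp: has_bochner_integral_iff)
    ultimately have after: "(LINT x|Leb l. (if a < x then z x else 0)) = 0"
      using Gamma_beta_pos by simp
    have "(LINT x|Leb l. z x) = (LINT x|Leb l. (if x < a then z x else 0) + (if a < x then z x else 0))"
    proof (rule integral_cong_AE)
      have "AE t in lebesgue. t \<noteq> a"
        by (intro AE_completion AE_lborel_singleton)
      then have "AE t in Leb l. t \<noteq> a"
        by (subst AE_restrict_space_iff) (auto elim: eventually_mono)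
      then show "AE x in Leb l. z x = (if x < a then z x else 0) + (if a < x then z x else 0)"
        by eventually_elim auto
    qed measurable
    also have "\<dots> = (LINT x|Leb l. (if x < a then z x else 0)) + (LINT x|Leb l. (if a < x then z x else 0))"
      by (intro Bochner_Integration.integral_add; rule Bochner_Integration.integrable_bound[OF int]) auto
    finally show ?thesis
      using after by simp
  qed
  have "AE x in Leb l. ((\<lambda>y. LINT t|Leb y. z t) has_real_derivative z x) (at x)"
    by (rule indefinite_integral_has_derivative_AE[OF int])
  moreover have "AE x in Leb l. x \<in> {0<..<l}"
    by (rule AE_I2) simp
  ultimately show ?thesis
  proof eventually_elim
    case (elim x)
    have "((\<lambda>y. LINT t|Leb l. z t) has_real_derivative z x) (at x)"
    proof (rule has_field_derivative_transform_within_open[OF elim(1)])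
      show "(LINT t|Leb y. z t) = (LINT t|Leb l. z t)" if "y \<in> {0<..<l}" for y
        using tail[OF that] that by (simp add: integral_Leb_restrict[of y l])
    qed (use elim in auto)
    then show "z x = 0"
      using DERIV_unique DERIV_const by blast
  qed
qed

text \<open>
  The fractional integrals of functions with mean value zero are total in \<open>L\<^sub>2\<close>. If \<open>z\<close> is orthogonal to
  all of them, its right-sided fractional integral \<open>K\<close> is orthogonal to all functions of mean zero,
  so it is a constant \<open>m\<close>; but \<open>K\<close> tends to zero at the right end, since \<open>\<beta> > 1 / 2\<close>. Hence \<open>K = 0\<close>.
\<close>

theorem frac_integral_mean_zero_total:
  assumes l: "0 < l" and z: "z \<in> L2_space (Leb l)"
    and perp: "\<And>\<phi>. \<phi> \<in> L2_space (Leb l) \<Longrightarrow> (LINT t|Leb l. \<phi> t) = 0 \<Longrightarrow> (LINT x|Leb l. z x * frac_integral \<beta> \<phi> x) = 0"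
  shows "AE x in Leb l. z x = 0"
proof -
  interpret finite_measure "Leb l"
    by (rule finite_measure_Leb)
  define K where "K t = (LINT x|Leb l. z x * rl_kernel \<beta> x t)" for t
  have [measurable]: "z \<in> borel_measurable (Leb l)"
    using z by (rule L2_measurable)
  have [measurable]: "K \<in> borel_measurable (Leb l)"
    unfolding K_def by measurable
  define B where "B = (LINT x|Leb l. (z x)\<^sup>2) / (2 * \<beta> - 1)"
  have B: "B \<ge> 0"
    using beta by (simp add: B_def)
  have K_bound: "(K t)\<^sup>2 \<le> B * (l - t) powr (2 * \<beta> - 1)" if "t \<in> {0<..<l}" for t
    using adjoint_bound[OF z, of t] that by (simp add: K_def B_def)
  have K: "K \<in> L2_space (Leb l)"
  proof (rule L2_bounded[OF finite_measure_Leb])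
    show "\<bar>K t\<bar> \<le> sqrt (B * l powr (2 * \<beta> - 1))" if "t \<in> space (Leb l)" for t
    proof -
      have "B * (l - t) powr (2 * \<beta> - 1) \<le> B * l powr (2 * \<beta> - 1)"
        using beta that B by (intro mult_left_mono powr_mono2) auto
      then have "(K t)\<^sup>2 \<le> B * l powr (2 * \<beta> - 1)"
        using K_bound[of t] that by simp
      then show ?thesis
        using real_sqrt_le_mono by fastforce
    qed
  qed measurable
  \<comment> \<open>The mean value of \<open>K\<close>; then \<open>\<phi> = K - m\<close> is itself an admissible test function.\<close>
  define m where "m = (LINT t|Leb l. K t) / l"
  define \<phi> where "\<phi> t = K t - m" for t
  have phi: "\<phi> \<in> L2_space (Leb l)"
    unfolding \<phi>_def by (intro L2_diff K L2_bounded[OF finite_measure_Leb, of _ _ "\<bar>m\<bar>"]) auto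
  have K_int: "integrable (Leb l) K"
    by (rule L2_integrable[OF finite_measure_Leb K])
  have "measure (Leb l) {0<..<l} = l"
    using l by (simp add: measure_restrict_space)
  then have mean: "(LINT t|Leb l. \<phi> t) = 0"
    using K_int l by (simp add: \<phi>_def m_def)
  have "(LINT t|Leb l. \<phi> t * K t) = 0"
    using perp[OF phi mean] frac_integral_adjoint[OF z phi] Gamma_beta_pos by (simp add: K_def)
  moreover have "(LINT t|Leb l. \<phi> t * m) = 0"
    using mean by simp
  moreover have "(LINT t|Leb l. (\<phi> t)\<^sup>2) = (LINT t|Leb l. \<phi> t * K t) - (LINT t|Leb l. \<phi> t * m)"
  proof -
    have "(\<phi> t)\<^sup>2 = \<phi> t * K t - \<phi> t * m" for t
      by (simp add: power2_eq_square \<phi>_def algebra_simps)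
    then show ?thesis
      using L2_mult_integrable[OF phi K] L2_integrable[OF finite_measure_Leb phi] by simp
  qed
  ultimately have "AE t in Leb l. \<phi> t = 0"
    using L2_norm_zero_iff[OF phi] by simp
  then have K_const: "AE t in Leb l. K t = m"
    by (simp add: \<phi>_def)
  have "m = 0"
  proof (rule ccontr)
    assume m: "m \<noteq> 0"
    have "((\<lambda>t. B * (l - t) powr (2 * \<beta> - 1)) \<longlongrightarrow> B * (l - l) powr (2 * \<beta> - 1)) (at_left l)"
      using beta by (intro tendsto_intros) (auto simp: eventually_at_filter)
    then have "\<forall>\<^sub>F t in at_left l. B * (l - t) powr (2 * \<beta> - 1) < m\<^sup>2"
      using m by (intro order_tendstoD) auto
    then obtain b where b: "b < l" "\<And>t. b < t \<Longrightarrow> t < l \<Longrightarrow> B * (l - t) powr (2 * \<beta> - 1) < m\<^sup>2"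
      by (auto simp: eventually_at_left_field)
    define c where "c = max 0 b"
    have c: "0 \<le> c" "c < l" "b \<le> c"
      using l b by (auto simp: c_def)
    have "AE t in Leb l. t \<notin> {c<..<l}"
      using K_const
    proof eventually_elim
      case (elim t)
      then show ?case
        using K_bound[of t] b(2)[of t] c by auto
    qed
    then have "emeasure (Leb l) {c<..<l} = 0"
      using c by (subst (asm) AE_iff_measurable[of "{c<..<l}"]) (auto simp: sets_restrict_space_iff)
    moreover have "emeasure (Leb l) {c<..<l} = ennreal (l - c)"
      using c by (subst emeasure_restrict_space) auto
    ultimately show False
      using c by simp
  qed
  then show ?thesis
    using adjoint_injective[OF z] K_const by (simp add: K_def)
qed

end

lemma RL_deriv_of_representation:
  assumes beta: "1 / 2 < \<beta>" "\<beta> < 1" and phi: "\<phi> \<in> L2_space (Leb l)"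
    and f: "AE \<xi> in Leb l. f \<xi> = c / Gamma \<beta> * \<xi> powr (\<beta> - 1) + frac_integral \<beta> \<phi> \<xi>"
    and meas: "f \<in> borel_measurable (Leb l)"
  shows "AE x in Leb l. RL_deriv \<beta> f x = \<phi> x"
proof -
  have "AE x in Leb l. ((\<lambda>y. LINT t|Leb y. \<phi> t) has_real_derivative \<phi> x) (at x)"
    by (rule indefinite_integral_has_derivative_AE[OF L2_integrable[OF finite_measure_Leb phi]])
  moreover have "AE x in Leb l. x \<in> {0<..<l}"
    by (rule AE_I2) simp
  ultimately show ?thesis
  proof eventually_elim
    case (elim x)
    have "((\<lambda>y. c + (LINT t|Leb y. \<phi> t)) has_real_derivative \<phi> x) (at x)"
      using DERIV_add[OF DERIV_const elim(1)] by simp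
    then have "(frac_integral (1 - \<beta>) f has_real_derivative \<phi> x) (at x)"
      by (rule has_field_derivative_transform_within_open[of _ _ _ "{0<..<l}"])
        (use elim(2) frac_integral_of_representation[OF beta phi f meas] in auto)
    then show ?case
      unfolding RL_deriv_def by (rule DERIV_imp_deriv)
  qed
qed

text \<open>
  The singular term \<open>x powr (\<beta> - 1)\<close> is the kernel with source at the left end \<open>0\<close>.
\<close>

lemma powr_L2:
  assumes "1 / 2 < \<beta>" "\<beta> < 1" "0 \<le> l"
  shows "(\<lambda>x. x powr (\<beta> - 1)) \<in> L2_space (Leb l)"
  by (rule L2_cong_AE[OF kernel_L2'[OF assms(1,2), of 0 l]])
     (use assms in \<open>auto simp: rl_kernel_def intro!: AE_I2\<close>)

section \<open>Weighted inner products on a metric graph\<close>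

context metric_graph
begin

definition weight :: "'e gfun \<Rightarrow> real \<Rightarrow> real \<Rightarrow> bool" where
  "weight \<rho> lo hi \<longleftrightarrow> 0 < lo \<and> (\<forall>e\<in>arcs G. \<rho> e \<in> borel_measurable (Leb (len e)) \<and>
     (\<forall>x\<in>{0<..<len e}. lo \<le> \<rho> e x \<and> \<rho> e x \<le> hi))"

lemma weight_of_uniformly_continuous:
  assumes "unif_continuous_on_edges G len \<rho>" "0 < lo"
    and "\<forall>e\<in>arcs G. \<forall>x\<in>{0<..<len e}. lo \<le> \<rho> e x \<and> \<rho> e x \<le> hi"
  shows "weight \<rho> lo hi"
  using assms
  by (auto simp: weight_def unif_continuous_on_edges_def
      intro!: continuous_imp_measurable_on_sets_lebesgue uniformly_continuous_imp_continuous)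

abbreviation wip :: "'e gfun \<Rightarrow> 'e gfun \<Rightarrow> 'e gfun \<Rightarrow> real" where
  "wip \<equiv> weighted_inner G len"

lemma wip_eq: "wip \<rho> u v = (\<Sum>e\<in>arcs G. LINT x|Leb (len e). \<rho> e x * u e x * v e x)"
  by (simp add: weighted_inner_def graph_integral_def)

lemma L2_graph_iff: "u \<in> L2_graph G len \<longleftrightarrow> (\<forall>e\<in>arcs G. u e \<in> L2_space (Leb (len e)))"
  by (simp add: L2_graph_def L2_interval_eq)

lemma L2_graph_subspace: "subspace (L2_graph G len)"
  by (rule subspaceI)
     (auto simp: L2_graph_iff subspace_0[OF L2_subspace] intro!: subspace_add[OF L2_subspace] subspace_scale[OF L2_subspace])

context
  fixes \<rho> lo hi
  assumes w: "weight \<rho> lo hi"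
begin

lemma weight_measurable: "e \<in> arcs G \<Longrightarrow> \<rho> e \<in> borel_measurable (Leb (len e))"
  and weight_bounds: "e \<in> arcs G \<Longrightarrow> 0 < x \<Longrightarrow> x < len e \<Longrightarrow> lo \<le> \<rho> e x \<and> \<rho> e x \<le> hi"
  and weight_pos: "0 < lo"
  using w by (auto simp: weight_def)

lemma weighted_L2:
  assumes "u \<in> L2_graph G len" "e \<in> arcs G"
  shows "(\<lambda>x. \<rho> e x * u e x) \<in> L2_space (Leb (len e))"
  using assms weight_measurable weight_bounds[of e] weight_pos
  by (intro L2_bounded_mult[where B = hi]) (force simp: L2_graph_iff)+

lemma weighted_integrable:
  assumes "u \<in> L2_graph G len" "v \<in> L2_graph G len" "e \<in> arcs G"
  shows "integrable (Leb (len e)) (\<lambda>x. \<rho> e x * u e x * v e x)"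
  using L2_mult_integrable[OF weighted_L2[OF assms(1,3)], of "v e"] assms by (simp add: L2_graph_iff)

lemma wip_semi_inner: "semi_inner (L2_graph G len) (wip \<rho>)"
proof
  fix x y z :: "'e gfun" and c :: real
  assume x: "x \<in> L2_graph G len"
  {
    assume "y \<in> L2_graph G len" "z \<in> L2_graph G len"
    then show "wip \<rho> (x + y) z = wip \<rho> x z + wip \<rho> y z"
      using x weighted_integrable
      by (simp add: wip_eq distrib_left distrib_right sum.distrib)
  }
  show "wip \<rho> (c *\<^sub>R x) z = c * wip \<rho> x z"
    by (simp add: wip_eq sum_distrib_left mult_ac flip: Bochner_Integration.integral_mult_right_zero)
  show "wip \<rho> x y = wip \<rho> y x"
    by (simp add: wip_eq mult_ac)
  show "0 \<le> wip \<rho> x x"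
    unfolding wip_eq
  proof (intro sum_nonneg Bochner_Integration.integral_nonneg)
    fix e t assume "e \<in> arcs G" "t \<in> space (Leb (len e))"
    then show "0 \<le> \<rho> e t * x e t * x e t"
      using weight_bounds[of e t] weight_pos by (simp add: mult.assoc)
  qed
qed (rule L2_graph_subspace)

lemma wip_edge_le:
  assumes "u \<in> L2_graph G len" "e \<in> arcs G"
  shows "lo * (LINT x|Leb (len e). (u e x)\<^sup>2) \<le> wip \<rho> u u"
proof -
  have "lo * (LINT x|Leb (len e). (u e x)\<^sup>2) \<le> (LINT x|Leb (len e). \<rho> e x * u e x * u e x)"
  proof -
    have "(LINT x|Leb (len e). lo * (u e x)\<^sup>2) \<le> (LINT x|Leb (len e). \<rho> e x * u e x * u e x)"
    proof (rule integral_mono)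
      show "lo * (u e x)\<^sup>2 \<le> \<rho> e x * u e x * u e x" if "x \<in> space (Leb (len e))" for x
        using weight_bounds[OF assms(2)] that by (simp add: power2_eq_square mult.assoc mult_right_mono)
    qed (use assms weighted_integrable in \<open>auto simp: L2_graph_iff L2_square_integrable\<close>)
    then show ?thesis by simp
  qed
  also have "\<dots> \<le> wip \<rho> u u"
    unfolding wip_eq
  proof (rule member_le_sum[OF assms(2)])
    fix d assume d: "d \<in> arcs G - {e}"
    show "0 \<le> (LINT x|Leb (len d). \<rho> d x * u d x * u d x)"
    proof (rule Bochner_Integration.integral_nonneg)
      fix x assume "x \<in> space (Leb (len d))"
      then show "0 \<le> \<rho> d x * u d x * u d x"
        using weight_bounds[of d x] weight_pos d by (simp add: mult.assoc)
    qed
  qed (rule finite_arcs)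
  finally show ?thesis .
qed

lemma wip_le:
  assumes "u \<in> L2_graph G len"
  shows "wip \<rho> u u \<le> hi * (\<Sum>e\<in>arcs G. LINT x|Leb (len e). (u e x)\<^sup>2)"
  unfolding wip_eq sum_distrib_left
proof (rule sum_mono)
  fix e assume e: "e \<in> arcs G"
  have "(LINT x|Leb (len e). \<rho> e x * u e x * u e x) \<le> (LINT x|Leb (len e). hi * (u e x)\<^sup>2)"
  proof (rule integral_mono)
    show "\<rho> e x * u e x * u e x \<le> hi * (u e x)\<^sup>2" if "x \<in> space (Leb (len e))" for x
      using weight_bounds[OF e] that by (simp add: power2_eq_square mult.assoc mult_right_mono)
  qed (use assms e weighted_integrable in \<open>auto simp: L2_graph_iff L2_square_integrable\<close>)
  then show "(LINT x|Leb (len e). \<rho> e x * u e x * u e x) \<le> hi * (LINT x|Leb (len e). (u e x)\<^sup>2)"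
    by simp
qed

text \<open>
  The null vectors of the inner product are the functions that \<^const>\<open>ae_eq\<close> identifies with zero.
\<close>

lemma wip_null_iff:
  assumes "u \<in> L2_graph G len"
  shows "wip \<rho> u u = 0 \<longleftrightarrow> ae_eq G len u (\<lambda>e x. 0)"
proof
  assume 0: "wip \<rho> u u = 0"
  show "ae_eq G len u (\<lambda>e x. 0)"
    unfolding ae_eq_def
  proof
    fix e assume e: "e \<in> arcs G"
    have "(LINT x|Leb (len e). (u e x)\<^sup>2) \<le> 0"
      using wip_edge_le[OF assms e] 0 weight_pos by (simp add: mult_le_0_iff)
    moreover have "0 \<le> (LINT x|Leb (len e). (u e x)\<^sup>2)"
      by simp
    ultimately have "(LINT x|Leb (len e). (u e x)\<^sup>2) = 0"
      by linarith
    then show "AE x in Leb (len e). u e x = 0"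
      using L2_norm_zero_iff[of "u e" "Leb (len e)"] assms e by (simp add: L2_graph_iff)
  qed
next
  assume "ae_eq G len u (\<lambda>e x. 0)"
  then have "(\<Sum>e\<in>arcs G. LINT x|Leb (len e). (u e x)\<^sup>2) = 0"
    using L2_norm_zero_iff assms by (intro sum.neutral) (auto simp: ae_eq_def L2_graph_iff)
  then show "wip \<rho> u u = 0"
    using wip_le[OF assms] semi_inner.nonneg[OF wip_semi_inner assms] by simp
qed

lemma wip_cong_ae:
  assumes "ae_eq G len u u'" "ae_eq G len v v'"
    and "u \<in> L2_graph G len" "u' \<in> L2_graph G len" "v \<in> L2_graph G len" "v' \<in> L2_graph G len"
  shows "wip \<rho> u v = wip \<rho> u' v'"
  unfolding wip_eq
proof (intro sum.cong refl integral_cong_AE)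
  fix e assume e: "e \<in> arcs G"
  have ae: "AE x in Leb (len e). u e x = u' e x" "AE x in Leb (len e). v e x = v' e x"
    using assms(1,2) e by (auto simp: ae_eq_def)
  then show "AE x in Leb (len e). \<rho> e x * u e x * v e x = \<rho> e x * u' e x * v' e x"
    by eventually_elim simp
qed (use assms weighted_integrable in \<open>auto intro: borel_measurable_integrable\<close>)

lemma wip_complete: "semi_inner.sq_complete (L2_graph G len) (wip \<rho>)"
proof -
  interpret semi_inner "L2_graph G len" "wip \<rho>"
    by (rule wip_semi_inner)
  show ?thesis
    unfolding sq_complete_def
  proof (intro allI impI, elim conjE)
    fix X assume X: "\<forall>n. X n \<in> L2_graph G len" and C: "sq_Cauchy X"
    have "\<forall>e\<in>arcs G. \<exists>f. f \<in> L2_space (Leb (len e)) \<and> (\<lambda>n. LINT x|Leb (len e). (X n e x - f x)\<^sup>2) \<longlonglongrightarrow> 0"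
    proof
      fix e assume e: "e \<in> arcs G"
      interpret E: semi_inner "L2_space (Leb (len e))" "\<lambda>f g. LINT x|Leb (len e). f x * g x"
        by (rule L2_semi_inner)
      have "E.sq_Cauchy (\<lambda>n. X n e)"
        unfolding E.sq_Cauchy_def
      proof (intro allI impI)
        fix \<epsilon> :: real assume "\<epsilon> > 0"
        then have "lo * \<epsilon> > 0"
          using weight_pos by simp
        then obtain N where N: "\<And>m n. m \<ge> N \<Longrightarrow> n \<ge> N \<Longrightarrow> wip \<rho> (X m - X n) (X m - X n) < lo * \<epsilon>"
          using C unfolding sq_Cauchy_def by meson
        have "(LINT x|Leb (len e). (X m e - X n e) x * (X m e - X n e) x) < \<epsilon>" if "m \<ge> N" "n \<ge> N" for m n
        proof -
          have "lo * (LINT x|Leb (len e). ((X m - X n) e x)\<^sup>2) < lo * \<epsilon>"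
            using wip_edge_le[of "X m - X n" e] e X N[OF that] by (force intro: mem)
          then show ?thesis
            using weight_pos by (simp add: power2_eq_square)
        qed
        then show "\<exists>N. \<forall>m\<ge>N. \<forall>n\<ge>N. (LINT x|Leb (len e). (X m e - X n e) x * (X m e - X n e) x) < \<epsilon>"
          by blast
      qed
      moreover have "X n e \<in> L2_space (Leb (len e))" for n
        using X e by (simp add: L2_graph_iff)
      ultimately have "\<exists>f\<in>L2_space (Leb (len e)). E.sq_tendsto (\<lambda>n. X n e) f"
        using L2_complete[of "Leb (len e)", unfolded E.sq_complete_def, THEN spec, of "\<lambda>n. X n e"] by simp
      then show "\<exists>f. f \<in> L2_space (Leb (len e)) \<and> (\<lambda>n. LINT x|Leb (len e). (X n e x - f x)\<^sup>2) \<longlonglongrightarrow> 0"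
        unfolding E.sq_tendsto_def by (auto simp: power2_eq_square)
    qed
    from bchoice[OF this] obtain f where f: "\<And>e. e \<in> arcs G \<Longrightarrow> f e \<in> L2_space (Leb (len e))"
        "\<And>e. e \<in> arcs G \<Longrightarrow> (\<lambda>n. LINT x|Leb (len e). (X n e x - f e x)\<^sup>2) \<longlonglongrightarrow> 0"
      by auto
    have fL: "f \<in> L2_graph G len"
      using f(1) by (simp add: L2_graph_iff)
    have "sq_tendsto X f"
      unfolding sq_tendsto_def
    proof (rule tendsto_sandwich[of "\<lambda>_. 0"])
      show "\<forall>\<^sub>F n in sequentially. wip \<rho> (X n - f) (X n - f)
          \<le> hi * (\<Sum>e\<in>arcs G. LINT x|Leb (len e). (X n e x - f e x)\<^sup>2)"
        using wip_le[of "X n - f" for n] X fL by (intro always_eventually allI) simp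
      show "(\<lambda>n. hi * (\<Sum>e\<in>arcs G. LINT x|Leb (len e). (X n e x - f e x)\<^sup>2)) \<longlonglongrightarrow> 0"
        using f(2) by (intro tendsto_mult_right_zero tendsto_null_sum) auto
    qed (use X fL in \<open>auto intro!: always_eventually nonneg\<close>)
    then show "\<exists>x\<in>L2_graph G len. sq_tendsto X x"
      using fL by blast
  qed
qed

end

end

section \<open>The energy space\<close>

text \<open>
  The coefficients of the eigenvalue problem enter as the weights of two \<open>L\<^sub>2\<close> inner products.
\<close>

locale fractional_graph = metric_graph G len
  for G :: "('v, 'e) pre_digraph" and len :: "'e \<Rightarrow> real" +
  fixes \<beta> a0 a1 R0 R1 :: real and p r :: "'e gfun"
  assumes beta: "1 / 2 < \<beta>" "\<beta> < 1"
    and conn: "Digraph_Component.connected G" and bd: "boundary G \<noteq> {}"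
    and weight_p: "weight p a0 a1" and weight_r: "weight r R0 R1"
begin

abbreviation "L \<equiv> L2_graph G len"
abbreviation "V \<equiv> H_graph_Dir G len \<beta>"

text \<open>
  A function of \<^const>\<open>H_graph_Dir\<close> is determined by the vertex values \<open>h\<close> of its fractional integral of
  order \<open>1 - \<beta>\<close> and by its fractional derivative \<open>\<phi>\<close>. These data are those of an ordinary \<open>H\<^sup>1\<close>
  function on the graph that vanishes at the boundary, and \<open>synth\<close> recovers the function from them.
\<close>

definition admissible :: "('v \<Rightarrow> real) \<Rightarrow> 'e gfun \<Rightarrow> bool" where
  "admissible h \<phi> \<longleftrightarrow> \<phi> \<in> L \<and> (\<forall>v\<in>boundary G. h v = 0) \<and>
     (\<forall>e\<in>arcs G. h (head G e) = h (tail G e) + (LINT t|Leb (len e). \<phi> e t))"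

definition synth :: "('v \<Rightarrow> real) \<Rightarrow> 'e gfun \<Rightarrow> 'e gfun" where
  "synth h \<phi> e x = h (tail G e) / Gamma \<beta> * x powr (\<beta> - 1) + frac_integral \<beta> (\<phi> e) x"

definition represents :: "'e gfun \<Rightarrow> ('v \<Rightarrow> real) \<Rightarrow> 'e gfun \<Rightarrow> bool" where
  "represents u h \<phi> \<longleftrightarrow> admissible h \<phi> \<and>
     (\<forall>e\<in>arcs G. u e \<in> borel_measurable (Leb (len e)) \<and> (AE x in Leb (len e). u e x = synth h \<phi> e x))"

lemma phi_L2: "\<phi> \<in> L \<Longrightarrow> e \<in> arcs G \<Longrightarrow> \<phi> e \<in> L2_space (Leb (len e))"
  by (simp add: L2_graph_iff)

lemma admissible_L: "admissible h \<phi> \<Longrightarrow> \<phi> \<in> L"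
  by (simp add: admissible_def)

lemma Gamma_pos: "Gamma \<beta> > 0"
  using Gamma_beta_pos[OF beta] by simp

lemma frac_integral_L2:
  assumes "\<phi> \<in> L2_space (Leb l)"
  shows "frac_integral \<beta> \<phi> \<in> L2_space (Leb l)"
proof (rule L2_bounded[OF finite_measure_Leb frac_integral_measurable[OF beta assms]])
  fix x assume x: "x \<in> space (Leb l)"
  have "(frac_integral \<beta> \<phi> x)\<^sup>2 \<le> x powr (2 * \<beta> - 1) / (2 * \<beta> - 1) / (Gamma \<beta>)\<^sup>2 * (LINT t|Leb l. (\<phi> t)\<^sup>2)"
    using x by (intro frac_integral_bound[OF beta assms]) auto
  also have "\<dots> \<le> l powr (2 * \<beta> - 1) / (2 * \<beta> - 1) / (Gamma \<beta>)\<^sup>2 * (LINT t|Leb l. (\<phi> t)\<^sup>2)"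
    using x beta by (intro mult_right_mono divide_right_mono powr_mono2) auto
  finally show "\<bar>frac_integral \<beta> \<phi> x\<bar> \<le> sqrt (l powr (2 * \<beta> - 1) / (2 * \<beta> - 1) / (Gamma \<beta>)\<^sup>2 * (LINT t|Leb l. (\<phi> t)\<^sup>2))"
    using real_sqrt_le_mono by fastforce
qed

lemma synth_L:
  assumes "\<phi> \<in> L"
  shows "synth h \<phi> \<in> L"
  unfolding L2_graph_iff synth_def
proof
  fix e assume e: "e \<in> arcs G"
  show "(\<lambda>x. h (tail G e) / Gamma \<beta> * x powr (\<beta> - 1) + frac_integral \<beta> (\<phi> e) x) \<in> L2_space (Leb (len e))"
    by (intro L2_add L2_scale powr_L2[OF beta] frac_integral_L2 phi_L2[OF assms e] less_imp_le len_pos e)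
qed

lemma represents_L:
  assumes "represents u h \<phi>"
  shows "u \<in> L"
  unfolding L2_graph_iff
proof
  fix e assume e: "e \<in> arcs G"
  have synth: "synth h \<phi> e \<in> L2_space (Leb (len e))"
    using assms e by (intro phi_L2 synth_L) (auto simp: represents_def admissible_def)
  have ae: "AE x in Leb (len e). synth h \<phi> e x = u e x"
    using assms e unfolding represents_def by (auto simp: eq_commute)
  show "u e \<in> L2_space (Leb (len e))"
    by (rule L2_cong_AE[OF synth _ ae]) (use assms e in \<open>simp add: represents_def\<close>)
qed

lemma represents_frac_integral:
  assumes "represents u h \<phi>" "e \<in> arcs G" "0 < x" "x \<le> len e"
  shows "frac_integral (1 - \<beta>) (u e) x = h (tail G e) + (LINT t|Leb x. \<phi> e t)"
  using assms by (intro frac_integral_of_representation[OF beta, of _ "len e"])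
    (auto simp: represents_def admissible_def synth_def phi_L2)

lemma represents_RL_deriv:
  assumes "represents u h \<phi>"
  shows "ae_eq G len (RL_deriv_graph \<beta> u) \<phi>" and "RL_deriv_graph \<beta> u \<in> L"
proof -
  have ae: "AE x in Leb (len e). RL_deriv \<beta> (u e) x = \<phi> e x" if "e \<in> arcs G" for e
    using assms that by (intro RL_deriv_of_representation[OF beta, of _ _ _ "h (tail G e)"])
      (auto simp: represents_def admissible_def synth_def phi_L2)
  then show "ae_eq G len (RL_deriv_graph \<beta> u) \<phi>"
    by (simp add: ae_eq_def RL_deriv_graph_def)
  show "RL_deriv_graph \<beta> u \<in> L"
    unfolding L2_graph_iff RL_deriv_graph_def
  proof
    fix e assume e: "e \<in> arcs G"
    then have phi: "\<phi> e \<in> L2_space (Leb (len e))"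
      using assms by (simp add: represents_def admissible_def phi_L2)
    have ae': "AE x in Leb (len e). \<phi> e x = RL_deriv \<beta> (u e) x"
      using ae[OF e] by eventually_elim simp
    show "RL_deriv \<beta> (u e) \<in> L2_space (Leb (len e))"
      using borel_measurable_Leb_cong_AE[OF L2_measurable[OF phi] ae'] by (rule L2_cong_AE[OF phi _ ae'])
  qed
qed

text \<open>
  On an edge the fractional integral of order \<open>1 - \<beta>\<close> is \<open>h (tail G e) + \<integral>\<phi>\<close>, which is continuous and has
  the right limits at both ends.
\<close>

lemma represents_imp_V:
  assumes rep: "represents u h \<phi>"
  shows "u \<in> V"
proof -
  have cont: "continuous_with_vertex_values G len (frac_integral_graph (1 - \<beta>) u) h"
    unfolding continuous_with_vertex_values_def frac_integral_graph_def
  proof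
    fix e assume e: "e \<in> arcs G"
    have "integrable (Leb (len e)) (\<phi> e)"
      using rep e by (simp add: represents_def admissible_def phi_L2 L2_integrable[OF finite_measure_Leb])
    from indefinite_integral_ends[OF this len_pos[OF e], of "frac_integral (1 - \<beta>) (u e)" "h (tail G e)"]
    show "continuous_on {0<..<len e} (frac_integral (1 - \<beta>) (u e)) \<and>
        (frac_integral (1 - \<beta>) (u e) \<longlongrightarrow> h (tail G e)) (at_right 0) \<and>
        (frac_integral (1 - \<beta>) (u e) \<longlongrightarrow> h (head G e)) (at_left (len e))"
      using represents_frac_integral[OF rep e] rep e by (simp add: represents_def admissible_def)
  qed
  have "u e \<in> H_interval \<beta> (len e)" if e: "e \<in> arcs G" for e
  proof -
    have "u e \<in> L2_interval (len e)"
      using represents_L[OF rep] e by (simp add: L2_interval_eq phi_L2)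
    moreover have "u e \<in> AC_space \<beta> (len e)"
      unfolding AC_space_def AE_Leb_Icc_iff
      using rep e by (auto simp: represents_def admissible_def synth_def L2_interval_eq phi_L2 intro!: exI[of _ "h (tail G e)"] bexI[of _ "\<phi> e"])
    ultimately show ?thesis
      by (simp add: H_interval_def)
  qed
  then show ?thesis
    using cont rep unfolding H_graph_Dir_def H_graph_def represents_def admissible_def by blast
qed

text \<open>
  Conversely, the limits at the two ends of an edge identify the constant of the representation with
  the value at the tail, and the integral of \<open>\<phi>\<close> with the increment from tail to head.
\<close>

lemma V_imp_represents:
  assumes "u \<in> V"
  obtains h \<phi> where "represents u h \<phi>"
proof -
  obtain h where cont: "continuous_with_vertex_values G len (frac_integral_graph (1 - \<beta>) u) h"
    and h0: "\<forall>v\<in>boundary G. h v = 0"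
    and H: "\<And>e. e \<in> arcs G \<Longrightarrow> u e \<in> H_interval \<beta> (len e)"
    using assms by (auto simp: H_graph_Dir_def H_graph_def)
  have "\<forall>e\<in>arcs G. \<exists>\<phi>. \<phi> \<in> L2_space (Leb (len e)) \<and>
      (AE x in Leb (len e). u e x = h (tail G e) / Gamma \<beta> * x powr (\<beta> - 1) + frac_integral \<beta> \<phi> x) \<and>
      h (head G e) = h (tail G e) + (LINT t|Leb (len e). \<phi> t)"
  proof
    fix e assume e: "e \<in> arcs G"
    have len: "0 < len e"
      using e by (rule len_pos)
    have u: "u e \<in> L2_space (Leb (len e))"
      using H[OF e] by (simp add: H_interval_def L2_interval_eq)
    obtain c \<phi> where phi: "\<phi> \<in> L2_space (Leb (len e))"
      and ae: "AE x in Leb (len e). u e x = c / Gamma \<beta> * x powr (\<beta> - 1) + frac_integral \<beta> \<phi> x"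
      using H[OF e] unfolding H_interval_def AC_space_def AE_Leb_Icc_iff L2_interval_eq by auto
    note ends = indefinite_integral_ends[OF L2_integrable[OF finite_measure_Leb phi] len,
        OF frac_integral_of_representation[OF beta phi ae L2_measurable[OF u]]]
    have lim: "(frac_integral (1 - \<beta>) (u e) \<longlongrightarrow> h (tail G e)) (at_right 0)"
      "(frac_integral (1 - \<beta>) (u e) \<longlongrightarrow> h (head G e)) (at_left (len e))"
      using cont e by (simp_all add: continuous_with_vertex_values_def frac_integral_graph_def)
    have tail: "h (tail G e) = c"
      using lim(1) ends(2) by (intro tendsto_unique[of "at_right (0::real)"]) auto
    have head: "h (head G e) = c + (LINT t|Leb (len e). \<phi> t)"
      using lim(2) ends(3) by (intro tendsto_unique[of "at_left (len e)"]) auto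
    show "\<exists>\<phi>. \<phi> \<in> L2_space (Leb (len e)) \<and>
      (AE x in Leb (len e). u e x = h (tail G e) / Gamma \<beta> * x powr (\<beta> - 1) + frac_integral \<beta> \<phi> x) \<and>
      h (head G e) = h (tail G e) + (LINT t|Leb (len e). \<phi> t)"
      using phi ae tail head by auto
  qed
  from bchoice[OF this] obtain \<phi> where phi: "\<And>e. e \<in> arcs G \<Longrightarrow> \<phi> e \<in> L2_space (Leb (len e)) \<and>
      (AE x in Leb (len e). u e x = h (tail G e) / Gamma \<beta> * x powr (\<beta> - 1) + frac_integral \<beta> (\<phi> e) x) \<and>
      h (head G e) = h (tail G e) + (LINT t|Leb (len e). \<phi> e t)"
    by auto
  have "u e \<in> borel_measurable (Leb (len e))" if "e \<in> arcs G" for e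
    using H[OF that] by (simp add: H_interval_def L2_interval_def)
  then have "represents u h \<phi>"
    using phi h0 by (simp add: represents_def admissible_def synth_def L2_graph_iff)
  then show ?thesis ..
qed

lemma represents_synth: "admissible h \<phi> \<Longrightarrow> represents (synth h \<phi>) h \<phi>"
  using synth_L[of \<phi> h] by (auto simp: represents_def admissible_def L2_graph_iff dest: L2_measurable)

text \<open>
  Linearity has to pass through representations: \<^const>\<open>RL_deriv\<close> is a derivative of a Bochner integral and
  not linear outside the space.
\<close>

lemma represents_add:
  assumes u: "represents u h \<phi>" and w: "represents w k \<psi>"
  shows "represents (u + w) (\<lambda>v. h v + k v) (\<phi> + \<psi>)"
proof -
  have L: "\<phi> e \<in> L2_space (Leb (len e))" "\<psi> e \<in> L2_space (Leb (len e))" if "e \<in> arcs G" for e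
    using that u w by (auto simp: represents_def admissible_def phi_L2)
  have "synth (\<lambda>v. h v + k v) (\<phi> + \<psi>) e x = synth h \<phi> e x + synth k \<psi> e x"
    if "e \<in> arcs G" "x \<in> {0<..<len e}" for e x
    using frac_integral_add[OF beta L[OF that(1)], of x] that
    by (simp add: synth_def plus_fun_def add_divide_distrib distrib_right)
  note synth = this
  have "AE x in Leb (len e). (u + w) e x = synth (\<lambda>v. h v + k v) (\<phi> + \<psi>) e x" if e: "e \<in> arcs G" for e
  proof -
    have "AE x in Leb (len e). u e x = synth h \<phi> e x" "AE x in Leb (len e). w e x = synth k \<psi> e x"
      using u w e by (auto simp: represents_def)
    moreover have "AE x in Leb (len e). x \<in> {0<..<len e}"
      by (rule AE_I2) simp
    ultimately show ?thesis
      by eventually_elim (simp add: synth[OF e])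
  qed
  moreover have "(u + w) e \<in> borel_measurable (Leb (len e))" if "e \<in> arcs G" for e
    using u w that by (auto simp: represents_def plus_fun_def intro!: borel_measurable_add)
  moreover have "\<phi> + \<psi> \<in> L"
    using u w by (auto simp: represents_def admissible_def intro: subspace_add[OF L2_graph_subspace])
  moreover have "integral\<^sup>L (Leb (len e)) (\<phi> e + \<psi> e) = (LINT t|Leb (len e). \<phi> e t) + (LINT t|Leb (len e). \<psi> e t)"
    if "e \<in> arcs G" for e
    using L[OF that] by (simp add: plus_fun_def L2_integrable[OF finite_measure_Leb])
  ultimately show ?thesis
    using u w unfolding represents_def admissible_def by auto
qed

lemma represents_scale:
  assumes u: "represents u h \<phi>"
  shows "represents (c *\<^sub>R u) (\<lambda>v. c * h v) (c *\<^sub>R \<phi>)"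
proof -
  have "synth (\<lambda>v. c * h v) (c *\<^sub>R \<phi>) e x = c * synth h \<phi> e x" for e x
    by (simp add: synth_def scaleR_fun_def frac_integral_scale distrib_left)
  then have "AE x in Leb (len e). (c *\<^sub>R u) e x = synth (\<lambda>v. c * h v) (c *\<^sub>R \<phi>) e x" if "e \<in> arcs G" for e
    using u that by (auto simp: represents_def elim!: eventually_mono)
  moreover have "c *\<^sub>R \<phi> \<in> L"
    using u by (auto simp: represents_def admissible_def intro: subspace_scale[OF L2_graph_subspace])
  ultimately show ?thesis
    using u by (auto simp: represents_def admissible_def scaleR_fun_def distrib_left)
qed

lemma represents_diff:
  assumes "represents u h \<phi>" "represents w k \<psi>"
  shows "represents (u - w) (\<lambda>v. h v - k v) (\<phi> - \<psi>)"
  using represents_add[OF assms(1) represents_scale[OF assms(2), of "-1"]] by simp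

lemma V_subset_L: "V \<subseteq> L"
  using V_imp_represents represents_L by blast

lemma V_subspace: "subspace V"
proof (rule subspaceI)
  have "represents 0 (\<lambda>_. 0) 0"
    by (auto simp: represents_def admissible_def synth_def zero_fun_def frac_integral_def
        subspace_0[OF L2_graph_subspace, unfolded zero_fun_def])
  then show "0 \<in> V"
    by (rule represents_imp_V)
  show "u + w \<in> V" if "u \<in> V" "w \<in> V" for u w
    using that by (meson V_imp_represents represents_add represents_imp_V)
  show "c *\<^sub>R u \<in> V" if "u \<in> V" for u c
    using that by (meson V_imp_represents represents_scale represents_imp_V)
qed

definition energy :: "'e gfun \<Rightarrow> 'e gfun \<Rightarrow> real" where
  "energy u w = wip p (RL_deriv_graph \<beta> u) (RL_deriv_graph \<beta> w)"

sublocale r_ip: semi_inner L "wip r"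
  by (rule wip_semi_inner[OF weight_r])

sublocale p_ip: semi_inner L "wip p"
  by (rule wip_semi_inner[OF weight_p])

text \<open>
  Through a representation the energy is a weighted \<open>L\<^sub>2\<close> inner product of the densities \<open>\<phi>\<close>; all
  properties of the energy are derived from this formula.
\<close>

lemma energy_eq:
  assumes "represents u h \<phi>" "represents w k \<psi>"
  shows "energy u w = wip p \<phi> \<psi>"
  unfolding energy_def
  by (rule wip_cong_ae[OF weight_p represents_RL_deriv(1)[OF assms(1)] represents_RL_deriv(1)[OF assms(2)]
        represents_RL_deriv(2)[OF assms(1)] _ represents_RL_deriv(2)[OF assms(2)]])
     (use assms in \<open>auto simp: represents_def admissible_def\<close>)

sublocale form: semi_inner V energy
proof (unfold_locales, rule V_subspace)
  fix u w z and c :: real assume V: "u \<in> V"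
  obtain h \<phi> where u: "represents u h \<phi>"
    using V by (rule V_imp_represents)
  then have phi: "\<phi> \<in> L"
    by (simp add: represents_def admissible_def)
  show "0 \<le> energy u u"
    using energy_eq[OF u u] phi by (simp add: p_ip.nonneg)
  {
    assume "w \<in> V"
    then obtain k \<psi> where w: "represents w k \<psi>"
      by (rule V_imp_represents)
    then have psi: "\<psi> \<in> L"
      by (simp add: represents_def admissible_def)
    show "energy u w = energy w u"
      using energy_eq[OF u w] energy_eq[OF w u] phi psi by (simp add: p_ip.commute)
    assume "z \<in> V"
    then obtain j \<omega> where z: "represents z j \<omega>"
      by (rule V_imp_represents)
    then have chi: "\<omega> \<in> L"
      by (simp add: represents_def admissible_def)
    show "energy (u + w) z = energy u z + energy w z"
      using energy_eq[OF u z] energy_eq[OF w z] energy_eq[OF represents_add[OF u w] z] phi psi chi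
      by (simp add: p_ip.add_left)
  }
  assume "z \<in> V"
  then obtain j \<omega> where z: "represents z j \<omega>"
    by (rule V_imp_represents)
  then have "\<omega> \<in> L"
    by (simp add: represents_def admissible_def)
  then show "energy (c *\<^sub>R u) z = c * energy u z"
    using energy_eq[OF u z] energy_eq[OF represents_scale[OF u] z] phi
    by (simp add: p_ip.scale_left)
qed

section \<open>Bounds by the energy and the compact embedding\<close>

lemma a0_pos: "a0 > 0"
  using weight_p by (simp add: weight_def)

lemma edge_integral_bound:
  assumes "\<phi> \<in> L" "e \<in> arcs G"
  shows "(LINT t|Leb (len e). \<phi> e t)\<^sup>2 \<le> len e / a0 * wip p \<phi> \<phi>"
proof -
  have "(LINT t|Leb (len e). \<phi> e t)\<^sup>2 \<le> len e * (LINT t|Leb (len e). (\<phi> e t)\<^sup>2)"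
    using len_pos[OF assms(2)] by (intro integral_Leb_square_le phi_L2 assms) auto
  also have "\<dots> \<le> len e * (wip p \<phi> \<phi> / a0)"
    using wip_edge_le[OF weight_p assms] a0_pos len_pos[OF assms(2)]
    by (intro mult_left_mono) (auto simp: field_simps)
  finally show ?thesis by simp
qed

lemma edge_square_le:
  assumes "\<phi> \<in> L" "e \<in> arcs G"
  shows "(LINT t|Leb (len e). (\<phi> e t)\<^sup>2) \<le> wip p \<phi> \<phi> / a0"
  using wip_edge_le[OF weight_p assms] a0_pos by (simp add: field_simps)

text \<open>
  This and the next lemma restate the estimates on one edge with constants that depend on the
  function only through its energy.
\<close>

lemma frac_edge_bound:
  assumes "\<phi> \<in> L" "e \<in> arcs G" "0 \<le> x" "x \<le> len e"
  shows "(frac_integral \<beta> (\<phi> e) x)\<^sup>2 \<le> len e powr (2 * \<beta> - 1) / (2 * \<beta> - 1) / (Gamma \<beta>)\<^sup>2 * (wip p \<phi> \<phi> / a0)"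
proof -
  have "(frac_integral \<beta> (\<phi> e) x)\<^sup>2
      \<le> x powr (2 * \<beta> - 1) / (2 * \<beta> - 1) / (Gamma \<beta>)\<^sup>2 * (LINT t|Leb (len e). (\<phi> e t)\<^sup>2)"
    by (intro frac_integral_bound[OF beta] phi_L2 assms)
  also have "\<dots> \<le> len e powr (2 * \<beta> - 1) / (2 * \<beta> - 1) / (Gamma \<beta>)\<^sup>2 * (wip p \<phi> \<phi> / a0)"
    using assms beta
    by (intro mult_mono divide_right_mono powr_mono2 edge_square_le) auto
  finally show ?thesis .
qed

lemma frac_edge_Hoelder:
  assumes "\<phi> \<in> L" "e \<in> arcs G" "0 \<le> y" "y \<le> len e" "0 \<le> x" "x \<le> len e"
  shows "(frac_integral \<beta> (\<phi> e) x - frac_integral \<beta> (\<phi> e) y)\<^sup>2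
    \<le> 2 * \<bar>x - y\<bar> powr (2 * \<beta> - 1) / (2 * \<beta> - 1) / (Gamma \<beta>)\<^sup>2 * (wip p \<phi> \<phi> / a0)"
proof -
  have "(frac_integral \<beta> (\<phi> e) x - frac_integral \<beta> (\<phi> e) y)\<^sup>2
      \<le> 2 * \<bar>x - y\<bar> powr (2 * \<beta> - 1) / (2 * \<beta> - 1) / (Gamma \<beta>)\<^sup>2 * (LINT t|Leb (len e). (\<phi> e t)\<^sup>2)"
    by (intro frac_integral_Hoelder[OF beta] phi_L2 assms)
  also have "\<dots> \<le> 2 * \<bar>x - y\<bar> powr (2 * \<beta> - 1) / (2 * \<beta> - 1) / (Gamma \<beta>)\<^sup>2 * (wip p \<phi> \<phi> / a0)"
    using beta by (intro mult_left_mono edge_square_le assms) auto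
  finally show ?thesis .
qed

text \<open>
  Poincare inequality at a vertex: walk to \<open>v\<close> from a boundary vertex, where \<open>h\<close> vanishes. Crossing an
  edge changes \<open>h\<close> by \<open>\<plusminus>\<integral>\<phi>\<close>, in either direction, which is bounded by the energy.
\<close>

lemma vertex_bound_at:
  assumes "v \<in> verts G"
  shows "\<exists>C\<ge>0. \<forall>h \<phi>. admissible h \<phi> \<longrightarrow> (h v)\<^sup>2 \<le> C * wip p \<phi> \<phi>"
proof -
  obtain v0 where v0: "v0 \<in> boundary G"
    using bd by blast
  then have "v0 \<in> verts G"
    by (simp add: boundary_def)
  then have "v0 \<rightarrow>\<^sup>*\<^bsub>mk_symmetric G\<^esub> v"
    using conn assms unfolding connected_def strongly_connected_def by simp
  then have "(v0, v) \<in> (parcs (mk_symmetric G))\<^sup>*"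
    using reachable_rtranclI by fastforce
  then show ?thesis
  proof (induction rule: rtrancl_induct)
    case base
    then show ?case
      using v0 by (auto simp: admissible_def intro!: exI[of _ 0])
  next
    case (step x y)
    obtain C where C: "C \<ge> 0" "\<And>h \<phi>. admissible h \<phi> \<Longrightarrow> (h x)\<^sup>2 \<le> C * wip p \<phi> \<phi>"
      using step.IH by auto
    from step.hyps(2) obtain e where e: "e \<in> arcs G" "(x, y) = (tail G e, head G e) \<or> (x, y) = (head G e, tail G e)"
      by (auto simp: parcs_mk_symmetric)
    have "(h y)\<^sup>2 \<le> (2 * C + 2 * (len e / a0)) * wip p \<phi> \<phi>" if adm: "admissible h \<phi>" for h \<phi>
    proof -
      have "h (head G e) = h (tail G e) + (LINT t|Leb (len e). \<phi> e t)"
        using adm e by (simp add: admissible_def)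
      then have "\<bar>h y - h x\<bar> = \<bar>LINT t|Leb (len e). \<phi> e t\<bar>"
        using e(2) by auto
      then have "(h y - h x)\<^sup>2 = (LINT t|Leb (len e). \<phi> e t)\<^sup>2"
        by (simp only: abs_eq_iff' power2_eq_iff) auto
      also have "\<dots> \<le> len e / a0 * wip p \<phi> \<phi>"
        using edge_integral_bound admissible_L[OF adm] e(1) by blast
      finally have "(h y - h x)\<^sup>2 \<le> len e / a0 * wip p \<phi> \<phi>" .
      moreover have "(h y)\<^sup>2 \<le> 2 * (h x)\<^sup>2 + 2 * (h y - h x)\<^sup>2"
        using zero_le_power2[of "h y - 2 * h x"] by (simp add: power2_eq_square algebra_simps)
      moreover have "(2 * C + 2 * (len e / a0)) * wip p \<phi> \<phi> = 2 * (C * wip p \<phi> \<phi>) + 2 * (len e / a0 * wip p \<phi> \<phi>)"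
        by (simp add: algebra_simps)
      ultimately show ?thesis
        using C(2)[OF adm] by linarith
    qed
    moreover have "2 * C + 2 * (len e / a0) \<ge> 0"
      using C(1) a0_pos len_pos[OF e(1)] by simp
    ultimately show ?case
      by blast
  qed
qed

lemma vertex_bound: "\<exists>C\<ge>0. \<forall>v\<in>verts G. \<forall>h \<phi>. admissible h \<phi> \<longrightarrow> (h v)\<^sup>2 \<le> C * wip p \<phi> \<phi>"
proof -
  have "\<forall>v\<in>verts G. \<exists>C. C \<ge> 0 \<and> (\<forall>h \<phi>. admissible h \<phi> \<longrightarrow> (h v)\<^sup>2 \<le> C * wip p \<phi> \<phi>)"
    using vertex_bound_at by blast
  from bchoice[OF this] obtain C where C: "\<And>v. v \<in> verts G \<Longrightarrow> C v \<ge> 0"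
    "\<And>v h \<phi>. v \<in> verts G \<Longrightarrow> admissible h \<phi> \<Longrightarrow> (h v)\<^sup>2 \<le> C v * wip p \<phi> \<phi>"
    by blast
  have "(h v)\<^sup>2 \<le> sum C (verts G) * wip p \<phi> \<phi>" if "v \<in> verts G" "admissible h \<phi>" for v h \<phi>
  proof -
    have "C v \<le> sum C (verts G)"
      using C(1) that(1) by (intro member_le_sum) auto
    then have "C v * wip p \<phi> \<phi> \<le> sum C (verts G) * wip p \<phi> \<phi>"
      using p_ip.nonneg[OF admissible_L[OF that(2)]] by (rule mult_right_mono)
    then show ?thesis
      using C(2)[OF that] by linarith
  qed
  moreover have "sum C (verts G) \<ge> 0"
    using C(1) by (rule sum_nonneg)
  ultimately show ?thesis
    by blast
qed

text \<open>
  The common majorant serves both the embedding into \<open>L\<close> and dominated convergence; it is integrable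
  because \<open>2 * (\<beta> - 1) > - 1\<close>.
\<close>

lemma synth_bound:
  "\<exists>K\<ge>0. \<forall>h \<phi>. admissible h \<phi> \<longrightarrow> (\<forall>e\<in>arcs G. \<forall>x\<in>{0<..<len e}.
     (synth h \<phi> e x)\<^sup>2 \<le> K * wip p \<phi> \<phi> * ((x powr (\<beta> - 1))\<^sup>2 + 1))"
proof -
  obtain C where C: "C \<ge> 0" "\<And>v h \<phi>. v \<in> verts G \<Longrightarrow> admissible h \<phi> \<Longrightarrow> (h v)\<^sup>2 \<le> C * wip p \<phi> \<phi>"
    using vertex_bound by blast
  define D where "D e = len e powr (2 * \<beta> - 1) / (2 * \<beta> - 1) / (Gamma \<beta>)\<^sup>2 / a0" for e
  have D: "D e \<ge> 0" for e
    using beta a0_pos by (simp add: D_def)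
  define K where "K = 2 * C / (Gamma \<beta>)\<^sup>2 + 2 * sum D (arcs G)"
  have sumD: "sum D (arcs G) \<ge> 0"
    using D by (rule sum_nonneg)
  then have K: "K \<ge> 0"
    using C(1) by (simp add: K_def)
  have "(synth h \<phi> e x)\<^sup>2 \<le> K * wip p \<phi> \<phi> * ((x powr (\<beta> - 1))\<^sup>2 + 1)"
    if adm: "admissible h \<phi>" and e: "e \<in> arcs G" and x: "x \<in> {0<..<len e}" for h \<phi> e x
  proof -
    define N where "N = wip p \<phi> \<phi>"
    define X where "X = (x powr (\<beta> - 1))\<^sup>2"
    have phi: "\<phi> \<in> L"
      using adm by (rule admissible_L)
    have N: "N \<ge> 0"
      unfolding N_def using phi by (rule p_ip.nonneg)
    have "(synth h \<phi> e x)\<^sup>2 \<le> 2 * ((h (tail G e))\<^sup>2 / (Gamma \<beta>)\<^sup>2 * X) + 2 * (frac_integral \<beta> (\<phi> e) x)\<^sup>2"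
    proof -
      have "(s + t)\<^sup>2 \<le> 2 * s\<^sup>2 + 2 * t\<^sup>2" for s t :: real
        using zero_le_power2[of "s - t"] by (simp add: power2_eq_square algebra_simps)
      from this[of "h (tail G e) / Gamma \<beta> * x powr (\<beta> - 1)" "frac_integral \<beta> (\<phi> e) x"]
      show ?thesis
        by (simp add: synth_def X_def power_mult_distrib power_divide)
    qed
    also have "\<dots> \<le> 2 * (C * N / (Gamma \<beta>)\<^sup>2 * X) + 2 * (D e * N)"
      using C(2)[OF tail_in_verts[OF e] adm] frac_edge_bound[OF phi e, of x] x
      by (intro add_mono mult_left_mono mult_right_mono divide_right_mono) (auto simp: N_def D_def X_def)
    also have "\<dots> \<le> K * N * X + K * N * 1"
    proof (rule add_mono)
      have "2 * C / (Gamma \<beta>)\<^sup>2 \<le> K"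
        using sumD by (simp add: K_def)
      then have "2 * C / (Gamma \<beta>)\<^sup>2 * (N * X) \<le> K * (N * X)"
        using N by (intro mult_right_mono) (auto simp: X_def)
      then show "2 * (C * N / (Gamma \<beta>)\<^sup>2 * X) \<le> K * N * X"
        by (simp add: mult_ac)
      have "D e \<le> sum D (arcs G)"
        using D e by (intro member_le_sum) auto
      then have "2 * D e \<le> K"
        using C(1) by (simp add: K_def add_increasing)
      then have "2 * D e * N \<le> K * N"
        using N by (rule mult_right_mono)
      then show "2 * (D e * N) \<le> K * N * 1"
        by simp
    qed
    finally show ?thesis
      by (simp add: N_def X_def distrib_left)
  qed
  then show ?thesis
    using K by blast
qed

lemma majorant_integrable:
  assumes "e \<in> arcs G"
  shows "integrable (Leb (len e)) (\<lambda>x. (x powr (\<beta> - 1))\<^sup>2 + 1)"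
proof -
  interpret finite_measure "Leb (len e)"
    by (rule finite_measure_Leb)
  show ?thesis
    using L2_square_integrable[OF powr_L2[OF beta less_imp_le[OF len_pos[OF assms]]]] by simp
qed

lemma arc_exists:
  obtains e where "e \<in> arcs G"
proof -
  obtain v where "v \<in> boundary G"
    using bd by blast
  then have "edges_at G v \<noteq> {}"
    by (auto simp: boundary_def valency_def)
  then show ?thesis
    using that by (auto simp: edges_at_def)
qed

lemma R1_nonneg: "R1 \<ge> 0"
proof -
  obtain e where e: "e \<in> arcs G"
    by (rule arc_exists)
  then show ?thesis
    using weight_bounds[OF weight_r e, of "len e / 2"] weight_pos[OF weight_r] len_pos[OF e] by auto
qed

lemma energy_dominates: "\<exists>C. \<forall>u\<in>V. wip r u u \<le> C * energy u u"
proof -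
  obtain K where K: "K \<ge> 0" "\<And>h \<phi> e x. admissible h \<phi> \<Longrightarrow> e \<in> arcs G \<Longrightarrow> x \<in> {0<..<len e} \<Longrightarrow>
     (synth h \<phi> e x)\<^sup>2 \<le> K * wip p \<phi> \<phi> * ((x powr (\<beta> - 1))\<^sup>2 + 1)"
    using synth_bound by blast
  define S where "S = (\<Sum>e\<in>arcs G. LINT x|Leb (len e). (x powr (\<beta> - 1))\<^sup>2 + 1)"
  have "wip r u u \<le> (R1 * K * S) * energy u u" if u: "u \<in> V" for u
  proof -
    obtain h \<phi> where rep: "represents u h \<phi>"
      using u by (rule V_imp_represents)
    then have adm: "admissible h \<phi>"
      by (simp add: represents_def)
    have "(LINT x|Leb (len e). (u e x)\<^sup>2) \<le> K * wip p \<phi> \<phi> * (LINT x|Leb (len e). (x powr (\<beta> - 1))\<^sup>2 + 1)"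
      if e: "e \<in> arcs G" for e
    proof -
      have "(LINT x|Leb (len e). (u e x)\<^sup>2) \<le> (LINT x|Leb (len e). K * wip p \<phi> \<phi> * ((x powr (\<beta> - 1))\<^sup>2 + 1))"
      proof (rule integral_mono_AE)
        have "AE x in Leb (len e). u e x = synth h \<phi> e x" "AE x in Leb (len e). x \<in> {0<..<len e}"
          using rep e by (auto simp: represents_def)
        then show "AE x in Leb (len e). (u e x)\<^sup>2 \<le> K * wip p \<phi> \<phi> * ((x powr (\<beta> - 1))\<^sup>2 + 1)"
          by eventually_elim (simp only: K(2)[OF adm e])
      qed (use L2_square_integrable[OF phi_L2[OF represents_L[OF rep] e]] majorant_integrable[OF e] in \<open>auto simp del: Bochner_Integration.integrable_add\<close>)
      then show ?thesis by simp
    qed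
    then have "(\<Sum>e\<in>arcs G. LINT x|Leb (len e). (u e x)\<^sup>2) \<le> K * wip p \<phi> \<phi> * S"
      unfolding S_def sum_distrib_left by (intro sum_mono)
    then have "wip r u u \<le> R1 * (K * wip p \<phi> \<phi> * S)"
      using wip_le[OF weight_r represents_L[OF rep]] R1_nonneg by (meson mult_left_mono order.trans)
    then show ?thesis
      using energy_eq[OF rep rep] by (simp add: mult_ac)
  qed
  then show ?thesis by blast
qed

text \<open>
  A diagonal argument gives a subsequence for which the vertex values and the fractional integrals
  at rational points converge. The fractional integrals are equicontinuous by the Hoelder estimate,
  so they converge at every point, and dominated convergence gives convergence in \<open>L\<close>.
\<close>

lemma compact_embedding:
  assumes XV: "\<And>n. X n \<in> V" and XM: "\<And>n. energy (X n) (X n) \<le> M"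
  shows "\<exists>s. strict_mono (s :: nat \<Rightarrow> nat) \<and> r_ip.sq_Cauchy (X \<circ> s)"
proof -
  have "\<forall>n. \<exists>h \<phi>. represents (X n) h \<phi>"
    using XV V_imp_represents by metis
  then obtain h \<phi> where rep: "\<And>n. represents (X n) (h n) (\<phi> n)"
    by metis
  then have adm: "admissible (h n) (\<phi> n)" for n
    by (simp add: represents_def)
  note phi = admissible_L[OF adm]
  have N: "wip p (\<phi> n) (\<phi> n) \<le> M" for n
    using XM[of n] energy_eq[OF rep rep] by simp
  have M: "M \<ge> 0"
    using N[of 0] p_ip.nonneg[OF phi, of 0] by linarith
  obtain C where C: "C \<ge> 0" "\<And>v h \<phi>. v \<in> verts G \<Longrightarrow> admissible h \<phi> \<Longrightarrow> (h v)\<^sup>2 \<le> C * wip p \<phi> \<phi>"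
    using vertex_bound by blast
  obtain K where K: "K \<ge> 0" "\<And>h \<phi> e x. admissible h \<phi> \<Longrightarrow> e \<in> arcs G \<Longrightarrow> x \<in> {0<..<len e} \<Longrightarrow>
     (synth h \<phi> e x)\<^sup>2 \<le> K * wip p \<phi> \<phi> * ((x powr (\<beta> - 1))\<^sup>2 + 1)"
    using synth_bound by blast
  define D where "D e = len e powr (2 * \<beta> - 1) / (2 * \<beta> - 1) / (Gamma \<beta>)\<^sup>2 * (M / a0)" for e
  have D: "D e \<ge> 0" for e
    using beta a0_pos M by (simp add: D_def)
  \<comment> \<open>Vertex values are stored at the point \<open>0\<close> of an edge, where a fractional integral carries no information.\<close>
  define F where "F n ex = (if snd ex = 0 then h n (tail G (fst ex)) else frac_integral \<beta> (\<phi> n (fst ex)) (snd ex))"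
    for n and ex :: "'e \<times> real"
  define S where "S = {(e, q). e \<in> arcs G \<and> q \<in> \<rat> \<and> 0 \<le> q \<and> q < len e}"
  have "countable S"
    by (rule countable_subset[of _ "arcs G \<times> \<rat>"]) (auto simp: S_def countable_rat countable_finite)
  moreover have "norm (F n ex) \<le> sqrt (C * M + sum D (arcs G))" if exS: "ex \<in> S" for n ex
  proof -
    obtain e q where ex: "ex = (e, q)" "e \<in> arcs G" "0 \<le> q" "q < len e"
      using exS by (auto simp: S_def)
    have 1: "(h n (tail G e))\<^sup>2 \<le> C * M"
      using C(2)[OF tail_in_verts[OF ex(2)] adm, of n] mult_left_mono[OF N C(1), of n] by linarith
    have "(frac_integral \<beta> (\<phi> n e) q)\<^sup>2 \<le> len e powr (2 * \<beta> - 1) / (2 * \<beta> - 1) / (Gamma \<beta>)\<^sup>2 * (wip p (\<phi> n) (\<phi> n) / a0)"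
      using ex by (intro frac_edge_bound phi) auto
    also have "\<dots> \<le> D e"
      unfolding D_def using N[of n] beta a0_pos by (intro mult_left_mono divide_right_mono) auto
    also have "D e \<le> sum D (arcs G)"
      using D ex by (intro member_le_sum) auto
    finally have 2: "(frac_integral \<beta> (\<phi> n e) q)\<^sup>2 \<le> sum D (arcs G)" .
    have "(F n ex)\<^sup>2 \<le> C * M + sum D (arcs G)"
      using 1 2 C(1) M D by (auto simp: F_def ex add_increasing add_increasing2 sum_nonneg)
    then show ?thesis
      using real_sqrt_le_mono by fastforce
  qed
  ultimately have "\<exists>k. strict_mono (k :: nat \<Rightarrow> nat) \<and> (\<forall>ex\<in>S. \<exists>l. (\<lambda>n. F (k n) ex) \<longlonglongrightarrow> l)"
    by (rule function_convergent_subsequence[of S F]) blast+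
  then obtain k where k: "strict_mono (k :: nat \<Rightarrow> nat)" "\<And>ex. ex \<in> S \<Longrightarrow> \<exists>l. (\<lambda>n. F (k n) ex) \<longlonglongrightarrow> l"
    by blast
  have conv: "convergent (\<lambda>n. synth (h (k n)) (\<phi> (k n)) e x)" if e: "e \<in> arcs G" and x: "x \<in> {0<..<len e}" for e x
  proof -
    have "(e, 0) \<in> S"
      using e len_pos by (auto simp: S_def)
    then have tail: "convergent (\<lambda>n. h (k n) (tail G e))"
      using k(2)[of "(e, 0)"] by (simp add: F_def convergent_def)
    have "Cauchy (\<lambda>n. frac_integral \<beta> (\<phi> (k n) e) x)"
    proof (rule metric_CauchyI)
      fix \<epsilon> :: real assume \<epsilon>: "\<epsilon> > 0"
      have "((\<lambda>q. 2 * (x - q) powr (2 * \<beta> - 1) / (2 * \<beta> - 1) / (Gamma \<beta>)\<^sup>2 * (M / a0))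
          \<longlongrightarrow> 2 * (x - x) powr (2 * \<beta> - 1) / (2 * \<beta> - 1) / (Gamma \<beta>)\<^sup>2 * (M / a0)) (at_left x)"
        using beta less_imp_neq[OF Gamma_pos] by (intro tendsto_intros) (auto simp: eventually_at_filter)
      then have "\<forall>\<^sub>F q in at_left x. 2 * (x - q) powr (2 * \<beta> - 1) / (2 * \<beta> - 1) / (Gamma \<beta>)\<^sup>2 * (M / a0) < (\<epsilon> / 3)\<^sup>2"
        using \<epsilon> by (intro order_tendstoD) auto
      then obtain b where b: "b < x"
        "\<And>q. b < q \<Longrightarrow> q < x \<Longrightarrow> 2 * (x - q) powr (2 * \<beta> - 1) / (2 * \<beta> - 1) / (Gamma \<beta>)\<^sup>2 * (M / a0) < (\<epsilon> / 3)\<^sup>2"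
        by (auto simp: eventually_at_left_field)
      \<comment> \<open>Equicontinuity: a rational point \<open>q\<close> at which the values are uniformly close to those at \<open>x\<close>.\<close>
      obtain q where q: "q \<in> \<rat>" "max 0 b < q" "q < x"
        using Rats_dense_in_real[of "max 0 b" x] b x by auto
      have close: "\<bar>frac_integral \<beta> (\<phi> n e) x - frac_integral \<beta> (\<phi> n e) q\<bar> < \<epsilon> / 3" for n
      proof -
        have "(frac_integral \<beta> (\<phi> n e) x - frac_integral \<beta> (\<phi> n e) q)\<^sup>2
            \<le> 2 * \<bar>x - q\<bar> powr (2 * \<beta> - 1) / (2 * \<beta> - 1) / (Gamma \<beta>)\<^sup>2 * (wip p (\<phi> n) (\<phi> n) / a0)"
          using q x by (intro frac_edge_Hoelder phi e) auto
        also have "\<dots> \<le> 2 * (x - q) powr (2 * \<beta> - 1) / (2 * \<beta> - 1) / (Gamma \<beta>)\<^sup>2 * (M / a0)"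
          using N[of n] q beta a0_pos by (simp add: mult_left_mono divide_right_mono)
        also have "\<dots> < (\<epsilon> / 3)\<^sup>2"
          using b(2)[of q] q by simp
        finally show ?thesis
          using \<epsilon> power2_less_imp_less[of "\<bar>frac_integral \<beta> (\<phi> n e) x - frac_integral \<beta> (\<phi> n e) q\<bar>" "\<epsilon> / 3"] by simp
      qed
      have "(e, q) \<in> S"
        using e q x by (auto simp: S_def)
      then have "convergent (\<lambda>n. frac_integral \<beta> (\<phi> (k n) e) q)"
        using k(2)[of "(e, q)"] q by (simp add: F_def convergent_def)
      then have "Cauchy (\<lambda>n. frac_integral \<beta> (\<phi> (k n) e) q)"
        by (rule convergent_Cauchy)
      then obtain n0 where n0: "\<And>m n. m \<ge> n0 \<Longrightarrow> n \<ge> n0 \<Longrightarrow> dist (frac_integral \<beta> (\<phi> (k m) e) q) (frac_integral \<beta> (\<phi> (k n) e) q) < \<epsilon> / 3"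
        using metric_CauchyD[of _ "\<epsilon> / 3"] \<epsilon> by force
      show "\<exists>n0. \<forall>m\<ge>n0. \<forall>n\<ge>n0. dist (frac_integral \<beta> (\<phi> (k m) e) x) (frac_integral \<beta> (\<phi> (k n) e) x) < \<epsilon>"
      proof (intro exI allI impI)
        fix m n assume "m \<ge> n0" "n \<ge> n0"
        then show "dist (frac_integral \<beta> (\<phi> (k m) e) x) (frac_integral \<beta> (\<phi> (k n) e) x) < \<epsilon>"
          using n0[of m n] close[of "k m"] close[of "k n"] unfolding dist_real_def by linarith
      qed
    qed
    then have "convergent (\<lambda>n. frac_integral \<beta> (\<phi> (k n) e) x)"
      by (rule Cauchy_convergent)
    with tail show ?thesis
      unfolding synth_def divide_inverse by (intro convergent_add convergent_mult convergent_const)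
  qed
  define W where "W e x = lim (\<lambda>n. synth (h (k n)) (\<phi> (k n)) e x)" for e x
  have lim: "(\<lambda>n. synth (h (k n)) (\<phi> (k n)) e x) \<longlonglongrightarrow> W e x" if "e \<in> arcs G" "x \<in> {0<..<len e}" for e x
    unfolding W_def using conv[OF that] by (simp add: convergent_LIMSEQ_iff)
  have synth_le: "(synth (h n) (\<phi> n) e x)\<^sup>2 \<le> K * M * ((x powr (\<beta> - 1))\<^sup>2 + 1)" if "e \<in> arcs G" "x \<in> {0<..<len e}" for n e x
  proof -
    have "K * wip p (\<phi> n) (\<phi> n) * ((x powr (\<beta> - 1))\<^sup>2 + 1) \<le> K * M * ((x powr (\<beta> - 1))\<^sup>2 + 1)"
      using N K(1) by (intro mult_right_mono mult_left_mono) auto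
    then show ?thesis
      using K(2)[OF adm that, of n] by linarith
  qed
  have W_le: "(W e x)\<^sup>2 \<le> K * M * ((x powr (\<beta> - 1))\<^sup>2 + 1)" if "e \<in> arcs G" "x \<in> {0<..<len e}" for e x
    using synth_le[OF that] by (intro LIMSEQ_le_const2[OF tendsto_power[OF lim[OF that]]]) auto
  have synth_meas: "synth (h n) (\<phi> n) e \<in> borel_measurable (Leb (len e))" if "e \<in> arcs G" for n e
    using phi_L2[OF synth_L[OF phi] that] by (rule L2_measurable)
  have W_meas: "W e \<in> borel_measurable (Leb (len e))" if "e \<in> arcs G" for e
    by (rule borel_measurable_LIMSEQ_metric[of "\<lambda>n. synth (h (k n)) (\<phi> (k n)) e"]) (use synth_meas lim that in auto)
  have W_L: "W \<in> L"
    unfolding L2_graph_iff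
  proof
    fix e assume e: "e \<in> arcs G"
    have "integrable (Leb (len e)) (\<lambda>x. (W e x)\<^sup>2)"
    proof (rule Bochner_Integration.integrable_bound)
      show "integrable (Leb (len e)) (\<lambda>x. K * M * ((x powr (\<beta> - 1))\<^sup>2 + 1))"
        using majorant_integrable[OF e] by (rule integrable_mult_right)
      show "AE x in Leb (len e). norm ((W e x)\<^sup>2) \<le> norm (K * M * ((x powr (\<beta> - 1))\<^sup>2 + 1))"
        using W_le[OF e] by (intro AE_I2) force
    qed (use W_meas[OF e] in measurable)
    then show "W e \<in> L2_space (Leb (len e))"
      using W_meas[OF e] by (simp add: L2_space_def)
  qed
  have edge_conv: "(\<lambda>n. LINT x|Leb (len e). (X (k n) e x - W e x)\<^sup>2) \<longlonglongrightarrow> 0" if e: "e \<in> arcs G" for e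
  proof -
    have X_ae: "AE x in Leb (len e). x \<in> {0<..<len e} \<and> (\<forall>n. X n e x = synth (h n) (\<phi> n) e x)"
      using rep e by (auto simp: represents_def AE_all_countable)
    have "(\<lambda>n. LINT x|Leb (len e). (X (k n) e x - W e x)\<^sup>2) \<longlonglongrightarrow> (LINT x|Leb (len e). 0)"
    proof (rule integral_dominated_convergence)
      show "(\<lambda>x. (X (k n) e x - W e x)\<^sup>2) \<in> borel_measurable (Leb (len e))" for n
        using rep[of "k n"] e W_meas[OF e] by (auto simp: represents_def)
      show "integrable (Leb (len e)) (\<lambda>x. 4 * (K * M * ((x powr (\<beta> - 1))\<^sup>2 + 1)))"
        using majorant_integrable[OF e] by (intro integrable_mult_right)
      show "AE x in Leb (len e). (\<lambda>n. (X (k n) e x - W e x)\<^sup>2) \<longlonglongrightarrow> 0"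
        using X_ae
      proof eventually_elim
        case (elim x)
        then have "(\<lambda>n. (synth (h (k n)) (\<phi> (k n)) e x - W e x)\<^sup>2) \<longlonglongrightarrow> (W e x - W e x)\<^sup>2"
          by (intro tendsto_intros lim e) auto
        then show ?case
          using elim by simp
      qed
      show "AE x in Leb (len e). norm ((X (k n) e x - W e x)\<^sup>2) \<le> 4 * (K * M * ((x powr (\<beta> - 1))\<^sup>2 + 1))" for n
        using X_ae
      proof eventually_elim
        case (elim x)
        then have x: "x \<in> {0<..<len e}" and eq: "X (k n) e x = synth (h (k n)) (\<phi> (k n)) e x"
          by auto
        have "(s - t)\<^sup>2 \<le> 2 * s\<^sup>2 + 2 * t\<^sup>2" for s t :: real
          using zero_le_power2[of "s + t"] by (simp add: power2_eq_square algebra_simps)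
        from this[of "synth (h (k n)) (\<phi> (k n)) e x" "W e x"] show ?case
          using synth_le[OF e x, of "k n"] W_le[OF e x] unfolding eq by simp
      qed
    qed simp
    then show ?thesis by simp
  qed
  have X_L: "X n \<in> L" for n
    using XV V_subset_L by auto
  have "r_ip.sq_tendsto (X \<circ> k) W"
    unfolding r_ip.sq_tendsto_def
  proof (rule tendsto_sandwich[of "\<lambda>_. 0"])
    show "\<forall>\<^sub>F n in sequentially. wip r ((X \<circ> k) n - W) ((X \<circ> k) n - W)
        \<le> R1 * (\<Sum>e\<in>arcs G. LINT x|Leb (len e). (X (k n) e x - W e x)\<^sup>2)"
      using wip_le[OF weight_r, of "X (k n) - W" for n] X_L W_L by (intro always_eventually allI) simp
    show "(\<lambda>n. R1 * (\<Sum>e\<in>arcs G. LINT x|Leb (len e). (X (k n) e x - W e x)\<^sup>2)) \<longlonglongrightarrow> 0"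
      using edge_conv by (intro tendsto_mult_right_zero tendsto_null_sum) auto
  qed (use X_L W_L in \<open>auto intro!: always_eventually r_ip.nonneg\<close>)
  then have "r_ip.sq_Cauchy (X \<circ> k)"
    using X_L W_L by (intro r_ip.sq_tendsto_imp_sq_Cauchy[of _ W]) auto
  then show ?thesis
    using k(1) by blast
qed

section \<open>Completeness and totality\<close>

text \<open>
  The densities \<open>\<phi> n\<close> converge in the weighted \<open>L\<^sub>2\<close> space and the vertex values converge by the vertex
  bound applied to differences. The increment condition along an edge passes to the limit because
  the integral over the edge is a bounded functional.
\<close>

lemma V_complete: "form.sq_complete"
  unfolding form.sq_complete_def
proof (intro allI impI, elim conjE)
  fix X assume XV: "\<forall>n. X n \<in> V" and Cauchy: "form.sq_Cauchy X"
  have "\<forall>n. \<exists>h \<phi>. represents (X n) h \<phi>"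
    using XV V_imp_represents by metis
  then obtain h \<phi> where rep: "\<And>n. represents (X n) (h n) (\<phi> n)"
    by metis
  then have adm: "admissible (h n) (\<phi> n)" for n
    by (simp add: represents_def)
  note phi = admissible_L[OF adm]
  have energy_diff: "energy (X m - X n) (X m - X n) = wip p (\<phi> m - \<phi> n) (\<phi> m - \<phi> n)" for m n
    by (rule energy_eq[OF represents_diff[OF rep rep] represents_diff[OF rep rep]])
  have "p_ip.sq_Cauchy \<phi>"
    using Cauchy by (simp add: p_ip.sq_Cauchy_def form.sq_Cauchy_def energy_diff)
  then obtain \<Phi> where Phi: "\<Phi> \<in> L" "p_ip.sq_tendsto \<phi> \<Phi>"
    using wip_complete[OF weight_p, unfolded p_ip.sq_complete_def, THEN spec, of \<phi>] phi by auto
  obtain C where C: "C \<ge> 0" "\<And>v h \<phi>. v \<in> verts G \<Longrightarrow> admissible h \<phi> \<Longrightarrow> (h v)\<^sup>2 \<le> C * wip p \<phi> \<phi>"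
    using vertex_bound by blast
  define H where "H v = lim (\<lambda>n. h n v)" for v
  have H: "(\<lambda>n. h n v) \<longlonglongrightarrow> H v" if v: "v \<in> verts G" for v
  proof -
    have "Cauchy (\<lambda>n. h n v)"
    proof (rule metric_CauchyI)
      fix \<epsilon> :: real assume \<epsilon>: "\<epsilon> > 0"
      define \<delta> where "\<delta> = \<epsilon>\<^sup>2 / (C + 1)"
      have \<delta>: "\<delta> > 0" "C * \<delta> < \<epsilon>\<^sup>2"
        using \<epsilon> C(1) by (auto simp: \<delta>_def divide_simps)
      then obtain N where N: "\<And>m n. m \<ge> N \<Longrightarrow> n \<ge> N \<Longrightarrow> energy (X m - X n) (X m - X n) < \<delta>"
        using Cauchy unfolding form.sq_Cauchy_def by meson
      show "\<exists>N. \<forall>m\<ge>N. \<forall>n\<ge>N. dist (h m v) (h n v) < \<epsilon>"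
      proof (intro exI allI impI)
        fix m n assume mn: "m \<ge> N" "n \<ge> N"
        have "admissible (\<lambda>v. h m v - h n v) (\<phi> m - \<phi> n)"
          using represents_diff[OF rep[of m] rep[of n]] by (simp add: represents_def)
        from C(2)[OF v this] have "(h m v - h n v)\<^sup>2 \<le> C * energy (X m - X n) (X m - X n)"
          by (simp add: energy_diff)
        also have "\<dots> \<le> C * \<delta>"
          using N[OF mn] C(1) by (intro mult_left_mono) auto
        finally have "\<bar>h m v - h n v\<bar>\<^sup>2 < \<epsilon>\<^sup>2"
          using \<delta>(2) by simp
        then show "dist (h m v) (h n v) < \<epsilon>"
          unfolding dist_real_def using \<epsilon> by (intro power2_less_imp_less[of _ \<epsilon>]) auto
      qed
    qed
    then show ?thesis
      unfolding H_def by (simp add: Cauchy_convergent_iff convergent_LIMSEQ_iff)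
  qed
  have adm_lim: "admissible H \<Phi>"
    unfolding admissible_def
  proof (intro conjI ballI Phi(1))
    fix v assume v: "v \<in> boundary G"
    then have "(\<lambda>n. h n v) = (\<lambda>n. 0)"
      using adm by (simp add: admissible_def)
    then show "H v = 0"
      using H[of v] v by (simp add: boundary_def LIMSEQ_const_iff)
  next
    fix e assume e: "e \<in> arcs G"
    have "(\<lambda>n. (LINT t|Leb (len e). \<phi> n e t) - (LINT t|Leb (len e). \<Phi> e t)) \<longlonglongrightarrow> 0"
    proof -
      have eq: "(LINT t|Leb (len e). \<phi> n e t) - (LINT t|Leb (len e). \<Phi> e t) = (LINT t|Leb (len e). (\<phi> n - \<Phi>) e t)" for n
        using phi_L2[OF phi e] phi_L2[OF Phi(1) e] by (simp add: L2_integrable[OF finite_measure_Leb])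
      have "(\<lambda>n. (LINT t|Leb (len e). (\<phi> n - \<Phi>) e t)\<^sup>2) \<longlonglongrightarrow> 0"
      proof (rule tendsto_sandwich[of "\<lambda>_. 0"])
        show "\<forall>\<^sub>F n in sequentially. (LINT t|Leb (len e). (\<phi> n - \<Phi>) e t)\<^sup>2 \<le> len e / a0 * wip p (\<phi> n - \<Phi>) (\<phi> n - \<Phi>)"
          by (intro always_eventually allI edge_integral_bound[of "\<phi> n - \<Phi>" for n] p_ip.mem(3) phi Phi(1) e)
        show "(\<lambda>n. len e / a0 * wip p (\<phi> n - \<Phi>) (\<phi> n - \<Phi>)) \<longlonglongrightarrow> 0"
          using Phi(2) unfolding p_ip.sq_tendsto_def by (rule tendsto_mult_right_zero)
      qed auto
      from tendsto_real_sqrt[OF this] show ?thesis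
        unfolding eq by (simp add: tendsto_rabs_zero_iff fun_diff_def)
    qed
    then have "(\<lambda>n. LINT t|Leb (len e). \<phi> n e t) \<longlonglongrightarrow> (LINT t|Leb (len e). \<Phi> e t)"
      by (simp add: LIM_zero_iff)
    then have "(\<lambda>n. h n (tail G e) + (LINT t|Leb (len e). \<phi> n e t)) \<longlonglongrightarrow> H (tail G e) + (LINT t|Leb (len e). \<Phi> e t)"
      using e by (intro tendsto_add H) auto
    moreover have "h n (tail G e) + (LINT t|Leb (len e). \<phi> n e t) = h n (head G e)" for n
      using adm[of n] e by (simp add: admissible_def)
    ultimately show "H (head G e) = H (tail G e) + (LINT t|Leb (len e). \<Phi> e t)"
      using H[of "head G e"] e by (simp add: LIMSEQ_unique)
  qed
  define x where "x = synth H \<Phi>"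
  have rep_x: "represents x H \<Phi>"
    unfolding x_def by (rule represents_synth[OF adm_lim])
  have "energy (X n - x) (X n - x) = wip p (\<phi> n - \<Phi>) (\<phi> n - \<Phi>)" for n
    by (rule energy_eq[OF represents_diff[OF rep rep_x] represents_diff[OF rep rep_x]])
  then have "form.sq_tendsto X x"
    using Phi(2) by (simp add: form.sq_tendsto_def p_ip.sq_tendsto_def)
  then show "\<exists>x\<in>V. form.sq_tendsto X x"
    using represents_imp_V[OF rep_x] by blast
qed

text \<open>
  It suffices to test with functions that live on one edge and have zero vertex values: these are the
  fractional integrals of densities of mean zero on that edge, to which \<open>r * z\<close> is then orthogonal.
\<close>

lemma V_total:
  assumes z: "z \<in> L" and perp: "\<And>w. w \<in> V \<Longrightarrow> wip r z w = 0"
  shows "wip r z z = 0"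
proof -
  have "AE x in Leb (len e). z e x = 0" if e: "e \<in> arcs G" for e
  proof -
    have "AE x in Leb (len e). r e x * z e x = 0"
    proof (rule frac_integral_mean_zero_total[OF beta len_pos[OF e] weighted_L2[OF weight_r z e]])
      fix \<phi> :: "real \<Rightarrow> real"
      assume phi: "\<phi> \<in> L2_space (Leb (len e))" and mean: "(LINT t|Leb (len e). \<phi> t) = 0"
      define \<Phi> where "\<Phi> d = (if d = e then \<phi> else (\<lambda>_. 0))" for d
      have "(\<lambda>_. 0) \<in> L2_space M" for M :: "real measure"
        by (simp add: L2_space_def)
      then have "\<Phi> \<in> L"
        using phi by (simp add: L2_graph_iff \<Phi>_def)
      then have "admissible (\<lambda>_. 0) \<Phi>"
        using mean by (simp add: admissible_def \<Phi>_def)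
      then have "wip r z (synth (\<lambda>_. 0) \<Phi>) = 0"
        by (intro perp represents_imp_V[OF represents_synth])
      also have "wip r z (synth (\<lambda>_. 0) \<Phi>)
          = (\<Sum>d\<in>arcs G. if d = e then LINT x|Leb (len e). r e x * z e x * frac_integral \<beta> \<phi> x else 0)"
        unfolding wip_eq by (intro sum.cong refl) (auto simp: synth_def \<Phi>_def frac_integral_def)
      finally show "(LINT x|Leb (len e). r e x * z e x * frac_integral \<beta> \<phi> x) = 0"
        using e by simp
    qed
    moreover have "AE x in Leb (len e). x \<in> {0<..<len e}"
      by (rule AE_I2) simp
    ultimately show ?thesis
    proof eventually_elim
      case (elim x)
      then show ?case
        using weight_bounds[OF weight_r e, of x] weight_pos[OF weight_r] by auto
    qed
  qed
  then show ?thesis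
    using wip_null_iff[OF weight_r z] by (simp add: ae_eq_def)
qed

text \<open>
  Indicators of the disjoint intervals \<open>(l / (k + 2), l / (k + 1))\<close> of one edge.
\<close>

lemma L_infinite_dimensional:
  "\<exists>f :: nat \<Rightarrow> 'e gfun. (\<forall>k. f k \<in> L \<and> 0 < wip r (f k) (f k)) \<and> (\<forall>j k. j \<noteq> k \<longrightarrow> wip r (f j) (f k) = 0)"
proof -
  obtain e0 where e0: "e0 \<in> arcs G"
    by (rule arc_exists)
  define l where "l = len e0"
  have l: "l > 0"
    unfolding l_def by (rule len_pos[OF e0])
  define I where "I k = {l / real (k + 2)<..<l / real (k + 1)}" for k
  define f where "f k e x = (if e = e0 then indicator (I k) x else 0 :: real)" for k e x
  have I_meas: "I k \<in> sets lebesgue" "I k \<subseteq> {0<..<l}" for k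
  proof -
    have "l / real (k + 1) \<le> l / 1"
      by (rule divide_left_mono) (use l in auto)
    moreover have "0 < l / real (k + 2)"
      using l by simp
    ultimately show "I k \<subseteq> {0<..<l}"
      by (auto simp: I_def)
  qed (simp add: I_def)
  have fL: "f k \<in> L" for k
    unfolding L2_graph_iff
  proof
    fix e assume "e \<in> arcs G"
    show "f k e \<in> L2_space (Leb (len e))"
      using I_meas(1)[of k]
      by (intro L2_bounded[OF finite_measure_Leb, of _ _ 1]) (auto simp: f_def[abs_def] indicator_def intro!: measurable_restrict_space1)
  qed
  have "0 < wip r (f k) (f k)" for k
  proof -
    have "(LINT x|Leb l. (f k e0 x)\<^sup>2) = (LINT x|Leb l. indicator (I k) x)"
      by (intro Bochner_Integration.integral_cong refl) (auto simp: f_def indicator_def)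
    also have "\<dots> = measure lebesgue (I k)"
      using I_meas[of k] by (simp add: measure_restrict_space Int_absorb2 sets_restrict_space_iff)
    also have "\<dots> > 0"
    proof -
      have "l / real (k + 2) < l / real (k + 1)"
        using l by (intro divide_strict_left_mono) auto
      then show ?thesis
        by (simp add: I_def)
    qed
    finally have "0 < R0 * (LINT x|Leb (len e0). (f k e0 x)\<^sup>2)"
      using weight_pos[OF weight_r] by (simp add: l_def)
    then show ?thesis
      using wip_edge_le[OF weight_r fL e0, of k] by linarith
  qed
  moreover have "wip r (f j) (f k) = 0" if "j \<noteq> k" for j k
  proof -
    have *: "I j \<inter> I k = {}" if "j < k" for j k
    proof -
      have "l / real (k + 1) \<le> l / real (j + 2)"
        using that l by (intro divide_left_mono) auto
      then show ?thesis
        by (auto simp: I_def)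
    qed
    have "I j \<inter> I k = {}"
      using *[of j k] *[of k j] \<open>j \<noteq> k\<close> by (cases j k rule: linorder_cases) auto
    then have "r e x * f j e x * f k e x = 0" for e x
      by (auto simp: f_def indicator_def)
    then show ?thesis
      unfolding wip_eq by (simp only:) simp
  qed
  ultimately show ?thesis
    using fL by blast
qed

section \<open>Eigenvalues and eigenfunctions\<close>

lemma compact_form_pair_exists: "\<exists>C. compact_form_pair V L energy (wip r) C"
proof -
  obtain C where C: "\<forall>u\<in>V. wip r u u \<le> C * energy u u"
    using energy_dominates by blast
  have "compact_form_pair V L energy (wip r) C"
  proof unfold_locales
    show "\<exists>s. strict_mono (s :: nat \<Rightarrow> nat) \<and> r_ip.sq_Cauchy (X \<circ> s)"
      if "\<And>n. X n \<in> V" "\<And>n. energy (X n) (X n) \<le> M" for X M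
      using that by (rule compact_embedding)
  qed (use C V_subset_L V_complete wip_complete[OF weight_r] V_total L_infinite_dimensional in auto)
  then show ?thesis ..
qed

lemma generalized_solution_iff:
  "generalized_solution G len \<beta> p r \<mu> u \<longleftrightarrow> u \<in> V \<and> (\<forall>w\<in>V. energy u w = \<mu> * wip r u w)"
  by (simp add: generalized_solution_def energy_def weighted_inner_def L2_inner_def)

lemma eigenfunction_iff:
  "eigenfunction G len \<beta> p r \<mu> u \<longleftrightarrow> u \<in> V \<and> (\<forall>w\<in>V. energy u w = \<mu> * wip r u w) \<and> wip r u u \<noteq> 0"
  using wip_null_iff[OF weight_r] V_subset_L
  by (auto simp: eigenfunction_def generalized_solution_iff)

lemma weighted_norm_eq: "weighted_norm G len r f = sqrt (wip r f f)"
  by (simp add: weighted_norm_def weighted_inner_def power2_eq_square mult.assoc)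

lemma combination_eq: "(\<lambda>e x. \<Sum>j\<in>I. c j * v j e x) = (\<Sum>j\<in>I. c j *\<^sub>R v j)" for v :: "nat \<Rightarrow> 'e gfun"
  by (simp add: fun_eq_iff sum_fun_apply)

theorem spectral_theorem:
  "\<exists>(lam :: nat \<Rightarrow> real) (u :: nat \<Rightarrow> 'e gfun).
    (\<forall>k. eigenfunction G len \<beta> p r (lam k) (u k)) \<and>
    range lam = {\<mu>. eigenvalue G len \<beta> p r \<mu>} \<and>
    (\<forall>\<mu>. eigenvalue G len \<beta> p r \<mu> \<longrightarrow>
       finite {k. lam k = \<mu>} \<and> has_multiplicity G len \<beta> p r \<mu> (card {k. lam k = \<mu>})) \<and>
    0 < lam 0 \<and> (\<forall>k. lam k \<le> lam (Suc k)) \<and>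
    filterlim lam at_top sequentially \<and>
    complete_orthonormal_basis G len r u"
proof -
  obtain C where "compact_form_pair V L energy (wip r) C"
    using compact_form_pair_exists by blast
  then interpret S: compact_form_pair V L energy "wip r" C .
  obtain lam u where sp: "S.spectral_sequence lam u"
    using S.spectral_sequence_exists by blast
  note sp' = sp[unfolded S.spectral_sequence_def]
  interpret U: orthonormal L "wip r" u UNIV
    using sp' V_subset_L by unfold_locales auto
  have eig: "eigenfunction G len \<beta> p r (lam k) (u k)" for k
    using sp' by (simp add: eigenfunction_iff)
  have expand: "finite {k. lam k = \<mu>}"
    "ae_eq G len w (\<Sum>k | lam k = \<mu>. wip r w (u k) *\<^sub>R u k)"
    if w: "generalized_solution G len \<beta> p r \<mu> w" for \<mu> w
  proof -
    have wV: "w \<in> V" "\<And>v. v \<in> V \<Longrightarrow> energy w v = \<mu> * wip r w v"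
      using w by (auto simp: generalized_solution_iff)
    note ex = S.eigenvector_expansion[OF sp wV]
    show "finite {k. lam k = \<mu>}"
      using ex(1) by simp
    have "w - (\<Sum>k | lam k = \<mu>. wip r w (u k) *\<^sub>R u k) \<in> L"
      using wV(1) sp' by (intro r_ip.mem r_ip.mem_sum) auto
    then have "ae_eq G len (w - (\<Sum>k | lam k = \<mu>. wip r w (u k) *\<^sub>R u k)) (\<lambda>e x. 0)"
      using ex(2) wip_null_iff[OF weight_r] by blast
    then show "ae_eq G len w (\<Sum>k | lam k = \<mu>. wip r w (u k) *\<^sub>R u k)"
      by (auto simp: ae_eq_def)
  qed
  have ev: "\<exists>k. lam k = \<mu>" if "eigenvalue G len \<beta> p r \<mu>" for \<mu>
  proof (rule ccontr)
    assume "\<nexists>k. lam k = \<mu>"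
    moreover obtain w where w: "eigenfunction G len \<beta> p r \<mu> w"
      using \<open>eigenvalue G len \<beta> p r \<mu>\<close> unfolding eigenvalue_def by blast
    ultimately have "ae_eq G len w (\<lambda>e x. 0)"
      using expand(2)[of \<mu> w] by (simp add: eigenfunction_def zero_fun_def)
    then show False
      using w by (simp add: eigenfunction_def)
  qed
  have mult: "has_multiplicity G len \<beta> p r \<mu> (card {k. lam k = \<mu>})" if fin: "finite {k. lam k = \<mu>}" for \<mu>
  proof -
    define m where "m = card {k. lam k = \<mu>}"
    obtain g where g: "bij_betw g {..<m} {k. lam k = \<mu>}"
      using ex_bij_betw_nat_finite[OF fin] unfolding m_def atLeast0LessThan by blast
    have lam_g: "lam (g j) = \<mu>" if "j < m" for j
      using bij_betwE[OF g] that by auto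
    have inj: "inj_on g {..<m}"
      using g by (simp add: bij_betw_def)
    show ?thesis
      unfolding has_multiplicity_def has_dim_ae_def m_def[symmetric]
    proof (intro exI[of _ "\<lambda>j. u (g j)"] conjI allI impI ballI)
      show "u (g j) \<in> {u. generalized_solution G len \<beta> p r \<mu> u}" if "j < m" for j
        using eig[of "g j"] lam_g[OF that] by (simp add: eigenfunction_def)
    next
      fix c :: "nat \<Rightarrow> real" and j
      assume ae: "ae_eq G len (\<lambda>e x. \<Sum>j<m. c j * u (g j) e x) (\<lambda>e x. 0)" and j: "j < m"
      define P where "P = (\<Sum>j<m. c j *\<^sub>R u (g j))"
      have PL: "P \<in> L"
        unfolding P_def using sp' V_subset_L by (intro r_ip.mem_sum r_ip.mem) auto
      have "wip r P P = 0"
        using ae wip_null_iff[OF weight_r PL] by (simp add: combination_eq P_def)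
      then have "wip r P (u (g j)) = 0"
        using sp' V_subset_L PL by (auto intro: r_ip.null_left)
      moreover have "P = (\<Sum>k\<in>g ` {..<m}. c (the_inv_into {..<m} g k) *\<^sub>R u k)"
        unfolding P_def by (subst sum.reindex[OF inj]) (auto simp: the_inv_into_f_f[OF inj] intro!: sum.cong)
      ultimately show "c j = 0"
        using U.inner_combination[of "g ` {..<m}" "g j" "\<lambda>k. c (the_inv_into {..<m} g k)"] j
        by (simp add: the_inv_into_f_f[OF inj])
    next
      fix w assume "w \<in> {u. generalized_solution G len \<beta> p r \<mu> u}"
      then have "ae_eq G len w (\<Sum>k | lam k = \<mu>. wip r w (u k) *\<^sub>R u k)"
        by (intro expand) simp
      also have "(\<Sum>k | lam k = \<mu>. wip r w (u k) *\<^sub>R u k) = (\<Sum>j<m. wip r w (u (g j)) *\<^sub>R u (g j))"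
        by (rule sum.reindex_bij_betw[OF g, symmetric])
      finally have "ae_eq G len w (\<lambda>e x. \<Sum>j<m. wip r w (u (g j)) * u (g j) e x)"
        by (simp add: combination_eq)
      then show "\<exists>c. ae_eq G len w (\<lambda>e x. \<Sum>j<m. c j * u (g j) e x)"
        by (rule exI[where x = "\<lambda>j. wip r w (u (g j))"])
    qed
  qed
  have basis: "complete_orthonormal_basis G len r u"
    unfolding complete_orthonormal_basis_def
  proof (intro conjI allI ballI)
    show "u k \<in> L" for k
      using sp' V_subset_L by auto
    show "wip r (u j) (u k) = (if j = k then 1 else 0)" for j k
      using sp' by simp
    fix f assume f: "f \<in> L"
    define P where "P N = (\<Sum>k<N. wip r f (u k) *\<^sub>R u k)" for N
    have PL: "P N \<in> L" for N
      unfolding P_def using sp' V_subset_L by (intro r_ip.mem_sum r_ip.mem) auto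
    have "(\<lambda>N. wip r (P N - f) (P N - f)) \<longlonglongrightarrow> 0"
      using sp' f by (simp add: r_ip.sq_tendsto_def P_def)
    moreover have "wip r (P N - f) (P N - f) = wip r (f - P N) (f - P N)" for N
      using f PL by (simp add: r_ip.linear algebra_simps)
    ultimately have "(\<lambda>N. wip r (f - P N) (f - P N)) \<longlonglongrightarrow> 0"
      by simp
    from tendsto_real_sqrt[OF this]
    have "(\<lambda>N. weighted_norm G len r (f - P N)) \<longlonglongrightarrow> 0"
      by (simp add: weighted_norm_eq)
    moreover have "f - P N = (\<lambda>e x. f e x - (\<Sum>k<N. wip r f (u k) * u k e x))" for N
      unfolding P_def by (simp add: fun_eq_iff sum_fun_apply)
    ultimately show "(\<lambda>N. weighted_norm G len r (\<lambda>e x. f e x - (\<Sum>k<N. wip r f (u k) * u k e x))) \<longlonglongrightarrow> 0"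
      by simp
  qed
  have "\<mu> \<in> range lam \<longleftrightarrow> eigenvalue G len \<beta> p r \<mu>" for \<mu>
    using eig ev[of \<mu>] unfolding eigenvalue_def by blast
  then have "range lam = {\<mu>. eigenvalue G len \<beta> p r \<mu>}"
    by blast
  moreover have "finite {k. lam k = \<mu>}" if "eigenvalue G len \<beta> p r \<mu>" for \<mu>
    using that expand(1) unfolding eigenvalue_def eigenfunction_def by blast
  ultimately show ?thesis
    using eig mult basis sp' by blast
qed

end

theorem theorem1:
  fixes G :: "('v, 'e) pre_digraph" and len :: "'e \<Rightarrow> real"
    and \<beta> a0 a1 R0 R1 :: real and p r :: "'e \<Rightarrow> real \<Rightarrow> real"
  assumes "metric_graph G len"
    and "Digraph_Component.connected G"
    and "boundary G \<noteq> {}"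
    and "1 / 2 < \<beta>" and "\<beta> < 1"
    and "unif_continuous_on_edges G len p"
    and "unif_continuous_on_edges G len r"
    and "0 < a0" and "\<forall>e\<in>arcs G. \<forall>x\<in>{0<..<len e}. a0 \<le> p e x \<and> p e x \<le> a1"
    and "0 < R0" and "\<forall>e\<in>arcs G. \<forall>x\<in>{0<..<len e}. R0 \<le> r e x \<and> r e x \<le> R1"
  shows "\<exists>(lam :: nat \<Rightarrow> real) (u :: nat \<Rightarrow> 'e \<Rightarrow> real \<Rightarrow> real).
    (\<forall>k. eigenfunction G len \<beta> p r (lam k) (u k)) \<and>
    range lam = {\<mu>. eigenvalue G len \<beta> p r \<mu>} \<and>
    (\<forall>\<mu>. eigenvalue G len \<beta> p r \<mu> \<longrightarrow>
       finite {k. lam k = \<mu>} \<and> has_multiplicity G len \<beta> p r \<mu> (card {k. lam k = \<mu>})) \<and>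
    0 < lam 0 \<and> (\<forall>k. lam k \<le> lam (Suc k)) \<and>
    filterlim lam at_top sequentially \<and>
    complete_orthonormal_basis G len r u"
proof -
  interpret metric_graph G len
    by fact
  interpret fractional_graph G len \<beta> a0 a1 R0 R1 p r
    using assms by unfold_locales (auto intro: weight_of_uniformly_continuous)
  show ?thesis
    by (rule spectral_theorem)
qed

end
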